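(* Let $\Omega\subset\mathbb{R}^N$, $N\ge2$, be a bounded domain with boundary $\Gamma$ of class $C^2$ and let $z$ be any critical point in $\Omega$ of the solution $u$ of $\Delta u=N$ in $\Omega$, $u=0$ on $\Gamma$. Consider the function $h=q-u$, with $q(x)=\frac12(|x-z|^2-a)$, $a\in\mathbb{R}$, and let $\rho_i=\min_{x\in\Gamma}|x-z|$, $\rho_e=\max_{x\in\Gamma}|x-z|$. There exists a positive constant $C$ such that $$\rho_e-\rho_i\le C\,\|\nabla^2h\|_{L^2(\Omega)}^{\tau_N},$$ with the following specifications: (i) $\tau_N=1$ for $N=2$ or $3$; (ii) $\tau_4$ is arbitrarily close to one, in the sense that for any $\theta>0$ there exists a positive constant $C$ such that the inequality holds with $\tau_4=1-\theta$; (iii) $\tau_N=2/(N-2)$ for $N\ge5$. The constant $C$ depends only on $N$, $r_i$, $r_e$, $d_\Omega$, $\delta_\Gamma(z)$, and $\theta$ (the latter only in the case $N=4$).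
   Context: A domain is a connected open set. $\delta_\Gamma(x)$ is the distance from $x$ to $\Gamma$ and $d_\Omega$ is the diameter of $\Omega$; $\|\nabla^2h\|_{L^2(\Omega)}=\big(\sum_{i,j}\|h_{ij}\|_{L^2(\Omega)}^2\big)^{1/2}$. Since $\Gamma$ is of class $C^2$, $\Omega$ satisfies uniform interior and exterior sphere conditions, whose radii are $r_i$ and $r_e$: for each $p\in\Gamma$ there is a ball of radius $r_i$ contained in $\Omega$ (respectively, a ball of radius $r_e$ contained in $\mathbb{R}^N\setminus\overline\Omega$) whose closure intersects $\Gamma$ only at $p$. *)

theory Defs
  imports "HOL-Analysis.Analysis"
begin

definition partial_deriv :: "'n::finite \<Rightarrow> (real ^ 'n \<Rightarrow> real) \<Rightarrow> real ^ 'n \<Rightarrow> real" where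
  "partial_deriv i f x = frechet_derivative f (at x) (axis i 1)"

text \<open>Only used for open sets \<open>S\<close>, where it is the usual class \<open>C\<^sup>2(S)\<close>;
  no condition is imposed at the boundary of \<open>S\<close>.\<close>

definition C2_on :: "(real ^ 'n::finite) set \<Rightarrow> (real ^ 'n \<Rightarrow> real) \<Rightarrow> bool" where
  "C2_on S f \<longleftrightarrow>
     (\<forall>x\<in>S. f differentiable (at x)) \<and>
     (\<forall>i. \<forall>x\<in>S. partial_deriv i f differentiable (at x)) \<and>
     (\<forall>i j. continuous_on S (partial_deriv i (partial_deriv j f)))"

definition laplacian :: "(real ^ 'n::finite \<Rightarrow> real) \<Rightarrow> real ^ 'n \<Rightarrow> real" where
  "laplacian f x = (\<Sum>i\<in>UNIV. partial_deriv i (partial_deriv i f) x)"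

text \<open>Near each of its points the boundary is the graph, over the hyperplane orthogonal to some
  unit vector \<open>\<nu>\<close>, of a \<open>C\<^sup>2\<close> function, and the set lies locally on one side
  of the graph.  The function \<open>\<gamma>\<close> is defined on the whole space but is only evaluated at the
  projection of \<open>x\<close> onto that hyperplane.\<close>

definition C2_boundary :: "(real ^ 'n::finite) set \<Rightarrow> bool" where
  "C2_boundary \<Omega> \<longleftrightarrow>
     (\<forall>p\<in>frontier \<Omega>. \<exists>r>0. \<exists>\<nu> \<gamma>. norm \<nu> = 1 \<and> C2_on UNIV \<gamma> \<and>
        \<Omega> \<inter> ball p r = {x \<in> ball p r. \<gamma> (x - (x \<bullet> \<nu>) *\<^sub>R \<nu>) < x \<bullet> \<nu>})"

definition C2_bounded_domain :: "(real ^ 'n::finite) set \<Rightarrow> bool" where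
  "C2_bounded_domain \<Omega> \<longleftrightarrow>
     open \<Omega> \<and> connected \<Omega> \<and> \<Omega> \<noteq> {} \<and> bounded \<Omega> \<and> C2_boundary \<Omega>"

definition interior_sphere_condition :: "(real ^ 'n::finite) set \<Rightarrow> real \<Rightarrow> bool" where
  "interior_sphere_condition \<Omega> r \<longleftrightarrow> 0 < r \<and>
     (\<forall>p\<in>frontier \<Omega>. \<exists>c. ball c r \<subseteq> \<Omega> \<and> closure (ball c r) \<inter> frontier \<Omega> = {p})"

definition exterior_sphere_condition :: "(real ^ 'n::finite) set \<Rightarrow> real \<Rightarrow> bool" where
  "exterior_sphere_condition \<Omega> r \<longleftrightarrow> 0 < r \<and>
     (\<forall>p\<in>frontier \<Omega>. \<exists>c. ball c r \<subseteq> - closure \<Omega> \<and> closure (ball c r) \<inter> frontier \<Omega> = {p})"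

text \<open>Classical solutions: \<open>u\<close> is \<open>C\<^sup>2\<close> in \<open>\<Omega>\<close> and continuous up to the boundary.\<close>

definition solves_torsion_problem ::
    "(real ^ 'n::finite) set \<Rightarrow> (real ^ 'n \<Rightarrow> real) \<Rightarrow> bool" where
  "solves_torsion_problem \<Omega> u \<longleftrightarrow>
     C2_on \<Omega> u \<and> continuous_on (closure \<Omega>) u \<and>
     (\<forall>x\<in>\<Omega>. laplacian u x = real CARD('n)) \<and> (\<forall>x\<in>frontier \<Omega>. u x = 0)"

definition critical_point :: "(real ^ 'n::finite \<Rightarrow> real) \<Rightarrow> real ^ 'n \<Rightarrow> bool" where
  "critical_point u z \<longleftrightarrow> u differentiable (at z) \<and> (\<forall>i. partial_deriv i u z = 0)"

text \<open>Real powers on \<open>[0, \<infinity>]\<close>, with \<open>0\<close> and \<open>\<infinity>\<close> exchanged by negative exponents and with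
  \<open>x\<close> to the power \<open>0\<close> equal to \<open>1\<close> throughout.  (In contrast, \<open>powr\<close> on the reals has
  \<open>0 powr p = 0\<close> for all \<open>p\<close>.)\<close>

definition ennreal_powr :: "ennreal \<Rightarrow> real \<Rightarrow> ennreal" where
  "ennreal_powr x p =
     (if p = 0 then 1
      else if x = 0 then (if p < 0 then top else 0)
      else if x = top then (if p < 0 then 0 else top)
      else ennreal (enn2real x powr p))"

text \<open>The norms are valued in \<open>[0, \<infinity>]\<close>, so that a function that is not square integrable has
  norm \<open>\<infinity>\<close> instead of a default value.\<close>

definition L2_norm_on :: "(real ^ 'n::finite) set \<Rightarrow> (real ^ 'n \<Rightarrow> real) \<Rightarrow> ennreal" where
  "L2_norm_on \<Omega> f = ennreal_powr (\<integral>\<^sup>+x\<in>\<Omega>. ennreal ((f x)\<^sup>2) \<partial>lborel) (1/2)"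

definition hessian_L2_norm :: "(real ^ 'n::finite) set \<Rightarrow> (real ^ 'n \<Rightarrow> real) \<Rightarrow> ennreal" where
  "hessian_L2_norm \<Omega> h =
     ennreal_powr (\<Sum>i\<in>UNIV. \<Sum>j\<in>UNIV.
       (L2_norm_on \<Omega> (partial_deriv i (partial_deriv j h)))\<^sup>2) (1/2)"

text \<open>For bounded nonempty \<open>\<Omega>\<close> the infimum and the supremum are attained.\<close>

definition rho_i :: "(real ^ 'n::finite) set \<Rightarrow> real ^ 'n \<Rightarrow> real" where
  "rho_i \<Omega> z = (INF x\<in>frontier \<Omega>. norm (x - z))"

definition rho_e :: "(real ^ 'n::finite) set \<Rightarrow> real ^ 'n \<Rightarrow> real" where
  "rho_e \<Omega> z = (SUP x\<in>frontier \<Omega>. norm (x - z))"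

definition comparison_fun ::
    "(real ^ 'n::finite \<Rightarrow> real) \<Rightarrow> real ^ 'n \<Rightarrow> real \<Rightarrow> real ^ 'n \<Rightarrow> real" where
  "comparison_fun u z a x = 1/2 * ((norm (x - z))\<^sup>2 - a) - u x"

end

theory Submission
  imports Defs
begin

text \<open>
  On the boundary \<open>h = (\<bar>x - z\<bar>\<^sup>2 - a) / 2\<close>, so \<open>\<rho>\<^sub>e - \<rho>\<^sub>i\<close> is bounded by the oscillation of \<open>h\<close> on \<open>\<Gamma>\<close>
  divided by \<open>\<delta>\<^sub>\<Gamma>(z)\<close>.  As \<open>h\<close> is harmonic, the mean value property gives
  \<open>\<bar>\<nabla>\<^sup>2h(x)\<bar> \<le> C \<delta>\<^sub>\<Gamma>(x)\<^bsup>-N/2\<^esup> A\<close> with \<open>A = \<parallel>\<nabla>\<^sup>2h\<parallel>\<close>.  A chain of balls starting at \<open>z\<close>, where \<open>\<nabla>h = 0\<close>,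
  bounds \<open>\<nabla>h\<close> and \<open>h - h(z)\<close> by \<open>C A\<close> at the centres of the interior tangent balls, and integrating
  twice along the normal down to distance \<open>\<epsilon>\<close> from \<open>\<Gamma>\<close> costs \<open>C A (1 + \<epsilon>\<^bsup>2-N/2\<^esup>)\<close> (with a logarithm for
  \<open>N = 4\<close>).  On the remaining piece \<open>h\<close> is Lipschitz by an exterior barrier for \<open>u\<close>, which costs \<open>C \<epsilon>\<close>;
  the choice \<open>\<epsilon> = A\<^bsup>\<tau>\<^esup>\<close> balances the two.

  For \<open>N = 4\<close> and \<open>\<theta> > 1\<close> the exponent is negative and an upper bound for \<open>A\<close> is needed.  Comparing
  differences of \<open>u\<close> in directions tangential at a boundary point with quadratic harmonic barriers
  shows that the tangential gradient decays like \<open>\<delta>\<^bsup>2/3\<^esup>\<close>.  Since the trace of \<open>\<nabla>\<^sup>2h\<close> vanishes, this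
  controls the whole Hessian by \<open>C \<delta>\<^bsup>-1/3\<^esup>\<close>, and \<open>\<delta>\<^bsup>-2/3\<^esup>\<close> is integrable because \<open>\<bar>\<nabla>u\<bar>\<close> is bounded below
  near \<open>\<Gamma>\<close> and the divergence of \<open>g(-u) \<nabla>u\<close> has integral zero.
\<close>

subsection \<open>The geometry of the two-ball condition\<close>

text \<open>Uniformity shapes the whole argument: every constant has to be fixed from
  \<open>r\<close>, \<open>d\<close>, \<delta> and the dimension before the domain is known. A chain
  of balls must therefore keep a fixed distance from the boundary and have a length bounded in
  advance. The first point is a connectedness statement about a shrunk domain, extracted from the
  two tangent balls; the second comes from a finite cover of one ball whose radius is the diameter.

  Mean values are taken over solid balls with a polynomial weight. The weight can take over
  derivatives, so that C2 regularity in the interior suffices for estimates of the Hessian, and no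
  surface measure enters.

  The logarithm for \<open>N = 4\<close> is never computed. The decay exponent \<open>N / 2\<close>
  is replaced by some \<open>m\<close> at least as large that differs from 1 and 2, the values at
  which integrating a power produces a logarithm; for \<open>N = 4\<close> the loss is absorbed by
  \<theta>.\<close>

lemma disjoint_balls_dist:
  fixes a b :: "'a::real_normed_vector"
  assumes "ball a s \<inter> ball b t = {}" "0 < s" "0 < t"
  shows "s + t \<le> dist a b"
proof (rule ccontr)
  assume "\<not> ?thesis"
  then have d: "dist a b < s + t" by simp
  \<comment> \<open>This point divides the segment in the ratio \<open>s : t\<close>; if the centres
    were too close it would lie in both balls.\<close>
  define y where "y = a + (s / (s + t)) *\<^sub>R (b - a)"
  have "y - b = (t / (s + t)) *\<^sub>R (a - b)"
  proof -
    have "s / (s + t) = 1 - t / (s + t)" using assms by (simp add: field_simps)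
    then show ?thesis unfolding y_def by (simp only:) (simp add: algebra_simps)
  qed
  then have "dist y b = t / (s + t) * dist a b"
    using assms by (simp add: dist_norm)
  also have "\<dots> < t / (s + t) * (s + t)"
    using assms d by (intro mult_strict_left_mono) auto
  finally have 1: "y \<in> ball b t" using assms by (simp add: dist_commute)
  have "dist a y = s / (s + t) * dist a b"
    using assms by (simp add: y_def dist_norm norm_minus_commute)
  also have "\<dots> < s / (s + t) * (s + t)"
    using assms d by (intro mult_strict_left_mono) auto
  finally have "y \<in> ball a s" using assms by simp
  with 1 assms show False by blast
qed

text \<open>Equality in the triangle inequality makes \<open>x - p\<close> and \<open>p - c\<close>
  parallel. This turns tangency of two balls at \<open>p\<close> into a formula for a
  centre.\<close>

lemma aligned_of_dist_add:
  fixes x p c :: "'a::real_inner"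
  assumes "dist x p = t" "dist p c = r" "t + r \<le> dist x c" "0 < r"
  shows "x = p + t *\<^sub>R ((1 / r) *\<^sub>R (p - c))"
proof -
  have "norm ((x - p) + (p - c)) = norm (x - p) + norm (p - c)"
    using assms norm_triangle_ineq[of "x - p" "p - c"] by (simp add: dist_norm)
  then have "norm (x - p) *\<^sub>R (p - c) = norm (p - c) *\<^sub>R (x - p)"
    by (simp only: norm_triangle_eq)
  then have "t *\<^sub>R (p - c) = r *\<^sub>R (x - p)" using assms by (simp add: dist_norm)
  then have "(1 / r) *\<^sub>R (t *\<^sub>R (p - c)) = x - p" using assms by simp
  then show ?thesis by (simp add: algebra_simps)
qed

text \<open>The normal is encoded by its two tangent balls of equal radius instead of derivatives of
  a chart, since the estimates below compare distances to the centres of these balls.\<close>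

definition inner_normal :: "'a::euclidean_space set \<Rightarrow> real \<Rightarrow> 'a \<Rightarrow> 'a \<Rightarrow> bool" where
  "inner_normal \<Omega> r p \<nu> \<longleftrightarrow> norm \<nu> = 1 \<and> ball (p + r *\<^sub>R \<nu>) r \<subseteq> \<Omega> \<and>
     ball (p - r *\<^sub>R \<nu>) r \<inter> closure \<Omega> = {}"

definition two_balls :: "'a::euclidean_space set \<Rightarrow> real \<Rightarrow> bool" where
  "two_balls \<Omega> r \<longleftrightarrow> 0 < r \<and> (\<forall>p\<in>frontier \<Omega>. \<exists>\<nu>. inner_normal \<Omega> r p \<nu>)"

text \<open>The interior and the exterior ball at \<open>p\<close> are disjoint, so their centres
  are at distance at least \<open>r\<^sub>i + r\<^sub>e\<close>, while both spheres pass through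
  \<open>p\<close>. Hence \<open>p\<close> lies between the centres and one unit vector serves both
  balls, which are then shrunk towards \<open>p\<close> to a common radius.\<close>

lemma two_balls_of_sphere_conditions:
  fixes \<Omega> :: "(real ^ 'n::finite) set"
  assumes "open \<Omega>" "interior_sphere_condition \<Omega> r\<^sub>i" "exterior_sphere_condition \<Omega> r\<^sub>e"
  shows "two_balls \<Omega> (min r\<^sub>i r\<^sub>e)"
  unfolding two_balls_def
proof (intro conjI ballI)
  show r0: "0 < min r\<^sub>i r\<^sub>e"
    using assms by (simp add: interior_sphere_condition_def exterior_sphere_condition_def)
  fix p assume p: "p \<in> frontier \<Omega>"
  define r where "r = min r\<^sub>i r\<^sub>e"
  have r: "0 < r" "r \<le> r\<^sub>i" "r \<le> r\<^sub>e" "0 < r\<^sub>i" "0 < r\<^sub>e" using r0 by (auto simp: r_def)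
  obtain c where c: "ball c r\<^sub>i \<subseteq> \<Omega>" "closure (ball c r\<^sub>i) \<inter> frontier \<Omega> = {p}"
    using assms(2) p by (auto simp: interior_sphere_condition_def)
  obtain b where b: "ball b r\<^sub>e \<subseteq> - closure \<Omega>" "closure (ball b r\<^sub>e) \<inter> frontier \<Omega> = {p}"
    using assms(3) p by (auto simp: exterior_sphere_condition_def)
  have pc: "p \<in> closure \<Omega>" "p \<notin> \<Omega>"
    using p assms(1) by (auto simp: frontier_def interior_open)
  have "p \<in> cball c r\<^sub>i" using c r by auto
  moreover have "p \<notin> ball c r\<^sub>i" using c pc by blast
  ultimately have dc: "dist c p = r\<^sub>i" by simp
  have "p \<in> cball b r\<^sub>e" using b r by auto
  moreover have "p \<notin> ball b r\<^sub>e" using b pc by blast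
  ultimately have db: "dist p b = r\<^sub>e" by (simp add: dist_commute)
  have "ball c r\<^sub>i \<inter> ball b r\<^sub>e = {}" using b c closure_subset[of \<Omega>] by blast
  then have "r\<^sub>i + r\<^sub>e \<le> dist c b" using disjoint_balls_dist r by blast
  define \<nu> where "\<nu> = (1 / r\<^sub>e) *\<^sub>R (p - b)"
  have ceq: "c = p + r\<^sub>i *\<^sub>R \<nu>"
    unfolding \<nu>_def using aligned_of_dist_add[OF dc db \<open>r\<^sub>i + r\<^sub>e \<le> dist c b\<close>] r by simp
  have beq: "b = p - r\<^sub>e *\<^sub>R \<nu>" using r by (simp add: \<nu>_def)
  have n: "norm \<nu> = 1" using db r by (simp add: \<nu>_def dist_norm)
  have "dist (p + r *\<^sub>R \<nu>) c = r\<^sub>i - r"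
  proof -
    have "p + r *\<^sub>R \<nu> - c = (r - r\<^sub>i) *\<^sub>R \<nu>" by (simp add: ceq algebra_simps)
    then show ?thesis using n r by (simp add: dist_norm)
  qed
  then have 1: "ball (p + r *\<^sub>R \<nu>) r \<subseteq> ball c r\<^sub>i" by (simp add: ball_subset_ball_iff)
  have "dist (p - r *\<^sub>R \<nu>) b = r\<^sub>e - r"
  proof -
    have "p - r *\<^sub>R \<nu> - b = (r\<^sub>e - r) *\<^sub>R \<nu>" by (simp add: beq algebra_simps)
    then show ?thesis using n r by (simp add: dist_norm)
  qed
  then have 2: "ball (p - r *\<^sub>R \<nu>) r \<subseteq> ball b r\<^sub>e" by (simp add: ball_subset_ball_iff)
  show "\<exists>\<nu>. inner_normal \<Omega> (min r\<^sub>i r\<^sub>e) p \<nu>"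
    unfolding inner_normal_def r_def[symmetric] using 1 2 n b c by blast
qed

lemma inner_normal_exterior:
  assumes "inner_normal \<Omega> r p \<nu>" "x \<in> closure \<Omega>"
  shows "r \<le> dist x (p - r *\<^sub>R \<nu>)"
  using assms by (auto simp: inner_normal_def disjoint_iff dist_commute not_less[symmetric])

text \<open>Expanding the squared distance to the centre of the exterior ball shows that the domain
  dips below the tangent plane at \<open>p\<close> at most quadratically.\<close>

lemma inner_normal_height:
  fixes x p :: "'a::euclidean_space"
  assumes "inner_normal \<Omega> r p \<nu>" "x \<in> closure \<Omega>" "0 < r"
  shows "- ((norm (x - p))\<^sup>2 / (2 * r)) \<le> (x - p) \<bullet> \<nu>"
proof -
  have n: "\<nu> \<bullet> \<nu> = 1" using assms by (simp add: inner_normal_def norm_eq_1)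
  have "r\<^sup>2 \<le> (norm (x - (p - r *\<^sub>R \<nu>)))\<^sup>2"
    using inner_normal_exterior[OF assms(1,2)] assms(3) by (intro power_mono) (auto simp: dist_norm)
  also have "\<dots> = (norm (x - p))\<^sup>2 + 2 * r * ((x - p) \<bullet> \<nu>) + r\<^sup>2"
    unfolding power2_norm_eq_inner using n
    by (simp add: algebra_simps inner_commute power2_eq_square)
  finally show ?thesis using assms(3) by (simp add: field_simps)
qed

text \<open>The interior ball at one point is disjoint from the exterior ball at the other; adding the
  two resulting inequalities is a parallelogram identity.\<close>

lemma inner_normal_lipschitz:
  fixes p q :: "'a::euclidean_space"
  assumes "inner_normal \<Omega> r p \<nu>" "inner_normal \<Omega> r q \<mu>" "0 < r"
  shows "norm (\<nu> - \<mu>) \<le> norm (p - q) / r"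
proof -
  have n: "\<nu> \<bullet> \<nu> = 1" "\<mu> \<bullet> \<mu> = 1" using assms by (simp_all add: inner_normal_def norm_eq_1)
  have *: "(2 * r)\<^sup>2 \<le> (norm (p + r *\<^sub>R \<nu> - (q - r *\<^sub>R \<mu>)))\<^sup>2"
    if "inner_normal \<Omega> r p \<nu>" "inner_normal \<Omega> r q \<mu>" for p q \<nu> \<mu>
  proof -
    have "ball (p + r *\<^sub>R \<nu>) r \<inter> ball (q - r *\<^sub>R \<mu>) r = {}"
      using that closure_subset[of \<Omega>] unfolding inner_normal_def by blast
    from disjoint_balls_dist[OF this] assms(3) show ?thesis
      by (intro power_mono) (auto simp: dist_norm)
  qed
  have "(2 * r)\<^sup>2 + (2 * r)\<^sup>2 \<le> (norm (p + r *\<^sub>R \<nu> - (q - r *\<^sub>R \<mu>)))\<^sup>2 + (norm (q + r *\<^sub>R \<mu> - (p - r *\<^sub>R \<nu>)))\<^sup>2"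
    using *[OF assms(1,2)] *[OF assms(2,1)] by linarith
  also have "\<dots> = 2 * (norm (p - q))\<^sup>2 + 4 * r\<^sup>2 + 4 * r\<^sup>2 * (\<nu> \<bullet> \<mu>)"
    unfolding power2_norm_eq_inner using n
    by (simp add: algebra_simps inner_commute power2_eq_square)
  also have "\<dots> = 2 * (norm (p - q))\<^sup>2 + 8 * r\<^sup>2 - 2 * r\<^sup>2 * (norm (\<nu> - \<mu>))\<^sup>2"
    unfolding power2_norm_eq_inner[of "\<nu> - \<mu>"] using n by (simp add: algebra_simps inner_commute)
  finally have "(r * norm (\<nu> - \<mu>))\<^sup>2 \<le> (norm (p - q))\<^sup>2" by (simp add: power_mult_distrib)
  then have "r * norm (\<nu> - \<mu>) \<le> norm (p - q)"
    by (rule power2_le_imp_le) simp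
  then show ?thesis using assms(3) by (simp add: field_simps)
qed

text \<open>The ball is connected, meets the domain and misses the frontier, so it cannot leave the
  domain.\<close>

lemma ball_infdist_frontier_subset:
  fixes \<Omega> :: "'a::euclidean_space set"
  assumes "open \<Omega>" "x \<in> \<Omega>"
  shows "ball x (infdist x (frontier \<Omega>)) \<subseteq> \<Omega>"
proof (cases "0 < infdist x (frontier \<Omega>)")
  case True
  then have "ball x (infdist x (frontier \<Omega>)) \<inter> frontier \<Omega> = {}"
    by (auto simp: disjoint_iff dist_commute dest!: infdist_le2[of _ _ x "dist x _"])
  moreover have "x \<in> ball x (infdist x (frontier \<Omega>))" using True by simp
  ultimately show ?thesis
    using connected_Int_frontier[of "ball x (infdist x (frontier \<Omega>))" \<Omega>] assms by blast
qed (simp add: ball_empty)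

lemma frontier_not_empty_bounded:
  fixes \<Omega> :: "'a::euclidean_space set"
  assumes "bounded \<Omega>" "\<Omega> \<noteq> {}"
  shows "frontier \<Omega> \<noteq> {}"
  using assms frontier_eq_empty not_bounded_UNIV by blast

lemma nearest_boundary_point:
  fixes \<Omega> :: "'a::euclidean_space set"
  assumes "bounded \<Omega>" "\<Omega> \<noteq> {}"
  obtains p where "p \<in> frontier \<Omega>" "dist x p = infdist x (frontier \<Omega>)"
  using infdist_attains_inf[OF frontier_closed frontier_not_empty_bounded[OF assms], of x] by metis

lemma infdist_frontier_pos:
  fixes \<Omega> :: "'a::euclidean_space set"
  assumes "open \<Omega>" "bounded \<Omega>" "x \<in> \<Omega>"
  shows "0 < infdist x (frontier \<Omega>)"
proof -
  have "frontier \<Omega> \<noteq> {}" using frontier_not_empty_bounded assms by blast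
  moreover have "x \<notin> frontier \<Omega>" using assms by (simp add: frontier_def interior_open)
  ultimately show ?thesis
    using in_closed_iff_infdist_zero[of "frontier \<Omega>" x] infdist_nonneg[of x "frontier \<Omega>"]
    by fastforce
qed

text \<open>The ball around \<open>x\<close> and the exterior ball at \<open>p\<close> are disjoint
  and their spheres both pass through \<open>p\<close>, which leaves only the normal line for
  \<open>x\<close>.\<close>

lemma nearest_on_normal:
  fixes x p :: "'a::euclidean_space"
  assumes "inner_normal \<Omega> r p \<nu>" "0 < r" "0 < t" "dist x p = t" "ball x t \<subseteq> \<Omega>"
  shows "x = p + t *\<^sub>R \<nu>"
proof -
  have "ball x t \<inter> ball (p - r *\<^sub>R \<nu>) r = {}"
    using assms closure_subset[of \<Omega>] unfolding inner_normal_def by blast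
  then have "t + r \<le> dist x (p - r *\<^sub>R \<nu>)" using disjoint_balls_dist assms by blast
  moreover have "dist p (p - r *\<^sub>R \<nu>) = r" using assms by (simp add: dist_norm inner_normal_def)
  ultimately have "x = p + t *\<^sub>R ((1 / r) *\<^sub>R (p - (p - r *\<^sub>R \<nu>)))"
    using aligned_of_dist_add assms by blast
  then show ?thesis using assms(2) by simp
qed

lemma normal_ball_nested:
  fixes p \<nu> :: "'a::euclidean_space"
  assumes "norm \<nu> = 1" "s \<le> r"
  shows "ball (p + s *\<^sub>R \<nu>) s \<subseteq> ball (p + r *\<^sub>R \<nu>) r"
proof -
  have "dist (p + s *\<^sub>R \<nu>) (p + r *\<^sub>R \<nu>) = r - s"
  proof -
    have "p + s *\<^sub>R \<nu> - (p + r *\<^sub>R \<nu>) = (s - r) *\<^sub>R \<nu>" by (simp add: algebra_simps)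
    then show ?thesis using assms by (simp add: dist_norm)
  qed
  then show ?thesis by (simp add: ball_subset_ball_iff)
qed

section \<open>Connectedness of the shrunk domain\<close>

lemma covered_by_inner_ball:
  fixes \<Omega> :: "'a::euclidean_space set"
  assumes "open \<Omega>" "bounded \<Omega>" "two_balls \<Omega> r" "0 < s" "s \<le> r" "v \<in> \<Omega>"
  obtains x where "ball x s \<subseteq> \<Omega>" "v \<in> ball x s"
proof (cases "s \<le> infdist v (frontier \<Omega>)")
  case True
  then have "ball v s \<subseteq> \<Omega>" using ball_infdist_frontier_subset[OF assms(1,6)] by fastforce
  then show ?thesis using that assms by auto
next
  case False
  define t where "t = infdist v (frontier \<Omega>)"
  have t: "0 < t" "t < s" using False infdist_frontier_pos assms by (auto simp: t_def)
  obtain p where p: "p \<in> frontier \<Omega>" "dist v p = t"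
    using nearest_boundary_point assms unfolding t_def by blast
  obtain \<nu> where \<nu>: "inner_normal \<Omega> r p \<nu>" using assms p by (auto simp: two_balls_def)
  have v: "v = p + t *\<^sub>R \<nu>"
    using nearest_on_normal[OF \<nu>] assms p t ball_infdist_frontier_subset[OF assms(1,6)]
    by (auto simp: two_balls_def t_def)
  have n: "norm \<nu> = 1" using \<nu> by (simp add: inner_normal_def)
  \<comment> \<open>Since \<open>v\<close> lies on the normal at its nearest boundary point, the
    interior tangent ball of radius \<open>s\<close> at that point contains it.\<close>
  have "dist (p + s *\<^sub>R \<nu>) v = s - t"
  proof -
    have "p + s *\<^sub>R \<nu> - v = (s - t) *\<^sub>R \<nu>" by (simp add: v algebra_simps)
    then show ?thesis using n t by (simp add: dist_norm)
  qed
  then have "v \<in> ball (p + s *\<^sub>R \<nu>) s" using t by simp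
  moreover have "ball (p + s *\<^sub>R \<nu>) s \<subseteq> \<Omega>"
    using normal_ball_nested[OF n assms(5)] \<nu> by (auto simp: inner_normal_def)
  ultimately show ?thesis using that by blast
qed

lemma segment_in_shrunk_set:
  fixes x w :: "'a::euclidean_space"
  assumes "ball x s \<subseteq> \<Omega>" "cball w (2 * \<eta>) \<subseteq> \<Omega>" "dist x w < s" "0 < \<eta>"
  shows "closed_segment x w \<subseteq> {y. cball y \<eta> \<subseteq> \<Omega>}"
proof
  fix y assume "y \<in> closed_segment x w"
  then have d: "dist x w = dist x y + dist y w"
    by (simp add: between_mem_segment[symmetric] between)
  show "y \<in> {y. cball y \<eta> \<subseteq> \<Omega>}"
  proof (cases "dist x y < s - \<eta>")
    case True
    then have "cball y \<eta> \<subseteq> ball x s" by (simp add: cball_subset_ball_iff dist_commute)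
    then show ?thesis using assms by auto
  next
    case False
    then have "dist y w < \<eta>" using d assms by linarith
    then have "cball y \<eta> \<subseteq> cball w (2 * \<eta>)" by (simp add: cball_subset_cball_iff)
    then show ?thesis using assms by auto
  qed
qed

text \<open>The exterior ball keeps the centre \<open>x\<close> at height almost \<open>s\<close>
  above the tangent plane, while \<open>x\<close> is within \<open>s\<close> of a point that almost
  lies on the boundary; together this pins \<open>x\<close> near
  \<open>p + s *\<^sub>R \<nu>\<close>. So all inner balls of radius \<open>s\<close> that reach the
  same point near the boundary have nearby centres.\<close>

lemma inner_ball_near_boundary:
  fixes \<Omega> :: "'a::euclidean_space set"
  assumes \<nu>: "inner_normal \<Omega> r p \<nu>" and s: "0 < s" "s \<le> r"
    and t: "0 < t" "t \<le> s / 64" and x: "ball x s \<subseteq> \<Omega>" "dist x (p + t *\<^sub>R \<nu>) \<le> s"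
  shows "dist x (p + s *\<^sub>R \<nu>) \<le> s / 4"
proof -
  have n: "\<nu> \<bullet> \<nu> = 1" using \<nu> by (simp add: inner_normal_def norm_eq_1)
  have r: "0 < r" using s by simp
  define X where "X = x - p"
  define k where "k = X \<bullet> \<nu>"
  have "ball x s \<inter> ball (p - r *\<^sub>R \<nu>) r = {}"
    using assms closure_subset[of \<Omega>] unfolding inner_normal_def by blast
  from disjoint_balls_dist[OF this s(1) r]
  have "(s + r)\<^sup>2 \<le> (norm (X + r *\<^sub>R \<nu>))\<^sup>2"
    using s r by (intro power_mono) (auto simp: dist_norm X_def algebra_simps)
  also have "\<dots> = (norm X)\<^sup>2 + 2 * r * k + r\<^sup>2"
    unfolding power2_norm_eq_inner using n
    by (simp add: algebra_simps inner_commute power2_eq_square k_def)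
  finally have 1: "s\<^sup>2 + 2 * s * r \<le> (norm X)\<^sup>2 + 2 * r * k" by (simp add: power2_eq_square algebra_simps)
  have "(norm (X - t *\<^sub>R \<nu>))\<^sup>2 \<le> s\<^sup>2"
    using x(2) by (intro power_mono) (auto simp: dist_norm X_def algebra_simps)
  moreover have "(norm (X - t *\<^sub>R \<nu>))\<^sup>2 = (norm X)\<^sup>2 - 2 * t * k + t\<^sup>2"
    unfolding power2_norm_eq_inner using n
    by (simp add: algebra_simps inner_commute power2_eq_square k_def)
  ultimately have 2: "(norm X)\<^sup>2 \<le> s\<^sup>2 + 2 * t * k - t\<^sup>2" by linarith
  have "2 * s * r \<le> 2 * (r + t) * k" using 1 2 by (simp add: algebra_simps) (smt (verit) zero_le_power2)
  then have "2 * (s * r) \<le> 2 * ((r + t) * k)" by (simp add: algebra_simps)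
  then have k: "s * r \<le> (r + t) * k" by simp
  have "0 \<le> (t / r) * t" using t r by simp
  \<comment> \<open>The product \<open>(1 - t / r) * (r + t)\<close> equals
    \<open>r - t * t / r\<close>, so \<open>1 - t / r\<close> is a convenient lower bound for
    \<open>r / (r + t)\<close>.\<close>
  then have "s * (1 - t / r) * (r + t) \<le> s * r" using r s t by (simp add: field_simps)
  also note k
  finally have k2: "s * (1 - t / r) \<le> k" using r t by (simp add: mult.commute)
  have "(norm (X - s *\<^sub>R \<nu>))\<^sup>2 = (norm X)\<^sup>2 - 2 * s * k + s\<^sup>2"
    unfolding power2_norm_eq_inner using n
    by (simp add: algebra_simps inner_commute power2_eq_square k_def)
  also have "\<dots> \<le> 2 * s\<^sup>2 - 2 * (s - t) * k" using 2 by (simp add: algebra_simps) (smt (verit) zero_le_power2)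
  also have "\<dots> \<le> 2 * s\<^sup>2 - 2 * (s - t) * (s * (1 - t / r))"
    using k2 t s by (intro diff_left_mono mult_left_mono) auto
  also have "\<dots> = 2 * s * t + 2 * s * t * (s / r) - 2 * s * (t * t / r)"
    using r by (simp add: field_simps power2_eq_square)
  also have "\<dots> \<le> 2 * s * t + 2 * s * t * 1 - 0"
    using r s t by (intro diff_mono add_mono mult_left_mono order_refl) (auto simp: field_simps)
  \<comment> \<open>The threshold \<open>s / 64\<close> for \<open>t\<close> is the value at which
    \<open>4 * s * t\<close> becomes the square of \<open>s / 4\<close>.\<close>
  also have "\<dots> \<le> 2 * s * (s / 64) + 2 * s * (s / 64)"
    using s t by (simp add: mult_left_mono)
  also have "\<dots> = (s / 4)\<^sup>2" by (simp add: power2_eq_square)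
  finally have "(norm (X - s *\<^sub>R \<nu>))\<^sup>2 \<le> (s / 4)\<^sup>2" .
  then have "norm (X - s *\<^sub>R \<nu>) \<le> s / 4" by (rule power2_le_imp_le) (use s in simp)
  then show ?thesis by (simp add: X_def dist_norm diff_diff_eq)
qed

text \<open>If the common point \<open>w\<close> is within \<open>s / 64\<close> of the boundary,
  both centres are within \<open>s / 4\<close> of the same point and the segment between them stays
  deep. Otherwise \<open>w\<close> itself is deep and the path runs through it. The depth
  \<open>s / 200\<close> leaves room in both cases: twice this value is below \<open>s / 64\<close>,
  and \<open>s / 2 + s / 200\<close> is below \<open>s\<close>.\<close>

lemma overlapping_balls_connected:
  fixes \<Omega> :: "'a::euclidean_space set"
  assumes \<Omega>: "open \<Omega>" "bounded \<Omega>" "two_balls \<Omega> r" and s: "0 < s" "s \<le> r"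
    and x: "ball x s \<subseteq> \<Omega>" "w \<in> ball x s" and y: "ball y s \<subseteq> \<Omega>" "w \<in> ball y s"
  shows "connected_component {y. cball y (s / 200) \<subseteq> \<Omega>} x y"
proof -
  let ?Y = "{y. cball y (s / 200) \<subseteq> \<Omega>}"
  have seg: "connected_component ?Y a b" if "closed_segment a b \<subseteq> ?Y" for a b
    using that by (meson connected_component_def connected_segment ends_in_segment)
  define t where "t = infdist w (frontier \<Omega>)"
  have w: "w \<in> \<Omega>" using x by auto
  have t: "0 < t" using infdist_frontier_pos \<Omega> w by (auto simp: t_def)
  have bt: "ball w t \<subseteq> \<Omega>" using ball_infdist_frontier_subset[OF \<Omega>(1) w] by (simp add: t_def)
  show ?thesis
  proof (cases "t \<le> s / 64")
    case True
    obtain p where p: "p \<in> frontier \<Omega>" "dist w p = t"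
      using nearest_boundary_point \<Omega> w unfolding t_def by blast
    obtain \<nu> where \<nu>: "inner_normal \<Omega> r p \<nu>" using \<Omega> p by (auto simp: two_balls_def)
    have weq: "w = p + t *\<^sub>R \<nu>"
      using nearest_on_normal[OF \<nu> _ t p(2) bt] s by simp
    have "dist x (p + s *\<^sub>R \<nu>) \<le> s / 4" "dist y (p + s *\<^sub>R \<nu>) \<le> s / 4"
      using inner_ball_near_boundary[OF \<nu> s t True] x y unfolding weq by auto
    then have xy: "dist x y \<le> s / 2"
      using dist_triangle2[of x y "p + s *\<^sub>R \<nu>"] by linarith
    have "closed_segment x y \<subseteq> ?Y"
    proof
      fix v assume "v \<in> closed_segment x y"
      then have "dist x v \<le> s / 2" using xy dist_in_closed_segment[of v x y] by (simp add: dist_commute)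
      then have "cball v (s / 200) \<subseteq> ball x s" using s by (simp add: cball_subset_ball_iff dist_commute)
      then show "v \<in> ?Y" using x by auto
    qed
    then show ?thesis by (rule seg)
  next
    case False
    then have "cball w (2 * (s / 200)) \<subseteq> ball w t" using s by (simp add: cball_subset_ball_iff)
    then have cw: "cball w (2 * (s / 200)) \<subseteq> \<Omega>" using bt by (rule subset_trans)
    have "closed_segment x w \<subseteq> ?Y"
      by (rule segment_in_shrunk_set[OF x(1) cw]) (use x(2) s(1) in simp_all)
    moreover have "closed_segment y w \<subseteq> ?Y"
      by (rule segment_in_shrunk_set[OF y(1) cw]) (use y(2) s(1) in simp_all)
    ultimately have "connected_component ?Y x w" "connected_component ?Y y w" by (auto intro: seg)
    then show ?thesis using connected_component_sym connected_component_trans by (metis (lifting))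
  qed
qed

text \<open>Balls of radius \<open>s\<close> inside the domain cover it, and overlapping ones have centres in the same
  component of the shrunk domain, so that component is a locally constant function on the domain.\<close>

lemma inner_balls_connected:
  fixes \<Omega> :: "'a::euclidean_space set"
  assumes \<Omega>: "open \<Omega>" "bounded \<Omega>" "connected \<Omega>" "two_balls \<Omega> r" and s: "0 < s" "s \<le> r"
    and x: "ball x s \<subseteq> \<Omega>" and y: "ball y s \<subseteq> \<Omega>"
  shows "connected_component {y. cball y (s / 200) \<subseteq> \<Omega>} x y"
proof -
  let ?C = "connected_component {y. cball y (s / 200) \<subseteq> \<Omega>}"
  \<comment> \<open>The relation ranges over all inner balls covering the two points, so that
    transitivity may use whichever ball covers the middle point.\<close>
  define R where "R v v' \<longleftrightarrow> (\<forall>x x'. ball x s \<subseteq> \<Omega> \<and> v \<in> ball x s \<and> ball x' s \<subseteq> \<Omega> \<and> v' \<in> ball x' s \<longrightarrow> ?C x x')" for v v'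
  note ov = overlapping_balls_connected[OF \<Omega>(1,2,4) s]
  have "R x y"
    using \<Omega>(3)
  proof (rule connected_equivalence_relation)
    show "x \<in> \<Omega>" "y \<in> \<Omega>" using x y s by auto
    show "R b a" if "R a b" for a b
      unfolding R_def
    proof (intro allI impI)
      fix x x' assume "ball x s \<subseteq> \<Omega> \<and> b \<in> ball x s \<and> ball x' s \<subseteq> \<Omega> \<and> a \<in> ball x' s"
      then have "?C x' x" using that unfolding R_def by blast
      then show "?C x x'" by (rule connected_component_sym)
    qed
    show "R a c" if abc: "R a b" "R b c" "b \<in> \<Omega>" for a b c
      unfolding R_def
    proof (intro allI impI)
      fix x x' assume *: "ball x s \<subseteq> \<Omega> \<and> a \<in> ball x s \<and> ball x' s \<subseteq> \<Omega> \<and> c \<in> ball x' s"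
      obtain y where "ball y s \<subseteq> \<Omega>" "b \<in> ball y s"
        using covered_by_inner_ball[OF \<Omega>(1,2,4) s abc(3)] by blast
      with * abc have "?C x y" "?C y x'" unfolding R_def by blast+
      then show "?C x x'" by (rule connected_component_trans)
    qed
    fix a assume a: "a \<in> \<Omega>"
    obtain z where z: "ball z s \<subseteq> \<Omega>" "a \<in> ball z s"
      using covered_by_inner_ball[OF \<Omega>(1,2,4) s a] by blast
    have "R a v" if "v \<in> ball z s" for v
      unfolding R_def
    proof (intro allI impI)
      fix x x' assume *: "ball x s \<subseteq> \<Omega> \<and> a \<in> ball x s \<and> ball x' s \<subseteq> \<Omega> \<and> v \<in> ball x' s"
      have "?C x z" "?C z x'" by (rule ov; use * z that in blast)+
      then show "?C x x'" by (rule connected_component_trans)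
    qed
    moreover have "openin (top_of_set \<Omega>) (ball z s)"
      using z by (simp add: open_subset)
    ultimately show "\<exists>T. openin (top_of_set \<Omega>) T \<and> a \<in> T \<and> (\<forall>x\<in>T. R a x)"
      using z by blast
  qed
  then show ?thesis using x y s unfolding R_def by auto
qed

text \<open>The cover by small balls is finite, so two points of a connected set are joined by a chain of
  overlapping balls whose length is bounded by the number of pairs of balls.\<close>

lemma chain_bound:
  assumes "0 < \<epsilon>"
  obtains K :: real where "0 \<le> K"
    "\<And>(S :: 'a::euclidean_space set) z F B. \<lbrakk>connected S; z \<in> S; S \<subseteq> cball z d; 0 \<le> (B::real);
        \<And>x y. \<lbrakk>x \<in> S; y \<in> S; dist x y < \<epsilon>\<rbrakk> \<Longrightarrow> \<bar>F x - F y\<bar> \<le> B\<rbrakk>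
        \<Longrightarrow> \<forall>x\<in>S. \<bar>F x - F z\<bar> \<le> K * B"
proof -
  \<comment> \<open>The cover is made once, around the origin, and translated by \<open>z\<close>
    afterwards; this keeps \<open>K\<close> independent of \<open>S\<close> and
    \<open>z\<close>.\<close>
  have "compact (cball (0::'a) d)" by simp
  then obtain T where T: "finite T" "cball (0::'a) d \<subseteq> (\<Union>x\<in>T. ball x (\<epsilon> / 2))"
    using assms unfolding compact_eq_totally_bounded by (metis half_gt_zero)
  define K where "K = real (card (T \<times> T)) + 1"
  have main: "\<forall>x\<in>S. \<bar>F x - F z\<bar> \<le> K * B"
    if S: "connected S" "z \<in> S" "S \<subseteq> cball z d" and B: "0 \<le> B"
      and F: "\<And>x y. \<lbrakk>x \<in> S; y \<in> S; dist x y < \<epsilon>\<rbrakk> \<Longrightarrow> \<bar>F x - F y\<bar> \<le> B"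
    for S :: "'a set" and z F and B :: real
  proof -
    define E where "E a = S \<inter> ball (z + a) (\<epsilon> / 2)" for a
    have E: "\<bar>F x - F y\<bar> \<le> B" if "x \<in> E a" "y \<in> E a" for a x y
    proof -
      have "dist x y < \<epsilon>"
        using that dist_triangle_half_r[of "z + a" x \<epsilon> y] by (simp add: E_def)
      then show ?thesis using F that by (simp add: E_def)
    qed
    have cov: "\<exists>a\<in>T. x \<in> E a" if "x \<in> S" for x
    proof -
      have "x - z \<in> cball 0 d" using that S by (auto simp: dist_norm norm_minus_commute)
      then obtain a where "a \<in> T" "x - z \<in> ball a (\<epsilon> / 2)" using T by blast
      then show ?thesis using that by (auto simp: E_def dist_norm algebra_simps)
    qed
    define r where "r = {(a, b). a \<in> T \<and> b \<in> T \<and> E a \<inter> E b \<noteq> {}}"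
    have r: "r \<subseteq> T \<times> T" "finite r" using T finite_subset[of r "T \<times> T"] by (auto simp: r_def)
    have pw: "(a, b) \<in> r ^^ n \<Longrightarrow> z \<in> E a \<Longrightarrow> x \<in> E b \<Longrightarrow> \<bar>F x - F z\<bar> \<le> (real n + 1) * B" for a b n x
    proof (induction n arbitrary: b x)
      case 0
      then show ?case using E[of x b z] by simp
    next
      case (Suc n)
      then obtain c where c: "(a, c) \<in> r ^^ n" "(c, b) \<in> r" by auto
      then obtain y where y: "y \<in> E c" "y \<in> E b" by (auto simp: r_def)
      have "\<bar>F y - F z\<bar> \<le> (real n + 1) * B" using Suc c y by blast
      moreover have "\<bar>F x - F y\<bar> \<le> B" using E Suc.prems y by blast
      ultimately show ?case by (simp add: algebra_simps)
    qed
    obtain a0 where a0: "a0 \<in> T" "z \<in> E a0" using cov S by blast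
    \<comment> \<open>These are the patches reachable from one that contains \<open>z\<close>. A
      patch with one point in \<open>R\<close> lies in \<open>R\<close>, so connectedness makes
      \<open>R\<close> all of \<open>S\<close>.\<close>
    define R where "R = (\<Union>b\<in>{b\<in>T. (a0, b) \<in> r\<^sup>*}. E b)"
    have op: "openin (top_of_set S) (E b)" for b
      unfolding E_def by (simp add: openin_open_Int)
    have "x \<in> R" if "x \<in> S" for x
      using S(1)
    proof (rule connected_induction_simple[where P = "\<lambda>x. x \<in> R"])
      show "z \<in> S" "x \<in> S" "z \<in> R" using S that a0 by (auto simp: R_def)
      fix v assume v: "v \<in> S"
      obtain b where b: "b \<in> T" "v \<in> E b" using cov v by blast
      have "\<forall>x\<in>E b. \<forall>y\<in>E b. x \<in> R \<longrightarrow> y \<in> R"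
      proof (intro ballI impI)
        fix x y assume xy: "x \<in> E b" "y \<in> E b" "x \<in> R"
        then obtain c where "c \<in> T" "(a0, c) \<in> r\<^sup>*" "x \<in> E c" by (auto simp: R_def)
        moreover from this have "(c, b) \<in> r" using b xy by (auto simp: r_def)
        ultimately have "(a0, b) \<in> r\<^sup>*" by simp
        then show "y \<in> R" using b xy by (auto simp: R_def)
      qed
      then show "\<exists>T. openin (top_of_set S) T \<and> v \<in> T \<and> (\<forall>x\<in>T. \<forall>y\<in>T. x \<in> R \<longrightarrow> y \<in> R)"
        using op b by blast
    qed
    moreover have "\<bar>F x - F z\<bar> \<le> K * B" if x: "x \<in> R" for x
    proof -
      obtain b where b: "(a0, b) \<in> r\<^sup>*" "x \<in> E b" using x by (auto simp: R_def)
      \<comment> \<open>In a finite relation a reachable pair is joined by at most as many steps as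
        the relation has elements; this is the uniform bound on the length of a chain.\<close>
      then obtain n where n: "n \<le> card r" "(a0, b) \<in> r ^^ n"
        using rtrancl_finite_eq_relpow[OF r(2)] by auto
      have "\<bar>F x - F z\<bar> \<le> (real n + 1) * B" using pw n a0 b by blast
      moreover have "n \<le> card (T \<times> T)"
        using n card_mono[OF finite_cartesian_product[OF T(1) T(1)] r(1)] by linarith
      then have "(real n + 1) * B \<le> K * B"
        unfolding K_def using B by (intro mult_right_mono add_right_mono of_nat_mono)
      ultimately show ?thesis by linarith
    qed
    ultimately show ?thesis by blast
  qed
  have "0 \<le> K" by (simp add: K_def)
  then show ?thesis by (rule that) (rule main)
qed

subsection \<open>The maximum principle and barriers\<close>

text \<open>Only second derivatives along coordinate lines are recorded, because an interior maximum
  constrains exactly these. Barriers can then be treated by one-variable calculus. The first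
  derivative is required on a neighbourhood of 0 since it is differentiated there.\<close>

definition has_lap :: "('a::euclidean_space \<Rightarrow> real) \<Rightarrow> 'a \<Rightarrow> real \<Rightarrow> bool" where
  "has_lap v x L \<longleftrightarrow> (\<exists>G H.
     (\<forall>e\<in>Basis. \<forall>\<^sub>F s in nhds 0. ((\<lambda>s. v (x + s *\<^sub>R e)) has_real_derivative G e s) (at s)) \<and>
     (\<forall>e\<in>Basis. (G e has_real_derivative H e) (at 0)) \<and> L = (\<Sum>e\<in>Basis. H e))"

lemma has_lapI:
  assumes "\<And>e s. e \<in> Basis \<Longrightarrow> ((\<lambda>s. v (x + s *\<^sub>R e)) has_real_derivative G e s) (at s)"
    and "\<And>e. e \<in> Basis \<Longrightarrow> (G e has_real_derivative H e) (at 0)"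
    and "L = (\<Sum>e\<in>Basis. H e)"
  shows "has_lap v x L"
  unfolding has_lap_def using assms by (intro exI[of _ G] exI[of _ H]) auto

lemma has_lap_add:
  assumes "has_lap f x L" "has_lap g x M"
  shows "has_lap (\<lambda>x. f x + g x) x (L + M)"
proof -
  obtain G H where 1: "\<forall>e\<in>Basis. \<forall>\<^sub>F s in nhds 0. ((\<lambda>s. f (x + s *\<^sub>R e)) has_real_derivative G e s) (at s)"
    "\<forall>e\<in>Basis. (G e has_real_derivative H e) (at 0)" "L = (\<Sum>e\<in>Basis. H e)"
    using assms(1) unfolding has_lap_def by blast
  obtain G' H' where 2: "\<forall>e\<in>Basis. \<forall>\<^sub>F s in nhds 0. ((\<lambda>s. g (x + s *\<^sub>R e)) has_real_derivative G' e s) (at s)"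
    "\<forall>e\<in>Basis. (G' e has_real_derivative H' e) (at 0)" "M = (\<Sum>e\<in>Basis. H' e)"
    using assms(2) unfolding has_lap_def by blast
  show ?thesis
    unfolding has_lap_def
  proof (intro exI[of _ "\<lambda>e s. G e s + G' e s"] exI[of _ "\<lambda>e. H e + H' e"] conjI ballI)
    fix e :: 'a assume e: "e \<in> Basis"
    show "\<forall>\<^sub>F s in nhds 0. ((\<lambda>s. f (x + s *\<^sub>R e) + g (x + s *\<^sub>R e)) has_real_derivative G e s + G' e s) (at s)"
      using bspec[OF 1(1) e] bspec[OF 2(1) e] by eventually_elim (rule DERIV_add)
    show "((\<lambda>s. G e s + G' e s) has_real_derivative H e + H' e) (at 0)"
      using 1(2) 2(2) e by (intro DERIV_add) auto
  qed (simp add: 1 2 sum.distrib)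
qed

lemma has_lap_cmult:
  assumes "has_lap f x L"
  shows "has_lap (\<lambda>x. c * f x) x (c * L)"
proof -
  obtain G H where 1: "\<forall>e\<in>Basis. \<forall>\<^sub>F s in nhds 0. ((\<lambda>s. f (x + s *\<^sub>R e)) has_real_derivative G e s) (at s)"
    "\<forall>e\<in>Basis. (G e has_real_derivative H e) (at 0)" "L = (\<Sum>e\<in>Basis. H e)"
    using assms(1) unfolding has_lap_def by blast
  show ?thesis
    unfolding has_lap_def
  proof (intro exI[of _ "\<lambda>e s. c * G e s"] exI[of _ "\<lambda>e. c * H e"] conjI ballI)
    fix e :: 'a assume e: "e \<in> Basis"
    show "\<forall>\<^sub>F s in nhds 0. ((\<lambda>s. c * f (x + s *\<^sub>R e)) has_real_derivative c * G e s) (at s)"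
      using bspec[OF 1(1) e] by eventually_elim (rule DERIV_cmult)
    show "((\<lambda>s. c * G e s) has_real_derivative c * H e) (at 0)"
      using 1(2) e by (intro DERIV_cmult) auto
  qed (simp add: 1 sum_distrib_left)
qed

lemma has_lap_diff:
  assumes "has_lap f x L" "has_lap g x M"
  shows "has_lap (\<lambda>x. f x - g x) x (L - M)"
  using has_lap_add[OF assms(1) has_lap_cmult[OF assms(2), of "-1"]] by simp

lemma has_lap_translate:
  assumes "has_lap f (x + w) L"
  shows "has_lap (\<lambda>y. f (y + w)) x L"
  using assms unfolding has_lap_def by (simp add: ac_simps)

lemma has_lap_const: "has_lap (\<lambda>x. c) x 0"
  by (rule has_lapI[of _ _ "\<lambda>e s. 0" "\<lambda>e. 0"]) auto

lemma sum_inner_Basis_square: "(\<Sum>e\<in>Basis. (x \<bullet> e)\<^sup>2) = (norm x)\<^sup>2"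
  unfolding power2_norm_eq_inner using euclidean_inner[of x x] by (simp add: power2_eq_square)

lemma has_lap_height: "has_lap (\<lambda>x. (x - p) \<bullet> \<nu>) x 0"
  by (rule has_lapI[of _ _ "\<lambda>e s. e \<bullet> \<nu>" "\<lambda>e. 0"])
    (auto intro!: derivative_eq_intros simp: inner_diff_left inner_add_left)

lemma has_lap_height_square: "has_lap (\<lambda>x. ((x - p) \<bullet> \<nu>)\<^sup>2) x (2 * (norm \<nu>)\<^sup>2)"
proof (rule has_lapI[of _ _ "\<lambda>e s. 2 * ((x - p) \<bullet> \<nu> + s * (e \<bullet> \<nu>)) * (e \<bullet> \<nu>)" "\<lambda>e. 2 * (\<nu> \<bullet> e)\<^sup>2"])
  show "2 * (norm \<nu>)\<^sup>2 = (\<Sum>e\<in>Basis. 2 * (\<nu> \<bullet> e)\<^sup>2)"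
    by (simp only: sum_inner_Basis_square sum_distrib_left[symmetric])
next
  fix e :: 'a and s :: real
  have "(\<lambda>s. ((x + s *\<^sub>R e - p) \<bullet> \<nu>)\<^sup>2) = (\<lambda>s. ((x - p) \<bullet> \<nu> + s * (e \<bullet> \<nu>))\<^sup>2)"
    by (simp add: inner_diff_left inner_add_left algebra_simps)
  then show "((\<lambda>s. ((x + s *\<^sub>R e - p) \<bullet> \<nu>)\<^sup>2) has_real_derivative 2 * ((x - p) \<bullet> \<nu> + s * (e \<bullet> \<nu>)) * (e \<bullet> \<nu>)) (at s)"
    by (auto intro!: derivative_eq_intros)
qed (auto intro!: derivative_eq_intros simp: power2_eq_square inner_commute)

lemma norm_add_scaleR_square:
  fixes y e :: "'a::real_inner"
  shows "(norm (y + s *\<^sub>R e))\<^sup>2 = (norm y)\<^sup>2 + 2 * s * (y \<bullet> e) + s\<^sup>2 * (norm e)\<^sup>2"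
  unfolding power2_norm_eq_inner by (simp add: algebra_simps inner_commute power2_eq_square)

lemma norm_shift_Basis_square:
  assumes "e \<in> Basis"
  shows "(norm (x + s *\<^sub>R e - c))\<^sup>2 = (norm (x - c))\<^sup>2 + 2 * s * ((x - c) \<bullet> e) + s\<^sup>2"
proof -
  have "x + s *\<^sub>R e - c = (x - c) + s *\<^sub>R e" by simp
  then show ?thesis using norm_add_scaleR_square[of "x - c" s e] assms by (simp only: norm_Basis) simp
qed

lemma has_lap_norm_square:
  fixes x c :: "'a::euclidean_space"
  shows "has_lap (\<lambda>x. (norm (x - c))\<^sup>2) x (2 * DIM('a))"
proof (rule has_lapI[of _ _ "\<lambda>e s. 2 * ((x - c) \<bullet> e) + 2 * s" "\<lambda>e. 2"])
  fix e :: 'a and s :: real assume e: "e \<in> Basis"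
  have "(\<lambda>s. (norm (x + s *\<^sub>R e - c))\<^sup>2) = (\<lambda>s. (norm (x - c))\<^sup>2 + 2 * s * ((x - c) \<bullet> e) + s\<^sup>2)"
    by (simp only: norm_shift_Basis_square[OF e])
  then show "((\<lambda>s. (norm (x + s *\<^sub>R e - c))\<^sup>2) has_real_derivative 2 * ((x - c) \<bullet> e) + 2 * s) (at s)"
    by (auto intro!: derivative_eq_intros)
qed (auto intro!: derivative_eq_intros)

text \<open>This is Hopf's comparison function. Its Laplacian is positive as soon as
  \<open>2 * \<alpha> * q\<close> exceeds the dimension, so a large \<alpha> makes it subharmonic
  outside a given ball around \<open>c\<close>.\<close>

lemma has_lap_gaussian:
  fixes x c :: "'a::euclidean_space"
  defines "q \<equiv> (norm (x - c))\<^sup>2"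
  shows "has_lap (\<lambda>x. exp (- (\<alpha> * (norm (x - c))\<^sup>2))) x (exp (- (\<alpha> * q)) * (4 * \<alpha>\<^sup>2 * q - 2 * \<alpha> * DIM('a)))"
proof (rule has_lapI[of _ _ "\<lambda>e s. exp (- (\<alpha> * (q + 2 * s * ((x - c) \<bullet> e) + s\<^sup>2))) * (- \<alpha> * (2 * ((x - c) \<bullet> e) + 2 * s))"
      "\<lambda>e. exp (- (\<alpha> * q)) * (4 * \<alpha>\<^sup>2 * ((x - c) \<bullet> e)\<^sup>2 - 2 * \<alpha>)"])
  fix e :: 'a and s :: real assume e: "e \<in> Basis"
  have "(\<lambda>s. exp (- (\<alpha> * (norm (x + s *\<^sub>R e - c))\<^sup>2))) = (\<lambda>s. exp (- (\<alpha> * (q + 2 * s * ((x - c) \<bullet> e) + s\<^sup>2))))"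
    by (simp only: norm_shift_Basis_square[OF e] q_def)
  then show "((\<lambda>s. exp (- (\<alpha> * (norm (x + s *\<^sub>R e - c))\<^sup>2))) has_real_derivative
      exp (- (\<alpha> * (q + 2 * s * ((x - c) \<bullet> e) + s\<^sup>2))) * (- \<alpha> * (2 * ((x - c) \<bullet> e) + 2 * s))) (at s)"
    by (auto intro!: derivative_eq_intros)
next
  fix e :: 'a
  show "((\<lambda>s. exp (- (\<alpha> * (q + 2 * s * ((x - c) \<bullet> e) + s\<^sup>2))) * (- \<alpha> * (2 * ((x - c) \<bullet> e) + 2 * s)))
      has_real_derivative exp (- (\<alpha> * q)) * (4 * \<alpha>\<^sup>2 * ((x - c) \<bullet> e)\<^sup>2 - 2 * \<alpha>)) (at 0)"
    by (auto intro!: derivative_eq_intros simp: algebra_simps power2_eq_square)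
next
  show "exp (- (\<alpha> * q)) * (4 * \<alpha>\<^sup>2 * q - 2 * \<alpha> * DIM('a)) =
      (\<Sum>e\<in>(Basis::'a set). exp (- (\<alpha> * q)) * (4 * \<alpha>\<^sup>2 * ((x - c) \<bullet> e)\<^sup>2 - 2 * \<alpha>))"
    by (simp add: sum_distrib_left[symmetric] sum_subtractf sum_inner_Basis_square q_def)
qed

section \<open>The maximum principle\<close>

lemma second_derivative_nonpos_at_local_max:
  fixes f :: "real \<Rightarrow> real"
  assumes "\<forall>\<^sub>F s in nhds 0. (f has_real_derivative G s) (at s)" "(G has_real_derivative H) (at 0)"
    and "\<forall>\<^sub>F s in nhds 0. f s \<le> f 0"
  shows "H \<le> 0"
proof (rule ccontr)
  assume "\<not> ?thesis"
  then have H: "0 < H" by simp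
  obtain d where d: "0 < d" "\<And>s. \<bar>s\<bar> < d \<Longrightarrow> (f has_real_derivative G s) (at s) \<and> f s \<le> f 0"
    using eventually_conj[OF assms(1,3)] unfolding eventually_nhds_metric by (auto simp: dist_real_def)
  have G0: "G 0 = 0"
    by (rule DERIV_local_max[of f _ 0 d]) (use d in auto)
  obtain d' where d': "0 < d'" "\<And>h. 0 < h \<Longrightarrow> h < d' \<Longrightarrow> 0 < G h"
    using DERIV_pos_inc_right[OF assms(2) H] G0 by auto
  define h where "h = min d d' / 2"
  have h: "0 < h" "h < d" "h < d'" using d(1) d'(1) by (auto simp: h_def)
  obtain \<xi> where \<xi>: "0 < \<xi>" "\<xi> < h" "f h - f 0 = (h - 0) * G \<xi>"
    using MVT2[of 0 h f G] h d(2) by force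
  have "0 < G \<xi>" using d' \<xi> h by simp
  then have "f 0 < f h" using \<xi> h by (simp add: algebra_simps)
  moreover have "f h \<le> f 0" using d(2)[of h] h by simp
  ultimately show False by simp
qed

text \<open>A strictly positive Laplacian excludes an interior maximum at once. Every comparison
  function below is therefore built with an excess in its Laplacian.\<close>

lemma strict_maximum_principle:
  fixes v :: "'a::euclidean_space \<Rightarrow> real"
  assumes D: "open D" "bounded D" and v: "continuous_on (closure D) v"
    and lap: "\<And>x. x \<in> D \<Longrightarrow> \<exists>L>0. has_lap v x L"
    and bd: "\<And>x. x \<in> frontier D \<Longrightarrow> v x \<le> 0" and x: "x \<in> closure D"
  shows "v x \<le> 0"
proof -
  have "compact (closure D)" "closure D \<noteq> {}" using D x by auto
  from continuous_attains_sup[OF this v]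
  obtain m where m: "m \<in> closure D" "\<And>y. y \<in> closure D \<Longrightarrow> v y \<le> v m"
    by blast
  have "m \<notin> D"
  proof
    assume mD: "m \<in> D"
    obtain L where L: "0 < L" "has_lap v m L" using lap mD by blast
    then obtain G H where GH: "\<forall>e\<in>Basis. \<forall>\<^sub>F s in nhds 0. ((\<lambda>s. v (m + s *\<^sub>R e)) has_real_derivative G e s) (at s)"
      "\<forall>e\<in>Basis. (G e has_real_derivative H e) (at 0)" "L = (\<Sum>e\<in>Basis. H e)"
      unfolding has_lap_def by blast
    have "H e \<le> 0" if e: "e \<in> Basis" for e
    proof (rule second_derivative_nonpos_at_local_max)
      show "\<forall>\<^sub>F s in nhds 0. ((\<lambda>s. v (m + s *\<^sub>R e)) has_real_derivative G e s) (at s)" using GH e by blast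
      show "(G e has_real_derivative H e) (at 0)" using GH e by blast
      have "((\<lambda>s. m + s *\<^sub>R e) \<longlongrightarrow> m + 0 *\<^sub>R e) (nhds (0::real))"
        by (intro tendsto_intros filterlim_ident)
      then have "\<forall>\<^sub>F s in nhds (0::real). m + s *\<^sub>R e \<in> D"
        using D(1) mD by (intro topological_tendstoD) auto
      then show "\<forall>\<^sub>F s in nhds 0. v (m + s *\<^sub>R e) \<le> v (m + 0 *\<^sub>R e)"
        by eventually_elim (use m closure_subset[of D] in auto)
    qed
    then have "L \<le> 0" using GH(3) by (simp add: sum_nonpos)
    then show False using L by simp
  qed
  then have "m \<in> frontier D" using m D(1) by (simp add: frontier_def interior_open)
  then show ?thesis using bd m x by force
qed

lemma has_derivative_partial:
  fixes f :: "real ^ 'n::finite \<Rightarrow> real"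
  assumes "f differentiable (at x)"
  shows "(f has_derivative (\<lambda>v. \<Sum>i\<in>UNIV. v $ i * partial_deriv i f x)) (at x)"
proof -
  let ?D = "frechet_derivative f (at x)"
  have D: "(f has_derivative ?D) (at x)" using assms frechet_derivative_works by blast
  then have "linear ?D" using has_derivative_linear by blast
  have "?D v = (\<Sum>i\<in>UNIV. v $ i * partial_deriv i f x)" for v
  proof -
    have "?D v = ?D (\<Sum>i\<in>UNIV. v $ i *s axis i 1)" by (simp only: basis_expansion)
    also have "\<dots> = (\<Sum>i\<in>UNIV. v $ i * ?D (axis i 1))"
      using \<open>linear ?D\<close> by (simp add: linear_sum linear_cmul scalar_mult_eq_scaleR)
    finally show ?thesis by (simp add: partial_deriv_def)
  qed
  then show ?thesis using D by (metis (no_types, lifting) ext)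
qed

lemma has_real_derivative_along_line:
  fixes f :: "real ^ 'n::finite \<Rightarrow> real"
  assumes "f differentiable (at (x + s *\<^sub>R v))"
  shows "((\<lambda>s. f (x + s *\<^sub>R v)) has_real_derivative (\<Sum>i\<in>UNIV. v $ i * partial_deriv i f (x + s *\<^sub>R v))) (at s)"
proof -
  have "((\<lambda>s. x + s *\<^sub>R v) has_derivative (\<lambda>h. h *\<^sub>R v)) (at s)"
    by (auto intro!: derivative_eq_intros)
  from has_derivative_compose[OF this has_derivative_partial[OF assms]]
  have *: "((\<lambda>s. f (x + s *\<^sub>R v)) has_derivative
      (\<lambda>h. \<Sum>i\<in>UNIV. (h *\<^sub>R v) $ i * partial_deriv i f (x + s *\<^sub>R v))) (at s)" .
  have "(\<lambda>h. \<Sum>i\<in>UNIV. (h *\<^sub>R v) $ i * c i) = (*) (\<Sum>i\<in>UNIV. v $ i * c i)" for c :: "'n \<Rightarrow> real"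
    by (rule ext) (simp add: sum_distrib_left mult_ac)
  with * show ?thesis by (simp only: has_field_derivative_def)
qed

lemma sum_axis_mult:
  fixes c :: "'n::finite \<Rightarrow> real"
  shows "(\<Sum>j\<in>UNIV. axis i 1 $ j * c j) = c i"
proof -
  have "(\<Sum>j\<in>UNIV. axis i 1 $ j * c j) = (\<Sum>j\<in>UNIV. if j = i then c j else 0)"
    by (intro sum.cong) (auto simp: axis_def)
  then show ?thesis by simp
qed

lemma C2_onD:
  assumes "C2_on S f" "x \<in> S"
  shows "f differentiable (at x)" "partial_deriv i f differentiable (at x)"
  using assms by (auto simp: C2_on_def)

lemma Basis_real_vec: "(Basis :: (real ^ 'n::finite) set) = range (\<lambda>i. axis i 1)"
  by (auto simp: Basis_vec_def)

lemma has_lap_C2: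
  fixes f :: "real ^ 'n::finite \<Rightarrow> real"
  assumes "open S" "C2_on S f" "x \<in> S"
  shows "has_lap f x (laplacian f x)"
proof -
  \<comment> \<open>\<open>has_lap\<close> is indexed by basis vectors and
    \<open>partial_deriv\<close> by coordinates; this function translates between the two.\<close>
  define ind where "ind e = (SOME i::'n. e = axis i (1::real))" for e
  have ind: "ind (axis i 1) = i" for i
    unfolding ind_def by (rule some_equality) (auto simp: axis_eq_axis)
  have *: "((\<lambda>s. g (x + s *\<^sub>R axis i 1)) has_real_derivative partial_deriv i g (x + s *\<^sub>R axis i 1)) (at s)"
    if "g differentiable (at (x + s *\<^sub>R axis i 1))" for g i s
    using has_real_derivative_along_line[OF that] by (simp only: sum_axis_mult)
  show ?thesis
    unfolding has_lap_def
  proof (intro exI[of _ "\<lambda>e s. partial_deriv (ind e) f (x + s *\<^sub>R e)"]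
      exI[of _ "\<lambda>e. partial_deriv (ind e) (partial_deriv (ind e) f) x"] conjI ballI)
    fix e :: "real ^ 'n" assume "e \<in> Basis"
    then obtain i where e: "e = axis i 1" by (auto simp: Basis_real_vec)
    have "((\<lambda>s. x + s *\<^sub>R e) \<longlongrightarrow> x + 0 *\<^sub>R e) (nhds (0::real))"
      by (intro tendsto_intros filterlim_ident)
    then have "\<forall>\<^sub>F s in nhds (0::real). x + s *\<^sub>R e \<in> S"
      using assms by (intro topological_tendstoD) auto
    then show "\<forall>\<^sub>F s in nhds 0. ((\<lambda>s. f (x + s *\<^sub>R e)) has_real_derivative partial_deriv (ind e) f (x + s *\<^sub>R e)) (at s)"
      by eventually_elim (use assms(2) * in \<open>auto simp: e ind C2_on_def\<close>)
    show "((\<lambda>s. partial_deriv (ind e) f (x + s *\<^sub>R e)) has_real_derivative partial_deriv (ind e) (partial_deriv (ind e) f) x) (at 0)"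
      using *[of "partial_deriv i f" 0 i] assms(2,3) by (simp add: e ind C2_on_def)
  next
    have "inj (\<lambda>i::'n. axis i (1::real))" by (auto simp: inj_on_def axis_eq_axis)
    then show "laplacian f x = (\<Sum>e\<in>Basis. partial_deriv (ind e) (partial_deriv (ind e) f) x)"
      by (simp add: Basis_real_vec sum.reindex ind laplacian_def)
  qed
qed

text \<open>The radius and the diameter are parameters, so that the lemmas below can choose their
  constants from \<open>r\<close> and \<open>d\<close> before the domain and the solution are
  introduced.\<close>

definition torsion_domain :: "real \<Rightarrow> real \<Rightarrow> (real ^ 'n::finite) set \<Rightarrow> (real ^ 'n \<Rightarrow> real) \<Rightarrow> bool" where
  "torsion_domain r d \<Omega> u \<longleftrightarrow> open \<Omega> \<and> connected \<Omega> \<and> bounded \<Omega> \<and> \<Omega> \<noteq> {} \<and> two_balls \<Omega> r \<and>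
     diameter \<Omega> = d \<and> solves_torsion_problem \<Omega> u"

lemma torsion_domainD:
  fixes \<Omega> :: "(real ^ 'n::finite) set"
  assumes "torsion_domain r d \<Omega> u"
  shows "open \<Omega>" "connected \<Omega>" "bounded \<Omega>" "\<Omega> \<noteq> {}" "two_balls \<Omega> r" "0 < r" "0 \<le> d"
    "C2_on \<Omega> u" "continuous_on (closure \<Omega>) u" "\<And>x. x \<in> \<Omega> \<Longrightarrow> has_lap u x (CARD('n))"
    "\<And>x. x \<in> frontier \<Omega> \<Longrightarrow> u x = 0"
    "\<And>x y. x \<in> closure \<Omega> \<Longrightarrow> y \<in> closure \<Omega> \<Longrightarrow> norm (x - y) \<le> d"
    "\<And>p. p \<in> frontier \<Omega> \<Longrightarrow> \<exists>\<nu>. inner_normal \<Omega> r p \<nu>"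
    "\<And>p. p \<in> frontier \<Omega> \<Longrightarrow> p \<in> closure \<Omega>"
proof -
  note * = assms[unfolded torsion_domain_def solves_torsion_problem_def]
  show "open \<Omega>" "connected \<Omega>" "bounded \<Omega>" "\<Omega> \<noteq> {}" "two_balls \<Omega> r" "C2_on \<Omega> u" "continuous_on (closure \<Omega>) u"
    using * by auto
  show "0 < r" using * by (simp add: two_balls_def)
  show "0 \<le> d" using * diameter_ge_0 by blast
  show "has_lap u x (CARD('n))" if "x \<in> \<Omega>" for x
    using has_lap_C2[of \<Omega> u x] * that by simp
  show "u x = 0" if "x \<in> frontier \<Omega>" for x using * that by blast
  show "norm (x - y) \<le> d" if "x \<in> closure \<Omega>" "y \<in> closure \<Omega>" for x y
    using diameter_bounded_bound[of "closure \<Omega>" x y] that * by (simp add: dist_norm diameter_closure bounded_closure)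
  show "\<exists>\<nu>. inner_normal \<Omega> r p \<nu>" if "p \<in> frontier \<Omega>" for p
    using * that by (simp add: two_balls_def)
  show "p \<in> closure \<Omega>" if "p \<in> frontier \<Omega>" for p
    using that by (simp add: frontier_def)
qed

section \<open>Barriers and boundary growth of the solution\<close>

lemma torsion_nonpos:
  assumes T: "torsion_domain r d \<Omega> u" and x: "x \<in> closure \<Omega>"
  shows "u x \<le> 0"
  using torsion_domainD(1,3,9)[OF T]
proof (rule strict_maximum_principle[OF _ _ _ _ _ x])
  show "\<exists>L>0. has_lap u y L" if "y \<in> \<Omega>" for y
    using torsion_domainD(10)[OF T that] by (auto intro!: exI[of _ "real (CARD(_))"])
  show "u y \<le> 0" if "y \<in> frontier \<Omega>" for y
    using torsion_domainD(11)[OF T that] by simp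
qed

lemma exp_neg_diff_le:
  fixes a b :: real
  assumes "0 \<le> a" "a \<le> b"
  shows "exp (- a) - exp (- b) \<le> b - a"
proof -
  have "1 - (b - a) \<le> exp (- (b - a))"
    using exp_ge_add_one_self[of "- (b - a)"] by linarith
  then have "exp (- a) * (1 - (b - a)) \<le> exp (- a) * exp (- (b - a))"
    by (intro mult_left_mono) auto
  also have "\<dots> = exp (- b)" by (simp add: exp_add[symmetric])
  finally have "exp (- a) - exp (- b) \<le> exp (- a) * (b - a)" by (simp add: algebra_simps)
  also have "\<dots> \<le> 1 * (b - a)" using assms by (intro mult_right_mono) auto
  finally show ?thesis by simp
qed

text \<open>The Hopf function \<open>w\<close> centred in the exterior ball is zero on its sphere
  and nonpositive on the domain. Its Laplacian exceeds that of \<open>u\<close>, hence it lies below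
  \<open>u\<close>, and its linear behaviour at the sphere bounds \<open>- u\<close>.\<close>

lemma torsion_barrier:
  assumes r: "0 < r"
  obtains G where "0 < G"
    "\<And>(\<Omega> :: (real ^ 'n) set) u x p \<nu>. \<lbrakk>torsion_domain r d \<Omega> u; inner_normal \<Omega> r p \<nu>; p \<in> frontier \<Omega>; x \<in> closure \<Omega>\<rbrakk>
       \<Longrightarrow> - u x \<le> G * (norm (x - (p - r *\<^sub>R \<nu>)) - r)"
proof -
  define N where "N = real CARD('n)"
  have N: "0 < N" by (simp add: N_def)
  \<comment> \<open>For this value, \<open>4 * \<alpha>\<^sup>2 * q - 2 * \<alpha> * N\<close> is at
    least \<open>2 * \<alpha> * N\<close> whenever \<open>q\<close> is at least the square of
    \<open>r\<close>.\<close>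
  define \<alpha> where "\<alpha> = N / r\<^sup>2"
  have \<alpha>: "0 < \<alpha>" using N r by (simp add: \<alpha>_def)
  \<comment> \<open>The domain lies within \<open>r + d\<close> of the centre of the exterior ball,
    so \<open>E\<close> bounds the exponential from below. The factor \<open>K\<close> then lifts
    the Laplacian of \<open>w\<close> to at least \<open>N + 1\<close>, one more than that of
    \<open>u\<close>.\<close>
  define E where "E = exp (- (\<alpha> * (r + d)\<^sup>2))"
  have E: "0 < E" by (simp add: E_def)
  define K where "K = (N + 1) / (E * (2 * \<alpha> * N))"
  have K: "0 < K" using E \<alpha> N by (simp add: K_def)
  define G where "G = K * \<alpha> * (2 * r + \<bar>d\<bar>)"
  have main: "- u x \<le> G * (norm (x - (p - r *\<^sub>R \<nu>)) - r)"
    if T: "torsion_domain r d \<Omega> u" and \<nu>: "inner_normal \<Omega> r p \<nu>" and p: "p \<in> frontier \<Omega>" and x: "x \<in> closure \<Omega>"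
    for \<Omega> :: "(real ^ 'n) set" and u x p \<nu>
  proof -
    note TD = torsion_domainD[OF T]
    define c where "c = p - r *\<^sub>R \<nu>"
    have ge: "r \<le> norm (y - c)" if "y \<in> closure \<Omega>" for y
      using inner_normal_exterior[OF \<nu> that] by (simp add: dist_norm c_def)
    have le: "norm (y - c) \<le> r + d" if "y \<in> closure \<Omega>" for y
    proof -
      have "norm (y - c) \<le> norm (y - p) + norm (p - c)" using norm_triangle_ineq[of "y - p" "p - c"] by simp
      also have "\<dots> \<le> d + r" using TD(12)[OF that TD(14)[OF p]] \<nu> r by (simp add: c_def inner_normal_def)
      finally show ?thesis by simp
    qed
    define w where "w y = K * (exp (- (\<alpha> * (norm (y - c))\<^sup>2)) - exp (- (\<alpha> * r\<^sup>2)))" for y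
    have w0: "w y \<le> 0" if "y \<in> closure \<Omega>" for y
      using ge[OF that] r K \<alpha> by (simp add: w_def mult_nonneg_nonpos power_mono)
    have "w x - u x \<le> 0"
    proof (rule strict_maximum_principle[OF TD(1) TD(3) _ _ _ x])
      show "continuous_on (closure \<Omega>) (\<lambda>y. w y - u y)"
        unfolding w_def by (intro continuous_intros TD(9))
      show "w y - u y \<le> 0" if "y \<in> frontier \<Omega>" for y
        using w0[OF TD(14)[OF that]] TD(11)[OF that] by simp
      fix y assume y: "y \<in> \<Omega>"
      then have yc: "y \<in> closure \<Omega>" using closure_subset by blast
      define q where "q = (norm (y - c))\<^sup>2"
      have q: "r\<^sup>2 \<le> q" "q \<le> (r + d)\<^sup>2" using ge[OF yc] le[OF yc] r by (auto simp: q_def power_mono)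
      define L where "L = exp (- (\<alpha> * q)) * (4 * \<alpha>\<^sup>2 * q - 2 * \<alpha> * N)"
      have "has_lap (\<lambda>y. w y - u y) y (K * (L - 0) - N)"
        unfolding w_def L_def q_def N_def
        using has_lap_gaussian[of \<alpha> c y] TD(10)[OF y]
        by (intro has_lap_diff has_lap_cmult has_lap_const) auto
      moreover have "N + 1 \<le> K * L"
      proof -
        have "2 * \<alpha> * N = 4 * \<alpha>\<^sup>2 * r\<^sup>2 - 2 * \<alpha> * N"
          using r by (simp add: \<alpha>_def power2_eq_square)
        also have "\<dots> \<le> 4 * \<alpha>\<^sup>2 * q - 2 * \<alpha> * N" using q by (simp add: mult_left_mono)
        finally have "E * (2 * \<alpha> * N) \<le> L"
          unfolding L_def E_def using q \<alpha> N by (intro mult_mono) auto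
        then have "K * (E * (2 * \<alpha> * N)) \<le> K * L" using K by (intro mult_left_mono) auto
        then show ?thesis using E \<alpha> N by (simp add: K_def)
      qed
      ultimately show "\<exists>L>0. has_lap (\<lambda>y. w y - u y) y L"
        by (intro exI[of _ "K * (L - 0) - N"]) auto
    qed
    define \<rho> where "\<rho> = norm (x - c)"
    have \<rho>: "r \<le> \<rho>" "\<rho> \<le> r + d" using ge[OF x] le[OF x] by (auto simp: \<rho>_def)
    have "- u x \<le> K * (exp (- (\<alpha> * r\<^sup>2)) - exp (- (\<alpha> * \<rho>\<^sup>2)))"
      using \<open>w x - u x \<le> 0\<close> by (simp add: w_def \<rho>_def algebra_simps)
    also have "\<dots> \<le> K * (\<alpha> * \<rho>\<^sup>2 - \<alpha> * r\<^sup>2)"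
      using K \<alpha> \<rho> r by (intro mult_left_mono exp_neg_diff_le) (auto intro: power_mono)
    also have "\<dots> = K * \<alpha> * ((\<rho> + r) * (\<rho> - r))" by (simp add: algebra_simps power2_eq_square)
    also have "\<dots> \<le> K * \<alpha> * ((2 * r + \<bar>d\<bar>) * (\<rho> - r))"
      using K \<alpha> \<rho> r by (intro mult_left_mono mult_right_mono) auto
    finally show ?thesis by (simp add: G_def \<rho>_def c_def mult.assoc)
  qed
  have "0 < G" using K \<alpha> r by (simp add: G_def add_pos_nonneg)
  then show ?thesis by (rule that) (rule main)
qed

text \<open>The solution in the ball itself has the factor 1/2; the factor 1/4 halves the Laplacian
  and thereby leaves the strict excess \<open>N / 2\<close>.\<close>

lemma torsion_upper_in_ball:
  fixes \<Omega> :: "(real ^ 'n::finite) set"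
  assumes T: "torsion_domain r d \<Omega> u" and sub: "ball c s \<subseteq> \<Omega>" and s: "0 < s" and x: "norm (x - c) \<le> s"
  shows "u x \<le> 1 / 4 * ((norm (x - c))\<^sup>2 - s\<^sup>2)"
proof -
  note TD = torsion_domainD[OF T]
  have cl: "closure (ball c s) \<subseteq> closure \<Omega>" using sub by (rule closure_mono)
  have "u x - 1 / 4 * ((norm (x - c))\<^sup>2 - s\<^sup>2) \<le> 0"
  proof (rule strict_maximum_principle[of "ball c s" "\<lambda>y. u y - 1 / 4 * ((norm (y - c))\<^sup>2 - s\<^sup>2)" x])
    show "continuous_on (closure (ball c s)) (\<lambda>y. u y - 1 / 4 * ((norm (y - c))\<^sup>2 - s\<^sup>2))"
      using continuous_on_subset[OF TD(9) cl] by (intro continuous_intros)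
    show "x \<in> closure (ball c s)" using x s by (simp add: dist_norm norm_minus_commute)
    show "u y - 1 / 4 * ((norm (y - c))\<^sup>2 - s\<^sup>2) \<le> 0" if "y \<in> frontier (ball c s)" for y
    proof -
      have "y \<in> closure (ball c s)" using that by (simp add: frontier_def)
      then have "u y \<le> 0" using torsion_nonpos[OF T] cl by blast
      moreover have "norm (y - c) = s" using that s by (simp add: dist_norm norm_minus_commute)
      ultimately show ?thesis by simp
    qed
    fix y assume "y \<in> ball c s"
    then have "y \<in> \<Omega>" using sub by blast
    then have "has_lap (\<lambda>y. u y - 1 / 4 * ((norm (y - c))\<^sup>2 - s\<^sup>2)) y (CARD('n) - 1 / 4 * (real (2 * DIM(real ^ 'n)) - 0))"
      by (intro has_lap_diff has_lap_cmult has_lap_const has_lap_norm_square TD(10))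
    then show "\<exists>L>0. has_lap (\<lambda>y. u y - 1 / 4 * ((norm (y - c))\<^sup>2 - s\<^sup>2)) y L"
      by (intro exI conjI) (auto simp: field_simps)
  qed auto
  then show ?thesis by simp
qed

text \<open>A quantitative Hopf lemma: comparison in the interior tangent ball makes
  \<open>- u\<close> grow at least linearly along the normal. It later bounds the gradient from
  below.\<close>

lemma torsion_interior_upper:
  fixes \<Omega> :: "(real ^ 'n::finite) set"
  assumes T: "torsion_domain r d \<Omega> u" and \<nu>: "inner_normal \<Omega> r p \<nu>"
    and t: "0 \<le> t" "t \<le> r"
  shows "u (p + t *\<^sub>R \<nu>) \<le> - (r / 4 * t)"
proof -
  define c where "c = p + r *\<^sub>R \<nu>"
  have n: "norm \<nu> = 1" and sub: "ball c r \<subseteq> \<Omega>" using \<nu> by (auto simp: inner_normal_def c_def)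
  define x where "x = p + t *\<^sub>R \<nu>"
  have "x - c = (t - r) *\<^sub>R \<nu>" by (simp add: x_def c_def algebra_simps)
  then have xc: "norm (x - c) = r - t" using n t by simp
  have "u x \<le> 1 / 4 * ((r - t)\<^sup>2 - r\<^sup>2)"
    using torsion_upper_in_ball[OF T sub torsion_domainD(6)[OF T], of x] xc t by simp
  also have "\<dots> = - (t * (2 * r - t) / 4)" by (simp add: power2_eq_square field_simps)
  also have "\<dots> \<le> - (t * r / 4)" using t by (simp add: mult_left_mono)
  finally show ?thesis by (simp add: x_def mult.commute)
qed

text \<open>The first form measures \<open>x\<close> by its distance to the exterior ball, which is
  of second order in tangential displacements; the second is its plain consequence in terms of the
  distance to \<open>p\<close>.\<close>

lemma torsion_boundary_growth:
  assumes r: "0 < r"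
  obtains G where "0 < G"
    "\<And>(\<Omega> :: (real ^ 'n) set) u x p \<nu>. \<lbrakk>torsion_domain r d \<Omega> u; inner_normal \<Omega> r p \<nu>; p \<in> frontier \<Omega>; x \<in> closure \<Omega>\<rbrakk>
       \<Longrightarrow> \<bar>u x\<bar> \<le> G * (norm (x - (p - r *\<^sub>R \<nu>)) - r)"
    "\<And>(\<Omega> :: (real ^ 'n) set) u x p. \<lbrakk>torsion_domain r d \<Omega> u; p \<in> frontier \<Omega>; x \<in> closure \<Omega>\<rbrakk>
       \<Longrightarrow> \<bar>u x\<bar> \<le> G * norm (x - p)"
proof -
  obtain G where G: "0 < G" and b: "\<And>(\<Omega> :: (real ^ 'n) set) u x p \<nu>. \<lbrakk>torsion_domain r d \<Omega> u; inner_normal \<Omega> r p \<nu>; p \<in> frontier \<Omega>; x \<in> closure \<Omega>\<rbrakk>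
       \<Longrightarrow> - u x \<le> G * (norm (x - (p - r *\<^sub>R \<nu>)) - r)"
    using torsion_barrier[OF r, where d = d and 'n = 'n] by metis
  have 1: "\<bar>u x\<bar> \<le> G * (norm (x - (p - r *\<^sub>R \<nu>)) - r)"
    if "torsion_domain r d \<Omega> u" "inner_normal \<Omega> r p \<nu>" "p \<in> frontier \<Omega>" "x \<in> closure \<Omega>" for \<Omega> :: "(real ^ 'n) set" and u x p \<nu>
    using b[OF that] torsion_nonpos[OF that(1,4)] by simp
  have 2: "\<bar>u x\<bar> \<le> G * norm (x - p)"
    if T: "torsion_domain r d \<Omega> u" "p \<in> frontier \<Omega>" "x \<in> closure \<Omega>" for \<Omega> :: "(real ^ 'n) set" and u x p
  proof -
    obtain \<nu> where \<nu>: "inner_normal \<Omega> r p \<nu>" using torsion_domainD(13)[OF T(1,2)] by blast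
    have "norm (x - (p - r *\<^sub>R \<nu>)) \<le> norm (x - p) + norm (r *\<^sub>R \<nu>)"
      using norm_triangle_ineq[of "x - p" "r *\<^sub>R \<nu>"] by (simp add: algebra_simps)
    also have "norm (r *\<^sub>R \<nu>) = r" using \<nu> r by (simp add: inner_normal_def)
    finally have "G * (norm (x - (p - r *\<^sub>R \<nu>)) - r) \<le> G * norm (x - p)"
      using G by (intro mult_left_mono) auto
    then show ?thesis using 1[OF T(1) \<nu> T(2,3)] by linarith
  qed
  show ?thesis by (rule that[OF G]) (fact 1, fact 2)
qed

subsection \<open>Mean values of harmonic functions\<close>

lemma set_integrable_cball:
  fixes f :: "'a::euclidean_space \<Rightarrow> real"
  assumes "continuous_on (cball x r) f"
  shows "set_integrable lborel (cball x r) f"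
  using borel_integrable_compact[OF compact_cball assms] by (simp add: set_integrable_def)

lemma integrable_indicator_cball: "integrable lborel (indicat_real (cball (x::'a::euclidean_space) r))"
  by (rule integrable_real_indicator[OF _ emeasure_lborel_cball_finite]) simp

lemma integrable_compact_support:
  fixes F :: "'a::euclidean_space \<Rightarrow> real"
  assumes F: "continuous_on UNIV F" and supp: "\<And>w. R \<le> norm w \<Longrightarrow> F w = 0"
  shows "integrable lborel F"
proof -
  have "set_integrable lborel (cball 0 R) F"
    by (rule set_integrable_cball) (rule continuous_on_subset[OF F], simp)
  moreover have "indicat_real (cball 0 R) w *\<^sub>R F w = F w" for w
    using supp[of w] by (cases "norm w \<le> R") auto
  ultimately show ?thesis unfolding set_integrable_def by (simp only:)
qed

text \<open>By translation invariance of Lebesgue measure every difference quotient of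
  \<open>F\<close> has integral zero, and dominated convergence passes this on to the derivative.
  The space need not be split into lines parallel to \<open>e\<close>.\<close>

lemma integral_line_derivative_zero:
  fixes F F' :: "'a::euclidean_space \<Rightarrow> real"
  assumes F: "continuous_on UNIV F" and F': "continuous_on UNIV F'"
    and supp: "\<And>w. R \<le> norm w \<Longrightarrow> F w = 0" "\<And>w. R \<le> norm w \<Longrightarrow> F' w = 0" and "0 < R"
    and der: "\<And>w. ((\<lambda>s. F (w + s *\<^sub>R e)) has_real_derivative F' w) (at 0)"
  shows "(LINT w|lborel. F' w) = 0"
proof -
  define X where "X n = 1 / real (Suc n)" for n
  have X: "0 < X n" "X n \<le> 1" for n by (auto simp: X_def)
  have X0: "X \<longlonglongrightarrow> 0" unfolding X_def by (rule LIMSEQ_Suc[OF lim_1_over_n])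
  define D where "D n w = (F (w + X n *\<^sub>R e) - F w) / X n" for n w
  have der': "((\<lambda>s. F (w + s *\<^sub>R e)) has_real_derivative F' (w + t *\<^sub>R e)) (at t)" for w t
  proof -
    have "((\<lambda>s. F (w + t *\<^sub>R e + s *\<^sub>R e)) has_real_derivative F' (w + t *\<^sub>R e)) (at 0)" by (rule der)
    then have "((\<lambda>s. F (w + (t + s) *\<^sub>R e)) has_real_derivative F' (w + t *\<^sub>R e)) (at 0)"
      by (simp add: scaleR_add_left add.assoc)
    then show ?thesis using DERIV_shift[of "\<lambda>s. F (w + s *\<^sub>R e)" _ 0 t] by (simp add: add.commute)
  qed
  obtain M where M: "\<And>w. \<bar>F' w\<bar> \<le> M" "0 \<le> M"
  proof -
    have "compact (F' ` cball 0 R)"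
      by (intro compact_continuous_image continuous_on_subset[OF F'] compact_cball) auto
    then obtain M where M: "\<And>w. w \<in> cball 0 R \<Longrightarrow> \<bar>F' w\<bar> \<le> M"
      unfolding bounded_iff using compact_imp_bounded bounded_iff by (metis image_eqI real_norm_def)
    have "\<bar>F' w\<bar> \<le> max M 0" for w using M[of w] supp(2)[of w] by (cases "norm w \<le> R") auto
    then show ?thesis using that[of "max M 0"] by auto
  qed
  have intF: "integrable lborel F" by (rule integrable_compact_support[OF F supp(1)])
  have trans: "integrable lborel (\<lambda>w. F (w + c))" "(LINT w|lborel. F (w + c)) = (LINT w|lborel. F w)" for c
  proof -
    have d: "lborel = distr lborel borel ((+) c)" by (simp add: lborel_distr_plus)
    have Fm: "F \<in> borel_measurable borel" using F by (rule borel_measurable_continuous_onI)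
    have "integrable (distr lborel borel ((+) c)) F" using intF by (simp add: lborel_distr_plus)
    then show "integrable lborel (\<lambda>w. F (w + c))"
      by (subst (asm) integrable_distr_eq) (use Fm in \<open>auto simp: add.commute\<close>)
    have "(LINT w|lborel. F w) = (LINT w|distr lborel borel ((+) c). F w)" using d by simp
    also have "\<dots> = (LINT w|lborel. F (c + w))"
      by (rule integral_distr) (use Fm in auto)
    finally show "(LINT w|lborel. F (w + c)) = (LINT w|lborel. F w)" by (simp add: add.commute)
  qed
  have D0: "(LINT w|lborel. D n w) = 0" for n
    unfolding D_def using trans intF by simp
  have "(\<lambda>n. LINT w|lborel. D n w) \<longlonglongrightarrow> (LINT w|lborel. F' w)"
  \<comment> \<open>The increments \<open>X n\<close> are at most 1, so all quotients vanish outside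
    the ball of radius \<open>R + norm e\<close>; inside, the mean value theorem bounds them by
    \<open>M\<close>.\<close>
  proof (rule integral_dominated_convergence[where w = "\<lambda>w. M * indicat_real (cball 0 (R + norm e)) w"])
    show "F' \<in> borel_measurable lborel" using borel_measurable_continuous_onI[OF F'] by simp
    show "D n \<in> borel_measurable lborel" for n
      unfolding D_def using trans(1) intF by (intro borel_measurable_divide borel_measurable_diff) auto
    show "integrable lborel (\<lambda>w. M * indicat_real (cball 0 (R + norm e)) w)"
      by (intro integrable_mult_right integrable_indicator_cball)
    show "AE w in lborel. (\<lambda>n. D n w) \<longlonglongrightarrow> F' w"
    proof (rule AE_I2)
      fix w
      have "((\<lambda>h. (F (w + (0 + h) *\<^sub>R e) - F (w + 0 *\<^sub>R e)) / h) \<longlongrightarrow> F' w) (at 0)"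
        using der[of w] unfolding DERIV_def .
      moreover have "filterlim X (at 0) sequentially"
        unfolding filterlim_at using X0 X by (auto intro!: always_eventually simp: less_imp_neq[symmetric])
      ultimately show "(\<lambda>n. D n w) \<longlonglongrightarrow> F' w"
        unfolding D_def by (auto dest: filterlim_compose)
    qed
    show "AE w in lborel. norm (D n w) \<le> M * indicat_real (cball 0 (R + norm e)) w" for n
    proof (rule AE_I2)
      fix w
      show "norm (D n w) \<le> M * indicat_real (cball 0 (R + norm e)) w"
      proof (cases "norm w \<le> R + norm e")
        case True
        obtain t where "F (w + X n *\<^sub>R e) - F (w + 0 *\<^sub>R e) = (X n - 0) * F' (w + t *\<^sub>R e)"
          using MVT2[of 0 "X n" "\<lambda>s. F (w + s *\<^sub>R e)" "\<lambda>s. F' (w + s *\<^sub>R e)"] X der' by blast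
        then have "D n w = F' (w + t *\<^sub>R e)" using X[of n] by (simp add: D_def)
        then show ?thesis using M True by simp
      next
        case False
        have "norm w \<le> norm (w + X n *\<^sub>R e) + norm (X n *\<^sub>R e)"
          using norm_triangle_ineq4[of "w + X n *\<^sub>R e" "X n *\<^sub>R e"] by simp
        moreover have "norm (X n *\<^sub>R e) \<le> norm e" using X[of n] by (simp add: mult_left_le_one_le)
        ultimately have "R \<le> norm (w + X n *\<^sub>R e)" using False by linarith
        moreover have "R \<le> norm w" using False norm_ge_zero[of e] by linarith
        ultimately show ?thesis using supp(1) M(2) by (simp add: D_def)
      qed
    qed
  qed
  then show ?thesis using D0 by (simp add: LIMSEQ_const_iff)
qed

text \<open>\<open>K\<close> and its derivative vanish outside the unit ball, so the product of
  \<open>G\<close> and \<open>K\<close> can be extended by zero. The extension is regular on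
  \<open>U\<close> and on the complement of the closed ball, and these two open sets cover the
  space.\<close>

lemma integration_by_parts_cball:
  fixes G G' K K' :: "'a::euclidean_space \<Rightarrow> real"
  assumes U: "open U" "cball 0 1 \<subseteq> U"
    and G: "continuous_on U G" "continuous_on U G'"
      "\<And>w. w \<in> U \<Longrightarrow> ((\<lambda>s. G (w + s *\<^sub>R e)) has_real_derivative G' w) (at 0)"
    and K: "continuous_on UNIV K" "continuous_on UNIV K'"
      "\<And>w. ((\<lambda>s. K (w + s *\<^sub>R e)) has_real_derivative K' w) (at 0)"
      "\<And>w. 1 \<le> norm w \<Longrightarrow> K w = 0" "\<And>w. 1 \<le> norm w \<Longrightarrow> K' w = 0"
  shows "(LINT w:cball 0 1|lborel. G' w * K w) = - (LINT w:cball 0 1|lborel. G w * K' w)"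
proof -
  define F where "F w = (if w \<in> U then G w * K w else 0)" for w
  define F' where "F' w = (if w \<in> U then G' w * K w + G w * K' w else 0)" for w
  let ?V = "- cball (0::'a) 1"
  have UV: "U \<union> ?V = UNIV" using U by blast
  have V: "open ?V" by auto
  have cont: "continuous_on UNIV (\<lambda>w. if w \<in> U then f w else 0)"
    if "continuous_on U f" "\<And>w. 1 \<le> norm w \<Longrightarrow> f w = 0" for f :: "'a \<Rightarrow> real"
  proof -
    have c1: "continuous_on U (\<lambda>w. if w \<in> U then f w else 0)"
      using that(1) by (rule continuous_on_eq) auto
    have c2: "continuous_on ?V (\<lambda>w. if w \<in> U then f w else 0)"
      by (rule continuous_on_eq[of _ "\<lambda>_. 0"]) (use that(2) in \<open>auto simp: not_le\<close>)
    show ?thesis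
      using continuous_on_open_Un[OF U(1) V c1 c2] unfolding UV .
  qed
  have "(LINT w|lborel. F' w) = 0"
  proof (rule integral_line_derivative_zero[of F F' 1 e])
    show "continuous_on UNIV F" unfolding F_def
      by (intro cont continuous_intros G continuous_on_subset[OF K(1)]) (auto simp: K)
    show "continuous_on UNIV F'" unfolding F'_def
      by (intro cont continuous_intros G continuous_on_subset[OF K(1)] continuous_on_subset[OF K(2)]) (auto simp: K)
    show "F w = 0" "F' w = 0" if "1 \<le> norm w" for w using that K(4,5) by (auto simp: F_def F'_def)
    fix w
    have lim: "((\<lambda>s. w + s *\<^sub>R e) \<longlongrightarrow> w + 0 *\<^sub>R e) (nhds (0::real))"
      by (intro tendsto_intros filterlim_ident)
    show "((\<lambda>s. F (w + s *\<^sub>R e)) has_real_derivative F' w) (at 0)"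
    proof (cases "w \<in> U")
      case True
      then have "\<forall>\<^sub>F s in nhds (0::real). w + s *\<^sub>R e \<in> U"
        using lim U by (intro topological_tendstoD) auto
      then have ev: "\<forall>\<^sub>F s in nhds (0::real). G (w + s *\<^sub>R e) * K (w + s *\<^sub>R e) = F (w + s *\<^sub>R e)"
        by eventually_elim (simp add: F_def)
      have "((\<lambda>s. G (w + s *\<^sub>R e) * K (w + s *\<^sub>R e)) has_real_derivative F' w) (at 0)"
        using DERIV_mult[OF G(3)[OF True] K(3)[of w]] True by (simp add: F'_def mult.commute)
      then show ?thesis using DERIV_cong_ev[OF refl ev refl] by blast
    next
      case False
      then have "w \<in> ?V" using U by blast
      then have "\<forall>\<^sub>F s in nhds (0::real). w + s *\<^sub>R e \<in> ?V"
        using lim V by (intro topological_tendstoD) auto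
      then have ev: "\<forall>\<^sub>F s in nhds (0::real). 0 = F (w + s *\<^sub>R e)"
        by eventually_elim (simp add: F_def K(4))
      have "((\<lambda>s. 0) has_real_derivative F' w) (at 0)" using False by (simp add: F'_def)
      then show ?thesis using DERIV_cong_ev[OF refl ev refl] by blast
    qed
  qed simp
  moreover have "(LINT w|lborel. F' w) = (LINT w:cball 0 1|lborel. G' w * K w + G w * K' w)"
    unfolding set_lebesgue_integral_def
    using U(2) K(4,5) by (intro Bochner_Integration.integral_cong refl) (auto simp: F'_def indicator_def)
  moreover have "set_integrable lborel (cball 0 1) (\<lambda>w. G' w * K w)"
    by (intro set_integrable_cball continuous_intros continuous_on_subset[OF G(2) U(2)] continuous_on_subset[OF K(1)]) auto
  moreover have "set_integrable lborel (cball 0 1) (\<lambda>w. G w * K' w)"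
    by (intro set_integrable_cball continuous_intros continuous_on_subset[OF G(1) U(2)] continuous_on_subset[OF K(2)]) auto
  ultimately show ?thesis by (simp add: set_integral_add)
qed

text \<open>Compactness of the parameter range times the ball bounds \<open>f'\<close>, and the mean
  value theorem makes this bound dominate the difference quotients.\<close>

lemma has_real_derivative_set_integral:
  fixes f f' :: "real \<Rightarrow> 'a::euclidean_space \<Rightarrow> real"
  assumes a: "0 < a"
    and f': "continuous_on ({t - a..t + a} \<times> cball x r) (\<lambda>(\<tau>, w). f' \<tau> w)"
    and f: "\<And>\<tau>. \<bar>\<tau> - t\<bar> \<le> a \<Longrightarrow> continuous_on (cball x r) (f \<tau>)"
    and der: "\<And>\<tau> w. \<bar>\<tau> - t\<bar> \<le> a \<Longrightarrow> w \<in> cball x r \<Longrightarrow> ((\<lambda>\<tau>. f \<tau> w) has_real_derivative f' \<tau> w) (at \<tau>)"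
  shows "((\<lambda>\<tau>. LINT w:cball x r|lborel. f \<tau> w) has_real_derivative (LINT w:cball x r|lborel. f' t w)) (at t)"
proof -
  let ?B = "cball x r"
  let ?I = "\<lambda>g. LINT w:?B|lborel. (g w :: real)"
  have f't: "continuous_on ?B (f' t)"
  proof -
    have "continuous_on ?B (\<lambda>w. (t, w))" by (intro continuous_intros)
    moreover have "(\<lambda>w. (t, w)) ` ?B \<subseteq> {t - a..t + a} \<times> ?B" using a by auto
    ultimately have "continuous_on ?B (\<lambda>w. (\<lambda>(\<tau>, w). f' \<tau> w) (t, w))"
      by (rule continuous_on_compose2[OF f'])
    then show ?thesis by simp
  qed
  obtain M where M: "\<And>\<tau> w. \<bar>\<tau> - t\<bar> \<le> a \<Longrightarrow> w \<in> ?B \<Longrightarrow> \<bar>f' \<tau> w\<bar> \<le> M"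
  proof -
    have "compact ((\<lambda>(\<tau>, w). f' \<tau> w) ` ({t - a..t + a} \<times> ?B))"
      by (rule compact_continuous_image[OF f']) (intro compact_Times compact_Icc compact_cball)
    then have "bounded ((\<lambda>(\<tau>, w). f' \<tau> w) ` ({t - a..t + a} \<times> ?B))" by (rule compact_imp_bounded)
    then obtain M where M: "\<And>y. y \<in> (\<lambda>(\<tau>, w). f' \<tau> w) ` ({t - a..t + a} \<times> ?B) \<Longrightarrow> \<bar>y\<bar> \<le> M"
      unfolding bounded_iff real_norm_def by blast
    have "\<bar>f' \<tau> w\<bar> \<le> M" if "\<bar>\<tau> - t\<bar> \<le> a" "w \<in> ?B" for \<tau> w
    proof -
      have "(\<tau>, w) \<in> {t - a..t + a} \<times> ?B" using that by (simp add: abs_le_iff)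
      then show ?thesis using M[of "f' \<tau> w"] by (metis (no_types, lifting) case_prod_conv image_eqI)
    qed
    then show ?thesis by (rule that)
  qed
  have "(\<lambda>n. (?I (f (t + X n)) - ?I (f t)) / X n) \<longlonglongrightarrow> ?I (f' t)"
    if X: "\<And>n. X n \<noteq> 0" "X \<longlonglongrightarrow> 0" "\<And>n. \<bar>X n\<bar> < a" for X
  proof -
    define D where "D n w = indicat_real ?B w * ((f (t + X n) w - f t w) / X n)" for n w
    have int: "set_integrable lborel ?B (f \<tau>)" if "\<bar>\<tau> - t\<bar> \<le> a" for \<tau>
      by (rule set_integrable_cball) (rule f[OF that])
    have "(?I (f (t + X n)) - ?I (f t)) / X n = (LINT w|lborel. D n w)" for n
    proof -
      have "(?I (f (t + X n)) - ?I (f t)) / X n = (LINT w:?B|lborel. f (t + X n) w - f t w) / X n"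
        using int[of "t + X n"] int[of t] X(3)[of n] a by (simp add: set_integral_diff)
      then show ?thesis by (simp add: set_lebesgue_integral_def D_def)
    qed
    moreover have "(\<lambda>n. LINT w|lborel. D n w) \<longlonglongrightarrow> (LINT w|lborel. indicat_real ?B w * f' t w)"
    proof (rule integral_dominated_convergence[where w = "\<lambda>w. indicat_real ?B w * M"])
      show "(\<lambda>w. indicat_real ?B w * f' t w) \<in> borel_measurable lborel"
        using set_integrable_cball[OF f't] by (simp add: set_integrable_def)
      show "D n \<in> borel_measurable lborel" for n
      proof -
        have "set_integrable lborel ?B (\<lambda>w. (f (t + X n) w - f t w) / X n)"
          using int[of "t + X n"] int[of t] X(3)[of n] a by (intro set_integrable_divide set_integral_diff) auto
        then show ?thesis by (simp add: set_integrable_def D_def[abs_def])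
      qed
      show "integrable lborel (\<lambda>w. indicat_real ?B w * M)"
        by (intro integrable_mult_left integrable_indicator_cball)
      show "AE w in lborel. (\<lambda>n. D n w) \<longlonglongrightarrow> indicat_real ?B w * f' t w"
      proof (rule AE_I2)
        fix w
        show "(\<lambda>n. D n w) \<longlonglongrightarrow> indicat_real ?B w * f' t w"
        proof (cases "w \<in> ?B")
          case True
          have "((\<lambda>h. (f (t + h) w - f t w) / h) \<longlongrightarrow> f' t w) (at 0)"
            using der[of t w] True a unfolding DERIV_def by simp
          moreover have "filterlim X (at 0) sequentially"
            unfolding filterlim_at using X by (auto intro!: always_eventually)
          ultimately show ?thesis
            unfolding D_def using True by (auto dest: filterlim_compose)
        qed (simp add: D_def)
      qed
      show "AE w in lborel. norm (D n w) \<le> indicat_real ?B w * M" for n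
      proof (rule AE_I2)
        fix w
        show "norm (D n w) \<le> indicat_real ?B w * M"
        proof (cases "w \<in> ?B")
          case True
          have "\<exists>\<xi>. \<bar>\<xi> - t\<bar> \<le> a \<and> f (t + X n) w - f t w = X n * f' \<xi> w"
          proof (cases "0 < X n")
            case p: True
            have "\<exists>z>t. z < t + X n \<and> f (t + X n) w - f t w = (t + X n - t) * f' z w"
              by (rule MVT2) (use p X(3)[of n] True in \<open>auto intro!: der\<close>)
            then obtain z where "t < z" "z < t + X n" "f (t + X n) w - f t w = X n * f' z w" by auto
            then show ?thesis using X(3)[of n] p by (intro exI[of _ z]) auto
          next
            case p: False
            then have p: "X n < 0" using X(1)[of n] by linarith
            have "\<exists>z>t + X n. z < t \<and> f t w - f (t + X n) w = (t - (t + X n)) * f' z w"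
              by (rule MVT2) (use p X(3)[of n] True in \<open>auto intro!: der\<close>)
            then obtain z where "t + X n < z" "z < t" "f t w - f (t + X n) w = - X n * f' z w" by auto
            then show ?thesis using X(3)[of n] p by (intro exI[of _ z]) auto
          qed
          then obtain \<xi> where "\<bar>\<xi> - t\<bar> \<le> a" "f (t + X n) w - f t w = X n * f' \<xi> w" by blast
          then show ?thesis using True M[of \<xi> w] X(1)[of n] by (simp add: D_def)
        qed (simp add: D_def)
      qed
    qed
    ultimately show ?thesis by (simp add: set_lebesgue_integral_def)
  qed
  note main = this
  show ?thesis
    unfolding DERIV_def tendsto_at_iff_sequentially
  proof (intro allI impI)
    fix X :: "nat \<Rightarrow> real" assume X: "\<forall>i. X i \<in> UNIV - {0}" "X \<longlonglongrightarrow> 0"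
    have "\<forall>\<^sub>F n in sequentially. \<bar>X n\<bar> < a"
      using order_tendstoD(2)[OF tendsto_rabs_zero[OF X(2)] a] .
    then obtain n0 where n0: "\<And>n. n0 \<le> n \<Longrightarrow> \<bar>X n\<bar> < a" unfolding eventually_sequentially by blast
    have "(\<lambda>n. (?I (f (t + X (n + n0))) - ?I (f t)) / X (n + n0)) \<longlonglongrightarrow> ?I (f' t)"
      by (rule main) (use X n0 LIMSEQ_ignore_initial_segment in auto)
    then have "(\<lambda>n. (?I (f (t + X n)) - ?I (f t)) / X n) \<longlonglongrightarrow> ?I (f' t)"
      by (rule LIMSEQ_offset)
    then show "((\<lambda>h. (?I (f (t + h)) - ?I (f t)) / h) \<circ> X) \<longlonglongrightarrow> ?I (f' t)"
      by (simp add: o_def)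
  qed
qed

section \<open>The polynomial weight and the mean value property\<close>

definition kern :: "nat \<Rightarrow> 'a::real_inner \<Rightarrow> real" where
  "kern k w = (max 0 (1 - (norm w)\<^sup>2)) ^ k"

lemma has_real_derivative_max_power:
  assumes "1 \<le> k"
  shows "((\<lambda>x. (max 0 x) ^ Suc k) has_real_derivative real (Suc k) * (max 0 x) ^ k) (at (x::real))"
proof -
  consider "0 < x" | "x < 0" | "x = 0" by linarith
  then show ?thesis
  proof cases
    case 1
    have ev: "\<forall>\<^sub>F y in nhds x. y ^ Suc k = (max 0 y) ^ Suc k"
      by (rule eventually_mono[OF eventually_nhds_in_open[of "{0<..}" x]]) (use 1 in auto)
    have "((\<lambda>x. x ^ Suc k) has_real_derivative real (Suc k) * x ^ k) (at x)"
      by (rule derivative_eq_intros refl | simp)+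
    then show ?thesis using DERIV_cong_ev[OF refl ev refl] 1 by simp
  next
    case 2
    have ev: "\<forall>\<^sub>F y in nhds x. 0 = (max 0 y) ^ Suc k"
      by (rule eventually_mono[OF eventually_nhds_in_open[of "{..<0}" x]]) (use 2 in auto)
    have "((\<lambda>x. 0) has_real_derivative 0) (at x)" by simp
    then show ?thesis using DERIV_cong_ev[OF refl ev refl] 2 assms by (simp add: power_0_left)
  next
    case 3
    have "((\<lambda>h. (max 0 h) ^ k * (max 0 h / h)) \<longlongrightarrow> 0) (at (0::real))"
    proof (rule Lim_null_comparison)
      show "\<forall>\<^sub>F h in at 0. norm ((max 0 h) ^ k * (max 0 h / h)) \<le> \<bar>h :: real\<bar> ^ k"
      proof (rule always_eventually, rule allI)
        fix h :: real
        have "(max 0 h) ^ k \<le> \<bar>h\<bar> ^ k" by (intro power_mono) auto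
        moreover have "\<bar>max 0 h / h\<bar> \<le> 1" by (simp add: max_def)
        ultimately have "(max 0 h) ^ k * \<bar>max 0 h / h\<bar> \<le> \<bar>h\<bar> ^ k * 1"
          by (intro mult_mono) auto
        then show "norm ((max 0 h) ^ k * (max 0 h / h)) \<le> \<bar>h\<bar> ^ k" by (simp add: abs_mult)
      qed
      have "((\<lambda>h::real. \<bar>h\<bar> ^ k) \<longlongrightarrow> \<bar>0\<bar> ^ k) (at 0)" by (intro tendsto_intros)
      moreover have z: "\<bar>0 :: real\<bar> ^ k = 0" using assms by (simp add: power_0_left)
      ultimately show "((\<lambda>h::real. \<bar>h\<bar> ^ k) \<longlongrightarrow> 0) (at 0)" by (simp only: z)
    qed
    then show ?thesis using 3 assms by (simp add: DERIV_def mult.commute power_0_left)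
  qed
qed

lemma kern_zero: "1 \<le> norm w \<Longrightarrow> 1 \<le> k \<Longrightarrow> kern k w = 0"
proof -
  assume "1 \<le> norm w" "1 \<le> k"
  then have "1 \<le> (norm w)\<^sup>2" by (simp add: one_le_power)
  then have "max 0 (1 - (norm w)\<^sup>2) = 0" by linarith
  then show ?thesis using \<open>1 \<le> k\<close> by (simp add: kern_def)
qed

lemma kern_nonneg: "0 \<le> kern k w"
  by (simp add: kern_def)

lemma kern_le_one: "kern k w \<le> 1"
  by (simp add: kern_def power_le_one)

lemma continuous_on_kern: "continuous_on S (kern k)"
  unfolding kern_def[abs_def] by (intro continuous_intros)

text \<open>Each differentiation lowers the exponent by one, and the exponent has to stay positive
  for the weight to vanish continuously on the sphere. A mean with exponent 3 leaves room for two
  integrations by parts, and exponent 4 provides a potential for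
  \<open>w $ i * kern 3 w\<close>.\<close>

lemma kern_line_derivative:
  assumes "1 \<le> k"
  shows "((\<lambda>s. kern (Suc k) (w + s *\<^sub>R e)) has_real_derivative - (2 * real (Suc k)) * (w \<bullet> e) * kern k w) (at 0)"
proof -
  have eq: "(\<lambda>s. kern (Suc k) (w + s *\<^sub>R e)) =
      (\<lambda>s. (max 0 (1 - ((norm w)\<^sup>2 + 2 * s * (w \<bullet> e) + s\<^sup>2 * (norm e)\<^sup>2))) ^ Suc k)"
    unfolding kern_def norm_add_scaleR_square ..
  have 1: "((\<lambda>s. 1 - ((norm w)\<^sup>2 + 2 * s * (w \<bullet> e) + s\<^sup>2 * (norm e)\<^sup>2)) has_real_derivative - (2 * (w \<bullet> e))) (at 0)"
    by (auto intro!: derivative_eq_intros)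
  have 2: "((\<lambda>s. (max 0 (1 - ((norm w)\<^sup>2 + 2 * s * (w \<bullet> e) + s\<^sup>2 * (norm e)\<^sup>2))) ^ Suc k) has_real_derivative
      (real (Suc k) * (max 0 (1 - ((norm w)\<^sup>2 + 2 * 0 * (w \<bullet> e) + 0\<^sup>2 * (norm e)\<^sup>2))) ^ k) * - (2 * (w \<bullet> e))) (at 0)"
    by (rule DERIV_chain2[OF has_real_derivative_max_power[OF assms] 1])
  show ?thesis unfolding eq using 2 by (simp add: kern_def algebra_simps)
qed

abbreviation unit_ball_integral :: "('a::euclidean_space \<Rightarrow> real) \<Rightarrow> real" where
  "unit_ball_integral f \<equiv> (LINT w:cball 0 1|lborel. f w)"

definition kern_mass :: "'a::euclidean_space itself \<Rightarrow> real" where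
  "kern_mass _ = (LINT w:cball (0::'a) 1|lborel. kern 3 w)"

lemma set_integral_mono_cball:
  fixes f g :: "'a::euclidean_space \<Rightarrow> real"
  assumes "continuous_on (cball 0 1) f" "continuous_on (cball 0 1) g"
    and "\<And>w. w \<in> cball 0 1 \<Longrightarrow> f w \<le> g w"
  shows "unit_ball_integral f \<le> unit_ball_integral g"
  by (rule set_integral_mono) (use assms set_integrable_cball in auto)

lemma kern_mass_pos: "0 < kern_mass TYPE('a::euclidean_space)"
proof -
  have int: "set_integrable lborel (cball (0::'a) 1) (kern 3)"
    by (intro set_integrable_cball continuous_on_kern)
  have "(LINT w|lborel. (3 / 4) ^ 3 * indicat_real (cball (0::'a) (1 / 2)) w) \<le> kern_mass TYPE('a)"
    unfolding kern_mass_def set_lebesgue_integral_def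
  proof (rule integral_mono)
    show "integrable lborel (\<lambda>w. indicat_real (cball (0::'a) 1) w *\<^sub>R kern 3 w)"
      using int by (simp add: set_integrable_def)
    show "integrable lborel (\<lambda>w. (3 / 4) ^ 3 * indicat_real (cball (0::'a) (1 / 2)) w)"
      by (intro integrable_mult_right integrable_indicator_cball)
    fix w :: 'a
    show "(3 / 4) ^ 3 * indicat_real (cball 0 (1 / 2)) w \<le> indicat_real (cball 0 1) w *\<^sub>R kern 3 w"
    proof (cases "w \<in> cball 0 (1 / 2)")
      case True
      then have "(norm w)\<^sup>2 \<le> (1 / 2)\<^sup>2" by (intro power_mono) auto
      then have "3 / 4 \<le> max 0 (1 - (norm w)\<^sup>2)" by (simp add: power2_eq_square)
      then have "(3 / 4) ^ 3 \<le> kern 3 w" unfolding kern_def by (rule power_mono) simp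
      then show ?thesis using True by simp
    qed (simp add: kern_nonneg)
  qed
  moreover have "0 < (LINT w|lborel. (3 / 4) ^ 3 * indicat_real (cball (0::'a) (1 / 2)) w)"
    using content_cball_pos[of "1/2" "0::'a"] by simp
  ultimately show ?thesis by linarith
qed

text \<open>The weighted mean over solid balls is linear and compatible with translations, so the
  property passes to derivatives. The condition \<open>s < R\<close> keeps the closed ball of
  integration inside \<open>S\<close>.\<close>

definition mv :: "(real ^ 'n::finite) set \<Rightarrow> (real ^ 'n \<Rightarrow> real) \<Rightarrow> bool" where
  "mv S f \<longleftrightarrow> (\<forall>x R s. ball x R \<subseteq> S \<longrightarrow> 0 < s \<longrightarrow> s < R \<longrightarrow>
     f x * kern_mass TYPE(real ^ 'n) = unit_ball_integral (\<lambda>w. f (x + s *\<^sub>R w) * kern 3 w))"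

lemma set_lebesgue_integral_sum:
  fixes f :: "'i \<Rightarrow> 'a \<Rightarrow> real"
  assumes "\<And>i. i \<in> A \<Longrightarrow> set_integrable M S (f i)"
  shows "(LINT w:S|M. \<Sum>i\<in>A. f i w) = (\<Sum>i\<in>A. LINT w:S|M. f i w)"
proof -
  have "(LINT w:S|M. \<Sum>i\<in>A. f i w) = (LINT w|M. (\<Sum>i\<in>A. indicat_real S w *\<^sub>R f i w))"
    unfolding set_lebesgue_integral_def by (simp only: scaleR_sum_right)
  also have "\<dots> = (\<Sum>i\<in>A. LINT w|M. indicat_real S w *\<^sub>R f i w)"
    by (rule Bochner_Integration.integral_sum) (use assms in \<open>auto simp: set_integrable_def\<close>)
  finally show ?thesis by (simp only: set_lebesgue_integral_def)
qed

lemma scaled_ball_mem: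
  assumes "ball x R \<subseteq> S" "norm w \<le> 1" "\<bar>s\<bar> < R"
  shows "x + s *\<^sub>R w \<in> S"
proof -
  have "norm (s *\<^sub>R w) \<le> \<bar>s\<bar> * 1" unfolding norm_scaleR using assms(2) by (intro mult_left_mono) auto
  then have "x + s *\<^sub>R w \<in> ball x R" using assms(3) by (simp add: dist_norm)
  then show ?thesis using assms(1) by blast
qed

lemma scaled_continuous_on:
  fixes g :: "'a::real_normed_vector \<Rightarrow> real"
  assumes "continuous_on S g"
  shows "continuous_on {w. x + s *\<^sub>R w \<in> S} (\<lambda>w. g (x + s *\<^sub>R w))"
  by (rule continuous_on_compose2[OF assms]) (auto intro!: continuous_intros)

lemma scaled_open:
  fixes S :: "'a::real_normed_vector set"
  assumes "open S"
  shows "open {w. x + s *\<^sub>R w \<in> S}"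
proof -
  have "open ((\<lambda>w. x + s *\<^sub>R w) -` S)"
    by (rule open_vimage[OF assms]) (intro continuous_intros)
  then show ?thesis by (simp add: vimage_def)
qed

lemma partial_deriv_line:
  fixes g :: "real ^ 'n::finite \<Rightarrow> real"
  assumes "g differentiable (at (x + t *\<^sub>R axis i 1))"
  shows "((\<lambda>t. g (x + t *\<^sub>R axis i 1)) has_real_derivative partial_deriv i g (x + t *\<^sub>R axis i 1)) (at t)"
  using has_real_derivative_along_line[OF assms] by (simp only: sum_axis_mult)

lemma partial_deriv_scaled_line:
  fixes g :: "real ^ 'n::finite \<Rightarrow> real"
  assumes "g differentiable (at (x + s *\<^sub>R w))"
  shows "((\<lambda>t. g (x + s *\<^sub>R (w + t *\<^sub>R axis i 1))) has_real_derivative s * partial_deriv i g (x + s *\<^sub>R w)) (at 0)"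
proof -
  have eq: "x + s *\<^sub>R (w + t *\<^sub>R axis i 1) = (x + s *\<^sub>R w) + (s * t) *\<^sub>R axis i 1" for t
    by (simp add: algebra_simps)
  have "((\<lambda>t. g ((x + s *\<^sub>R w) + (s * t) *\<^sub>R axis i 1)) has_real_derivative
      partial_deriv i g (x + s *\<^sub>R w + 0 *\<^sub>R axis i 1) * s) (at 0)"
  proof (rule DERIV_chain2[where g = "\<lambda>t. s * t"])
    show "((\<lambda>t. g (x + s *\<^sub>R w + t *\<^sub>R axis i 1)) has_real_derivative
        partial_deriv i g (x + s *\<^sub>R w + 0 *\<^sub>R axis i 1)) (at (s * 0))"
      using partial_deriv_line[of g "x + s *\<^sub>R w" 0 i] assms by simp
    show "((\<lambda>t. s * t) has_real_derivative s) (at 0)" by (auto intro!: derivative_eq_intros)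
  qed
  then show ?thesis unfolding eq by (simp add: mult.commute)
qed

text \<open>The kernel \<open>w\<^sub>i\<close> \<open>kern 3 w\<close> is the \<open>i\<close>-th partial derivative of \<open>- kern 4 / 8\<close>, so that the derivative
  in \<open>s\<close> of the weighted mean is a weighted mean of the Laplacian.\<close>

lemma mv_harmonic:
  fixes g :: "real ^ 'n::finite \<Rightarrow> real"
  assumes S: "open S" and g: "C2_on S g" and lap: "\<And>x. x \<in> S \<Longrightarrow> laplacian g x = 0"
  shows "mv S g"
  unfolding mv_def
proof (intro allI impI)
  fix x R and s :: real assume b: "ball x R \<subseteq> S" and s: "0 < s" "s < R"
  have g0: "continuous_on S g"
    using g by (intro continuous_at_imp_continuous_on ballI differentiable_imp_continuous_within) (auto simp: C2_on_def)
  have g1: "continuous_on S (partial_deriv i g)" for i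
    using g by (intro continuous_at_imp_continuous_on ballI differentiable_imp_continuous_within) (auto simp: C2_on_def)
  have g2: "continuous_on S (partial_deriv i (partial_deriv j g))" for i j
    using g by (auto simp: C2_on_def)
  define R' where "R' = (s + R) / 2"
  have R': "s < R'" "R' < R" "0 < R'" using s by (auto simp: R'_def)
  define J where "J \<sigma> = unit_ball_integral (\<lambda>w. g (x + \<sigma> *\<^sub>R w) * kern 3 w)" for \<sigma>
  have J': "(J has_real_derivative 0) (at \<sigma>)" if \<sigma>: "\<bar>\<sigma>\<bar> < R'" for \<sigma>
  proof -
    define a where "a = (R - \<bar>\<sigma>\<bar>) / 2"
    have a: "0 < a" using \<sigma> R' by (simp add: a_def)
    have small: "\<bar>\<tau>\<bar> < R" if "\<bar>\<tau> - \<sigma>\<bar> \<le> a" for \<tau>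
    proof -
      have "\<bar>\<tau>\<bar> \<le> \<bar>\<sigma>\<bar> + \<bar>\<tau> - \<sigma>\<bar>" by linarith
      also have "\<dots> \<le> \<bar>\<sigma>\<bar> + a" using that by simp
      also have "\<dots> < R" using \<sigma> R' by (simp add: a_def field_simps)
      finally show ?thesis .
    qed
    have mem: "x + \<tau> *\<^sub>R w \<in> S" if "\<bar>\<tau> - \<sigma>\<bar> \<le> a" "w \<in> cball 0 1" for \<tau> w
      using scaled_ball_mem[OF b _ small[OF that(1)]] that(2) by simp
    have "(J has_real_derivative unit_ball_integral (\<lambda>w. (\<Sum>i\<in>UNIV. w $ i * partial_deriv i g (x + \<sigma> *\<^sub>R w)) * kern 3 w)) (at \<sigma>)"
      unfolding J_def
    proof (rule has_real_derivative_set_integral[OF a])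
      show "continuous_on ({\<sigma> - a..\<sigma> + a} \<times> cball 0 1)
          (\<lambda>(\<tau>, w). (\<Sum>i\<in>UNIV. w $ i * partial_deriv i g (x + \<tau> *\<^sub>R w)) * kern 3 w)"
        unfolding case_prod_beta
        by (intro continuous_intros continuous_on_compose2[OF g1] continuous_on_compose2[OF continuous_on_kern])
          (auto intro!: mem simp: abs_le_iff)
      show "continuous_on (cball 0 1) (\<lambda>w. g (x + \<tau> *\<^sub>R w) * kern 3 w)" if "\<bar>\<tau> - \<sigma>\<bar> \<le> a" for \<tau>
        by (intro continuous_intros continuous_on_compose2[OF g0] continuous_on_kern) (use that in \<open>auto intro!: mem\<close>)
      fix \<tau> w assume "\<bar>\<tau> - \<sigma>\<bar> \<le> a" "w \<in> cball (0::real ^ 'n) 1"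
      then have "g differentiable (at (x + \<tau> *\<^sub>R w))" using C2_onD[OF g] mem by blast
      from has_real_derivative_along_line[OF this]
      show "((\<lambda>\<tau>. g (x + \<tau> *\<^sub>R w) * kern 3 w) has_real_derivative
          (\<Sum>i\<in>UNIV. w $ i * partial_deriv i g (x + \<tau> *\<^sub>R w)) * kern 3 w) (at \<tau>)"
        by (rule DERIV_cmult_right)
    qed
    moreover have "unit_ball_integral (\<lambda>w. (\<Sum>i\<in>UNIV. w $ i * partial_deriv i g (x + \<sigma> *\<^sub>R w)) * kern 3 w) = 0"
    proof -
      let ?U = "{w. x + \<sigma> *\<^sub>R w \<in> S}"
      have U: "open ?U" "cball 0 1 \<subseteq> ?U" using scaled_open[OF S] mem[of \<sigma>] a by auto
      have c1: "continuous_on ?U (\<lambda>w. partial_deriv i g (x + \<sigma> *\<^sub>R w))" for i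
        by (rule scaled_continuous_on[OF g1])
      have c2: "continuous_on ?U (\<lambda>w. \<sigma> * partial_deriv i (partial_deriv i g) (x + \<sigma> *\<^sub>R w))" for i
        by (intro continuous_intros scaled_continuous_on[OF g2])
      have ibp: "unit_ball_integral (\<lambda>w. partial_deriv i g (x + \<sigma> *\<^sub>R w) * (w $ i * kern 3 w)) =
          unit_ball_integral (\<lambda>w. \<sigma> * partial_deriv i (partial_deriv i g) (x + \<sigma> *\<^sub>R w) * (kern 4 w / 8))" for i
      proof -
        have "unit_ball_integral (\<lambda>w. (\<sigma> * partial_deriv i (partial_deriv i g) (x + \<sigma> *\<^sub>R w)) * (kern 4 w / 8)) =
            - unit_ball_integral (\<lambda>w. partial_deriv i g (x + \<sigma> *\<^sub>R w) * (- (w $ i * kern 3 w)))"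
        proof (rule integration_by_parts_cball[OF U c1 c2])
          show "((\<lambda>t. partial_deriv i g (x + \<sigma> *\<^sub>R (w + t *\<^sub>R axis i 1))) has_real_derivative
              \<sigma> * partial_deriv i (partial_deriv i g) (x + \<sigma> *\<^sub>R w)) (at 0)" if "w \<in> ?U" for w
            using that C2_onD[OF g] by (intro partial_deriv_scaled_line) auto
          show "continuous_on UNIV (\<lambda>w::real ^ 'n. kern 4 w / 8)"
            by (intro continuous_intros continuous_on_kern) auto
          show "continuous_on UNIV (\<lambda>w::real ^ 'n. - (w $ i * kern 3 w))"
            by (intro continuous_intros continuous_on_kern)
          show "((\<lambda>t. kern 4 (w + t *\<^sub>R axis i 1) / 8) has_real_derivative - (w $ i * kern 3 w)) (at 0)" for w :: "real ^ 'n"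
            using DERIV_cdivide[OF kern_line_derivative[of 3 w "axis i 1"], of 8]
            by (simp add: inner_axis eval_nat_numeral)
          show "kern 4 w / 8 = 0" "- (w $ i * kern 3 w) = 0" if "1 \<le> norm w" for w :: "real ^ 'n"
            using kern_zero[OF that] by auto
        qed
        then show ?thesis by (simp add: set_lebesgue_integral_def)
      qed
      have int1: "set_integrable lborel (cball 0 1) (\<lambda>w. partial_deriv i g (x + \<sigma> *\<^sub>R w) * (w $ i * kern 3 w))" for i
        by (intro set_integrable_cball continuous_intros continuous_on_subset[OF c1 U(2)] continuous_on_kern)
      have int2: "set_integrable lborel (cball 0 1) (\<lambda>w. \<sigma> * partial_deriv i (partial_deriv i g) (x + \<sigma> *\<^sub>R w) * (kern 4 w / 8))" for i
        by (intro set_integrable_cball continuous_intros continuous_on_subset[OF c2 U(2)] continuous_on_kern) auto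
      have "unit_ball_integral (\<lambda>w. (\<Sum>i\<in>UNIV. w $ i * partial_deriv i g (x + \<sigma> *\<^sub>R w)) * kern 3 w) =
          unit_ball_integral (\<lambda>w. \<Sum>i\<in>UNIV. partial_deriv i g (x + \<sigma> *\<^sub>R w) * (w $ i * kern 3 w))"
        unfolding sum_distrib_right by (simp only: mult_ac)
      also have "\<dots> = (\<Sum>i\<in>UNIV. unit_ball_integral (\<lambda>w. partial_deriv i g (x + \<sigma> *\<^sub>R w) * (w $ i * kern 3 w)))"
        by (rule set_lebesgue_integral_sum) (use int1 in auto)
      also have "\<dots> = (\<Sum>i\<in>UNIV. unit_ball_integral (\<lambda>w. \<sigma> * partial_deriv i (partial_deriv i g) (x + \<sigma> *\<^sub>R w) * (kern 4 w / 8)))"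
        by (simp only: ibp)
      also have "\<dots> = unit_ball_integral (\<lambda>w. \<Sum>i\<in>UNIV. \<sigma> * partial_deriv i (partial_deriv i g) (x + \<sigma> *\<^sub>R w) * (kern 4 w / 8))"
        by (rule set_lebesgue_integral_sum[symmetric]) (use int2 in auto)
      also have "\<dots> = unit_ball_integral (\<lambda>w::real ^ 'n. 0)"
        unfolding set_lebesgue_integral_def
      proof (rule Bochner_Integration.integral_cong[OF refl])
        fix w :: "real ^ 'n"
        have "(\<Sum>i\<in>UNIV. \<sigma> * partial_deriv i (partial_deriv i g) (x + \<sigma> *\<^sub>R w) * (kern 4 w / 8)) = 0" if "w \<in> cball 0 1"
        proof -
          have "laplacian g (x + \<sigma> *\<^sub>R w) = 0" using that U(2) lap by blast
          then show ?thesis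
            unfolding sum_distrib_right[symmetric] sum_distrib_left[symmetric] laplacian_def by simp
        qed
        then show "indicat_real (cball 0 1) w *\<^sub>R (\<Sum>i\<in>UNIV. \<sigma> * partial_deriv i (partial_deriv i g) (x + \<sigma> *\<^sub>R w) * (kern 4 w / 8)) =
            indicat_real (cball 0 1) w *\<^sub>R 0"
          by (cases "w \<in> cball 0 1") simp_all
      qed
      finally show ?thesis by (simp add: set_lebesgue_integral_def)
    qed
    ultimately show ?thesis by simp
  qed
  have "\<exists>c. \<forall>\<tau>\<in>{-R'<..<R'}. J \<tau> = c"
  proof (rule has_field_derivative_zero_constant)
    show "(J has_real_derivative 0) (at \<tau> within {-R'<..<R'})" if "\<tau> \<in> {-R'<..<R'}" for \<tau>
      by (rule has_field_derivative_at_within, rule J') (use that in \<open>simp add: abs_less_iff\<close>)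
  qed simp
  then obtain c where c: "\<And>\<tau>. \<tau> \<in> {-R'<..<R'} \<Longrightarrow> J \<tau> = c" by blast
  have "J s = J 0" using c[of s] c[of 0] R' s by simp
  moreover have "J 0 = g x * kern_mass TYPE(real ^ 'n)"
    by (simp add: J_def kern_mass_def)
  ultimately have "J s = g x * kern_mass TYPE(real ^ 'n)" by (rule trans)
  then show "g x * kern_mass TYPE(real ^ 'n) = unit_ball_integral (\<lambda>w. g (x + s *\<^sub>R w) * kern 3 w)"
    unfolding J_def by (rule sym)
qed

text \<open>The mean value identity is differentiated with respect to the centre. In this way the
  property reaches the second derivatives of a harmonic function without third derivatives, about
  which \<open>C2_on\<close> says nothing.\<close>

lemma mv_partial_deriv:
  fixes f :: "real ^ 'n::finite \<Rightarrow> real"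
  assumes S: "open S" and f: "\<And>x. x \<in> S \<Longrightarrow> f differentiable (at x)"
    and f1: "continuous_on S (partial_deriv i f)" and mv: "mv S f"
  shows "mv S (partial_deriv i f)"
  unfolding mv_def
proof (intro allI impI)
  fix x R and s :: real assume b: "ball x R \<subseteq> S" and s: "0 < s" "s < R"
  have f0: "continuous_on S f"
    using f by (intro continuous_at_imp_continuous_on ballI differentiable_imp_continuous_within) auto
  define a where "a = (R - s) / 2"
  have a: "0 < a" using s by (simp add: a_def)
  have sub: "ball (x + \<tau> *\<^sub>R axis i 1) (R - a) \<subseteq> S" if "\<bar>\<tau>\<bar> \<le> a" for \<tau>
  proof -
    have "ball (x + \<tau> *\<^sub>R axis i 1) (R - a) \<subseteq> ball x R"
      using that by (simp add: ball_subset_ball_iff dist_norm)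
    then show ?thesis using b by blast
  qed
  have sa: "s < R - a" using s by (simp add: a_def field_simps)
  have mem: "(x + \<tau> *\<^sub>R axis i 1) + s *\<^sub>R w \<in> S" if "\<bar>\<tau>\<bar> \<le> a" "w \<in> cball 0 1" for \<tau> w
    using scaled_ball_mem[OF sub[OF that(1)], of w s] sa s that(2) by simp
  have "((\<lambda>\<tau>. unit_ball_integral (\<lambda>w. f (x + \<tau> *\<^sub>R axis i 1 + s *\<^sub>R w) * kern 3 w)) has_real_derivative
      unit_ball_integral (\<lambda>w. partial_deriv i f (x + 0 *\<^sub>R axis i 1 + s *\<^sub>R w) * kern 3 w)) (at 0)"
  proof (rule has_real_derivative_set_integral[OF a])
    show "continuous_on ({0 - a..0 + a} \<times> cball 0 1) (\<lambda>(\<tau>, w). partial_deriv i f (x + \<tau> *\<^sub>R axis i 1 + s *\<^sub>R w) * kern 3 w)"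
      unfolding case_prod_beta
      by (intro continuous_intros continuous_on_compose2[OF f1] continuous_on_compose2[OF continuous_on_kern])
        (auto intro!: mem simp: abs_le_iff)
    show "continuous_on (cball 0 1) (\<lambda>w. f (x + \<tau> *\<^sub>R axis i 1 + s *\<^sub>R w) * kern 3 w)" if "\<bar>\<tau> - 0\<bar> \<le> a" for \<tau>
      by (intro continuous_intros continuous_on_compose2[OF f0] continuous_on_kern) (use that in \<open>auto intro!: mem\<close>)
    fix \<tau> w assume "\<bar>\<tau> - 0\<bar> \<le> a" "w \<in> cball (0::real ^ 'n) 1"
    then have "f differentiable (at ((x + s *\<^sub>R w) + \<tau> *\<^sub>R axis i 1))"
      using f[OF mem[of \<tau> w]] by (simp add: ac_simps)
    from DERIV_cmult_right[OF partial_deriv_line[OF this]]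
    show "((\<lambda>\<tau>. f (x + \<tau> *\<^sub>R axis i 1 + s *\<^sub>R w) * kern 3 w) has_real_derivative
        partial_deriv i f (x + \<tau> *\<^sub>R axis i 1 + s *\<^sub>R w) * kern 3 w) (at \<tau>)"
      by (simp add: ac_simps)
  qed
  moreover have ev: "\<forall>\<^sub>F \<tau> in nhds 0. unit_ball_integral (\<lambda>w. f (x + \<tau> *\<^sub>R axis i 1 + s *\<^sub>R w) * kern 3 w) =
      f (x + \<tau> *\<^sub>R axis i 1) * kern_mass TYPE(real ^ 'n)"
    unfolding eventually_nhds_metric
  proof (intro exI[of _ a] conjI a allI impI)
    fix \<tau> :: real assume "dist \<tau> 0 < a"
    then show "unit_ball_integral (\<lambda>w. f (x + \<tau> *\<^sub>R axis i 1 + s *\<^sub>R w) * kern 3 w) = f (x + \<tau> *\<^sub>R axis i 1) * kern_mass TYPE(real ^ 'n)"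
      using mv[unfolded mv_def, rule_format, OF sub s(1) sa] by (simp add: dist_norm)
  qed
  ultimately have "((\<lambda>\<tau>. f (x + \<tau> *\<^sub>R axis i 1) * kern_mass TYPE(real ^ 'n)) has_real_derivative
      unit_ball_integral (\<lambda>w. partial_deriv i f (x + 0 *\<^sub>R axis i 1 + s *\<^sub>R w) * kern 3 w)) (at 0)"
    using DERIV_cong_ev[OF refl ev refl] by blast
  moreover have "x \<in> S" using b s by auto
  then have "((\<lambda>\<tau>. f (x + \<tau> *\<^sub>R axis i 1) * kern_mass TYPE(real ^ 'n)) has_real_derivative
      partial_deriv i f (x + 0 *\<^sub>R axis i 1) * kern_mass TYPE(real ^ 'n)) (at 0)"
    using f by (intro DERIV_cmult_right partial_deriv_line) auto
  ultimately show "partial_deriv i f x * kern_mass TYPE(real ^ 'n) = unit_ball_integral (\<lambda>w. partial_deriv i f (x + s *\<^sub>R w) * kern 3 w)"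
    using DERIV_unique by fastforce
qed

section \<open>Derivatives of the comparison function\<close>

lemma partial_deriv_eq:
  assumes "(f has_derivative f') (at x)"
  shows "partial_deriv i f x = f' (axis i 1)"
  unfolding partial_deriv_def using frechet_derivative_at[OF assms] by simp

lemma comparison_fun_has_derivative:
  fixes u :: "real ^ 'n::finite \<Rightarrow> real"
  assumes "u differentiable (at x)"
  shows "(comparison_fun u z a has_derivative (\<lambda>v. (x - z) \<bullet> v - frechet_derivative u (at x) v)) (at x)"
proof -
  have "(u has_derivative frechet_derivative u (at x)) (at x)"
    using assms by (simp add: frechet_derivative_works)
  then have "((\<lambda>x. 1 / 2 * ((x - z) \<bullet> (x - z) - a) - u x) has_derivative
      (\<lambda>v. (x - z) \<bullet> v - frechet_derivative u (at x) v)) (at x)"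
    by (auto intro!: derivative_eq_intros simp: inner_commute)
  then show ?thesis by (simp add: comparison_fun_def[abs_def] power2_norm_eq_inner)
qed

lemma comparison_fun_partial_deriv:
  fixes u :: "real ^ 'n::finite \<Rightarrow> real"
  assumes "u differentiable (at x)"
  shows "partial_deriv i (comparison_fun u z a) x = (x - z) $ i - partial_deriv i u x"
  using partial_deriv_eq[OF comparison_fun_has_derivative[OF assms]]
  by (simp add: partial_deriv_def inner_axis)

lemma comparison_fun_second_derivative:
  fixes u :: "real ^ 'n::finite \<Rightarrow> real"
  assumes S: "open S" "C2_on S u" and x: "x \<in> S"
  shows "partial_deriv i (comparison_fun u z a) differentiable (at x)"
    and "partial_deriv j (partial_deriv i (comparison_fun u z a)) x =
      (if i = j then 1 else 0) - partial_deriv j (partial_deriv i u) x"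
proof -
  let ?D = "frechet_derivative (partial_deriv i u) (at x)"
  have "(partial_deriv i u has_derivative ?D) (at x)"
    using C2_onD(2)[OF S(2) x] by (simp add: frechet_derivative_works)
  moreover have "((\<lambda>y. y $ i) has_derivative (\<lambda>v. v $ i)) (at x)"
    by (rule bounded_linear_imp_has_derivative) (rule bounded_linear_vec_nth)
  ultimately have "((\<lambda>y. (y $ i - z $ i) - partial_deriv i u y) has_derivative (\<lambda>v. (v $ i - 0) - ?D v)) (at x)"
    by (intro has_derivative_diff has_derivative_const)
  then have "((\<lambda>y. (y - z) $ i - partial_deriv i u y) has_derivative (\<lambda>v. v $ i - ?D v)) (at x)"
    by simp
  then have *: "(partial_deriv i (comparison_fun u z a) has_derivative (\<lambda>v. v $ i - ?D v)) (at x)"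
    by (rule has_derivative_transform_within_open[OF _ S(1) x])
      (simp add: comparison_fun_partial_deriv C2_onD(1)[OF S(2)])
  then show "partial_deriv i (comparison_fun u z a) differentiable (at x)"
    by (rule differentiableI)
  show "partial_deriv j (partial_deriv i (comparison_fun u z a)) x =
      (if i = j then 1 else 0) - partial_deriv j (partial_deriv i u) x"
    using partial_deriv_eq[OF *, of j] by (simp add: partial_deriv_def axis_def)
qed

lemma comparison_fun_C2:
  fixes u :: "real ^ 'n::finite \<Rightarrow> real"
  assumes S: "open S" "C2_on S u"
  shows "C2_on S (comparison_fun u z a)"
  unfolding C2_on_def
proof (intro conjI ballI allI)
  show "comparison_fun u z a differentiable (at x)" if "x \<in> S" for x
    using comparison_fun_has_derivative[OF C2_onD(1)[OF S(2) that]] by (rule differentiableI)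
  show "partial_deriv i (comparison_fun u z a) differentiable (at x)" if "x \<in> S" for x i
    by (rule comparison_fun_second_derivative(1)[OF S that])
  fix i j
  have "continuous_on S (\<lambda>x. (if j = i then 1 else 0) - partial_deriv i (partial_deriv j u) x)"
    using S(2) by (intro continuous_intros) (simp add: C2_on_def)
  then show "continuous_on S (partial_deriv i (partial_deriv j (comparison_fun u z a)))"
    by (rule continuous_on_eq) (simp add: comparison_fun_second_derivative(2)[OF S])
qed

lemma comparison_fun_laplacian:
  fixes u :: "real ^ 'n::finite \<Rightarrow> real"
  assumes S: "open S" "C2_on S u" and x: "x \<in> S"
  shows "laplacian (comparison_fun u z a) x = CARD('n) - laplacian u x"
  by (simp add: laplacian_def comparison_fun_second_derivative(2)[OF assms] sum_subtractf)

section \<open>Interior estimates and symmetry of the Hessian\<close>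

lemma mv_sum:
  fixes f :: "'i \<Rightarrow> real ^ 'n::finite \<Rightarrow> real"
  assumes "\<And>i. i \<in> A \<Longrightarrow> mv S (f i)" "\<And>i. i \<in> A \<Longrightarrow> continuous_on S (f i)"
  shows "mv S (\<lambda>x. \<Sum>i\<in>A. c i * f i x)"
  unfolding mv_def
proof (intro allI impI)
  fix x R and s :: real assume b: "ball x R \<subseteq> S" and s: "0 < s" "s < R"
  have int: "set_integrable lborel (cball 0 1) (\<lambda>w. c i * (f i (x + s *\<^sub>R w) * kern 3 w))" if "i \<in> A" for i
    by (intro set_integrable_cball continuous_intros continuous_on_kern continuous_on_compose2[OF assms(2)[OF that]])
      (use scaled_ball_mem[OF b] s in auto)
  have "unit_ball_integral (\<lambda>w. (\<Sum>i\<in>A. c i * f i (x + s *\<^sub>R w)) * kern 3 w) = unit_ball_integral (\<lambda>w. \<Sum>i\<in>A. c i * (f i (x + s *\<^sub>R w) * kern 3 w))"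
    by (simp add: sum_distrib_right mult.assoc)
  also have "\<dots> = (\<Sum>i\<in>A. c i * unit_ball_integral (\<lambda>w. f i (x + s *\<^sub>R w) * kern 3 w))"
    by (subst set_lebesgue_integral_sum[OF int]) auto
  also have "\<dots> = (\<Sum>i\<in>A. c i * (f i x * kern_mass TYPE(real ^ 'n)))"
    using assms(1) b s by (intro sum.cong refl) (simp add: mv_def)
  finally show "(\<Sum>i\<in>A. c i * f i x) * kern_mass TYPE(real ^ 'n) = unit_ball_integral (\<lambda>w. (\<Sum>i\<in>A. c i * f i (x + s *\<^sub>R w)) * kern 3 w)"
    by (simp add: sum_distrib_right mult.assoc)
qed

lemma mv_integration_by_parts:
  fixes f :: "real ^ 'n::finite \<Rightarrow> real"
  assumes S: "open S" and f: "\<And>x. x \<in> S \<Longrightarrow> f differentiable (at x)"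
    and f1: "continuous_on S (partial_deriv j f)" and b: "ball x R \<subseteq> S" and s: "0 < s" "s < R"
    and K: "continuous_on UNIV K" "continuous_on UNIV K'"
      "\<And>w. ((\<lambda>t. K (w + t *\<^sub>R axis j 1)) has_real_derivative K' w) (at 0)"
      "\<And>w. 1 \<le> norm w \<Longrightarrow> K w = 0" "\<And>w. 1 \<le> norm w \<Longrightarrow> K' w = 0"
  shows "s * unit_ball_integral (\<lambda>w. partial_deriv j f (x + s *\<^sub>R w) * K w) = - unit_ball_integral (\<lambda>w. f (x + s *\<^sub>R w) * K' w)"
proof -
  have f0: "continuous_on S f"
    using f by (intro continuous_at_imp_continuous_on ballI differentiable_imp_continuous_within) auto
  let ?U = "{w. x + s *\<^sub>R w \<in> S}"
  have U: "open ?U" "cball 0 1 \<subseteq> ?U" using scaled_open[OF S] scaled_ball_mem[OF b] s by auto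
  have "unit_ball_integral (\<lambda>w. (s * partial_deriv j f (x + s *\<^sub>R w)) * K w) = - unit_ball_integral (\<lambda>w. f (x + s *\<^sub>R w) * K' w)"
    by (rule integration_by_parts_cball[OF U scaled_continuous_on[OF f0] _ _ K])
      (auto intro!: continuous_intros scaled_continuous_on[OF f1] partial_deriv_scaled_line f)
  then show ?thesis by (simp add: mult.assoc)
qed

text \<open>The derivative is moved from \<open>f\<close> onto the weight, where it becomes
  \<open>- 6 * w $ j * kern 2 w\<close> and is bounded by 6; the chain rule contributes the factor
  \<open>1 / s\<close>.\<close>

lemma mv_gradient_bound:
  fixes f :: "real ^ 'n::finite \<Rightarrow> real"
  assumes S: "open S" and f: "\<And>x. x \<in> S \<Longrightarrow> f differentiable (at x)"
    and f1: "continuous_on S (partial_deriv j f)" and mv: "mv S f"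
    and b: "ball x R \<subseteq> S" and s: "0 < s" "s < R" and M: "\<And>y. y \<in> ball x R \<Longrightarrow> \<bar>f y\<bar> \<le> M"
  shows "\<bar>partial_deriv j f x\<bar> \<le>
    6 * measure lborel (cball (0 :: real ^ 'n) 1) / kern_mass TYPE(real ^ 'n) * (M / s)"
proof -
  let ?m = "kern_mass TYPE(real ^ 'n)" and ?V = "measure lborel (cball (0 :: real ^ 'n) 1)"
  have f0: "continuous_on S f"
    using f by (intro continuous_at_imp_continuous_on ballI differentiable_imp_continuous_within) auto
  have "s * unit_ball_integral (\<lambda>w. partial_deriv j f (x + s *\<^sub>R w) * kern 3 w) =
      - unit_ball_integral (\<lambda>w. f (x + s *\<^sub>R w) * (- 6 * w $ j * kern 2 w))"
  proof (rule mv_integration_by_parts[OF S f f1 b s])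
    show "((\<lambda>t. kern 3 (w + t *\<^sub>R axis j 1)) has_real_derivative - 6 * w $ j * kern 2 w) (at 0)" for w :: "real ^ 'n"
      using kern_line_derivative[of 2 w "axis j 1"] by (simp add: inner_axis eval_nat_numeral)
  qed (auto intro!: continuous_intros continuous_on_kern simp: kern_zero)
  then have eq: "s * (partial_deriv j f x * ?m) = - unit_ball_integral (\<lambda>w. f (x + s *\<^sub>R w) * (- 6 * w $ j * kern 2 w))"
    using mv_partial_deriv[OF S f f1 mv] b s unfolding mv_def by simp
  have mem: "x + s *\<^sub>R w \<in> ball x R" if "w \<in> cball 0 1" for w
    using scaled_ball_mem[of x R "ball x R" w s] that s by simp
  have M0: "0 \<le> M" using M[of x] s by fastforce
  have c: "continuous_on (cball 0 1) (\<lambda>w. f (x + s *\<^sub>R w) * (- 6 * w $ j * kern 2 w))"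
    by (intro continuous_intros continuous_on_kern continuous_on_compose2[OF f0]) (use mem b in auto)
  have "\<bar>f (x + s *\<^sub>R w) * (- 6 * w $ j * kern 2 w)\<bar> \<le> 6 * M" if w: "w \<in> cball 0 1" for w
  proof -
    have "\<bar>w $ j\<bar> \<le> 1" using component_le_norm_cart[of w j] w by simp
    then have "\<bar>f (x + s *\<^sub>R w)\<bar> * (6 * (\<bar>w $ j\<bar> * \<bar>kern 2 w\<bar>)) \<le> M * (6 * (1 * 1))"
      using M[OF mem[OF w]] M0 kern_nonneg[of 2 w] kern_le_one[of 2 w]
      by (intro mult_mono) auto
    then show ?thesis by (simp add: abs_mult mult_ac)
  qed
  note bnd = this
  have const: "unit_ball_integral (\<lambda>w::real ^ 'n. k) = k * ?V" for k :: real
    by (simp add: set_lebesgue_integral_def mult.commute)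
  have "unit_ball_integral (\<lambda>w. f (x + s *\<^sub>R w) * (- 6 * w $ j * kern 2 w)) \<le> 6 * M * ?V"
    unfolding const[symmetric]
    by (rule set_integral_mono_cball[OF c continuous_on_const]) (rule abs_le_D1[OF bnd])
  moreover have "- (6 * M) * ?V \<le> unit_ball_integral (\<lambda>w. f (x + s *\<^sub>R w) * (- 6 * w $ j * kern 2 w))"
    unfolding const[symmetric]
    by (rule set_integral_mono_cball[OF continuous_on_const c]) (use abs_le_D2[OF bnd] in \<open>simp add: minus_le_iff\<close>)
  ultimately have "\<bar>s * (partial_deriv j f x * ?m)\<bar> \<le> 6 * M * ?V"
    unfolding eq by linarith
  then have "s * ?m * \<bar>partial_deriv j f x\<bar> \<le> 6 * M * ?V"
    using s kern_mass_pos[where 'a = "real ^ 'n"] by (simp add: abs_mult mult_ac)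
  then show ?thesis
    using s kern_mass_pos[where 'a = "real ^ 'n"] by (simp add: field_simps)
qed

text \<open>Jensen's inequality for the weighted mean, obtained by expanding the integral of
  \<open>(g w - f x)\<^sup>2 * kern 3 w\<close>, combined with dropping the weight and rescaling the
  unit ball. The factor \<open>s ^ CARD('n)\<close> of the rescaling is the origin of the decay
  exponent \<open>N / 2\<close>.\<close>

lemma mv_square_bound:
  fixes f :: "real ^ 'n::finite \<Rightarrow> real"
  assumes f: "continuous_on S f" "mv S f" and b: "ball x R \<subseteq> S" and s: "0 < s" "s < R"
    and B: "0 \<le> B" "(\<integral>\<^sup>+y\<in>S. ennreal ((f y)\<^sup>2) \<partial>lborel) \<le> ennreal B"
  shows "(f x)\<^sup>2 * kern_mass TYPE(real ^ 'n) * s ^ CARD('n) \<le> B"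
proof -
  let ?m = "kern_mass TYPE(real ^ 'n)"
  define g where "g w = f (x + s *\<^sub>R w)" for w
  have mem: "x + s *\<^sub>R w \<in> S" if "w \<in> cball 0 1" for w
    using scaled_ball_mem[OF b, of w s] that s by simp
  have g: "continuous_on (cball 0 1) g"
    unfolding g_def by (intro continuous_intros continuous_on_compose2[OF f(1)]) (use mem in auto)
  have cs: "cball x s \<subseteq> S" using b s by (metis cball_subset_ball_iff dist_self add_0 subset_trans)
  have i1: "set_integrable lborel (cball 0 1) (\<lambda>w. (g w)\<^sup>2 * kern 3 w)"
    by (intro set_integrable_cball continuous_intros g continuous_on_kern)
  have i2: "set_integrable lborel (cball 0 1) (\<lambda>w. 2 * f x * (g w * kern 3 w))"
    by (intro set_integrable_cball continuous_intros g continuous_on_kern)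
  have i3: "set_integrable lborel (cball 0 1) (\<lambda>w::real ^ 'n. (f x)\<^sup>2 * kern 3 w)"
    by (intro set_integrable_cball continuous_intros continuous_on_kern)
  have i4: "set_integrable lborel (cball 0 1) (\<lambda>w. (g w)\<^sup>2)"
    by (intro set_integrable_cball continuous_intros g)
  have "0 \<le> unit_ball_integral (\<lambda>w. (g w - f x)\<^sup>2 * kern 3 w)"
    unfolding set_lebesgue_integral_def by (intro integral_nonneg_AE) (auto simp: kern_nonneg)
  also have "\<dots> = unit_ball_integral (\<lambda>w. ((g w)\<^sup>2 * kern 3 w - 2 * f x * (g w * kern 3 w)) + (f x)\<^sup>2 * kern 3 w)"
    by (simp add: power2_eq_square algebra_simps)
  also have "\<dots> = unit_ball_integral (\<lambda>w. (g w)\<^sup>2 * kern 3 w) - 2 * f x * unit_ball_integral (\<lambda>w. g w * kern 3 w) + (f x)\<^sup>2 * ?m"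
    using i1 i2 i3 by (simp add: set_integral_add set_integral_diff kern_mass_def)
  also have "unit_ball_integral (\<lambda>w. g w * kern 3 w) = f x * ?m"
    using f(2) b s unfolding mv_def g_def by simp
  finally have "(f x)\<^sup>2 * ?m \<le> unit_ball_integral (\<lambda>w. (g w)\<^sup>2 * kern 3 w)"
    by (simp add: power2_eq_square algebra_simps)
  also have "\<dots> \<le> unit_ball_integral (\<lambda>w. (g w)\<^sup>2)"
    by (rule set_integral_mono[OF i1 i4]) (simp add: mult_left_le kern_le_one)
  finally have 1: "(f x)\<^sup>2 * ?m \<le> unit_ball_integral (\<lambda>w. (g w)\<^sup>2)" .
  \<comment> \<open>The change of variables is carried out for extended nonnegative integrals, the
    form in which the bound over \<open>S\<close> is given.\<close>
  define G where "G y = ennreal (indicat_real (cball x s) y *\<^sub>R (f y)\<^sup>2)" for y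
  have Gm: "G \<in> borel_measurable borel"
    unfolding G_def[abs_def]
    by (intro measurable_compose[OF _ measurable_ennreal] borel_measurable_continuous_on_indicator
        continuous_intros continuous_on_subset[OF f(1) cs]) auto
  have "ennreal (s ^ CARD('n) * unit_ball_integral (\<lambda>w. (g w)\<^sup>2)) = ennreal (s ^ CARD('n)) * (\<integral>\<^sup>+w. G (x + s *\<^sub>R w) \<partial>lborel)"
  proof -
    have "G (x + s *\<^sub>R w) = ennreal (indicat_real (cball 0 1) w *\<^sub>R (g w)\<^sup>2)" for w
    proof -
      have "x + s *\<^sub>R w \<in> cball x s \<longleftrightarrow> w \<in> cball 0 1" using s by (simp add: dist_norm)
      then show ?thesis by (simp add: G_def g_def indicator_def)
    qed
    then have "(\<integral>\<^sup>+w. G (x + s *\<^sub>R w) \<partial>lborel) = ennreal (unit_ball_integral (\<lambda>w. (g w)\<^sup>2))"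
      unfolding set_lebesgue_integral_def
      using i4 by (simp only: set_integrable_def) (intro nn_integral_eq_integral, auto)
    then show ?thesis using s by (simp add: ennreal_mult')
  qed
  also have "\<dots> = (\<integral>\<^sup>+y. G y \<partial>lborel)"
  proof -
    have "(\<integral>\<^sup>+y. G y \<partial>lborel) = (\<integral>\<^sup>+y. G y \<partial>density (distr lborel borel (\<lambda>y. x + s *\<^sub>R y)) (\<lambda>_. ennreal (\<bar>s\<bar> ^ DIM(real ^ 'n))))"
      using lborel_affine[of s x] s by simp
    also have "\<dots> = (\<integral>\<^sup>+y. ennreal (\<bar>s\<bar> ^ DIM(real ^ 'n)) * G (x + s *\<^sub>R y) \<partial>lborel)"
      using Gm by (subst nn_integral_density) (auto simp: nn_integral_distr)
    also have "\<dots> = ennreal (s ^ CARD('n)) * (\<integral>\<^sup>+w. G (x + s *\<^sub>R w) \<partial>lborel)"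
      using Gm s by (subst nn_integral_cmult) auto
    finally show ?thesis by simp
  qed
  also have "\<dots> \<le> (\<integral>\<^sup>+y\<in>S. ennreal ((f y)\<^sup>2) \<partial>lborel)"
    by (intro nn_integral_mono) (use cs in \<open>auto simp: G_def indicator_def\<close>)
  also note B(2)
  finally have "s ^ CARD('n) * unit_ball_integral (\<lambda>w. (g w)\<^sup>2) \<le> B" using B(1) by simp
  moreover have "(f x)\<^sup>2 * ?m * s ^ CARD('n) \<le> unit_ball_integral (\<lambda>w. (g w)\<^sup>2) * s ^ CARD('n)"
    using 1 s by (intro mult_right_mono) auto
  ultimately show ?thesis by (simp add: mult.commute)
qed

text \<open>Both derivatives are moved onto the weight by the mean value property. The resulting
  kernel is symmetric in the two indices, hence so is the Hessian.\<close>

lemma hessian_symmetric_harmonic: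
  fixes g :: "real ^ 'n::finite \<Rightarrow> real"
  assumes S: "open S" and g: "C2_on S g" and lap: "\<And>x. x \<in> S \<Longrightarrow> laplacian g x = 0" and x: "x \<in> S"
  shows "partial_deriv i (partial_deriv j g) x = partial_deriv j (partial_deriv i g) x"
proof -
  let ?m = "kern_mass TYPE(real ^ 'n)"
  obtain R where R: "0 < R" "ball x R \<subseteq> S" using S x by (meson openE)
  define s where "s = R / 2"
  have s: "0 < s" "s < R" using R by (auto simp: s_def)
  have g1: "continuous_on S (partial_deriv i g)" for i
    using g by (intro continuous_at_imp_continuous_on ballI differentiable_imp_continuous_within) (auto simp: C2_on_def)
  have g2: "continuous_on S (partial_deriv i (partial_deriv j g))" for i j
    using g by (auto simp: C2_on_def)
  note D = C2_onD[OF g]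
  have mv2: "mv S (partial_deriv j (partial_deriv i g))" for i j
    by (intro mv_partial_deriv[OF S _ g2] mv_partial_deriv[OF S _ g1] mv_harmonic[OF S g lap] D)
  \<comment> \<open>The derivative of \<open>w $ j * kern 2 w\<close> along coordinate
    \<open>i\<close>; a factor 6 from differentiating \<open>kern 3\<close> is kept outside.\<close>
  define L where "L i j w = (if i = j then 1 else 0) * kern 2 w - 4 * (w $ i * w $ j) * kern 1 w" for i j and w :: "real ^ 'n"
  have "s * (s * (partial_deriv j (partial_deriv i g) x * ?m)) = - (6 * unit_ball_integral (\<lambda>w. g (x + s *\<^sub>R w) * L i j w))" for i j
  proof -
    have "s * unit_ball_integral (\<lambda>w. partial_deriv j (partial_deriv i g) (x + s *\<^sub>R w) * kern 3 w) =
        - unit_ball_integral (\<lambda>w. partial_deriv i g (x + s *\<^sub>R w) * (- 6 * w $ j * kern 2 w))"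
    proof (rule mv_integration_by_parts[OF S D(2) g2 R(2) s])
      show "((\<lambda>t. kern 3 (w + t *\<^sub>R axis j 1)) has_real_derivative - 6 * w $ j * kern 2 w) (at 0)" for w :: "real ^ 'n"
        using kern_line_derivative[of 2 w "axis j 1"] by (simp add: inner_axis eval_nat_numeral)
    qed (auto intro!: continuous_intros continuous_on_kern simp: kern_zero)
    also have "\<dots> = 6 * unit_ball_integral (\<lambda>w. partial_deriv i g (x + s *\<^sub>R w) * (w $ j * kern 2 w))"
    proof -
      have "p * (- 6 * q * k) = - 6 * (p * (q * k))" for p q k :: real by simp
      then show ?thesis by (simp only: set_integral_mult_right)
    qed
    finally have 1: "s * (partial_deriv j (partial_deriv i g) x * ?m) = 6 * unit_ball_integral (\<lambda>w. partial_deriv i g (x + s *\<^sub>R w) * (w $ j * kern 2 w))"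
      using mv2 R s unfolding mv_def by simp
    let ?K = "\<lambda>w::real ^ 'n. w $ j * kern 2 w"
    have K1: "continuous_on UNIV ?K" by (intro continuous_intros continuous_on_kern)
    have K2: "continuous_on UNIV (L i j)"
      unfolding L_def[abs_def] by (intro continuous_intros continuous_on_kern)
    have K3: "((\<lambda>t. ?K (w + t *\<^sub>R axis i 1)) has_real_derivative L i j w) (at 0)" for w
    proof -
      have d1: "((\<lambda>t. kern 2 (w + t *\<^sub>R axis i 1)) has_real_derivative - 4 * w $ i * kern 1 w) (at 0)"
        using kern_line_derivative[of 1 w "axis i 1"] by (simp add: inner_axis numeral_2_eq_2)
      have d2: "((\<lambda>t. (w + t *\<^sub>R axis i 1) $ j) has_real_derivative (if i = j then 1 else 0)) (at 0)"
      proof -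
        have "(w + t *\<^sub>R axis i 1) $ j = w $ j + t * (if i = j then 1 else 0)" for t
          by (simp add: axis_def)
        moreover have "((\<lambda>t. w $ j + t * c) has_real_derivative c) (at 0)" for c :: real
          by (auto intro!: derivative_eq_intros)
        ultimately show ?thesis by (simp only:)
      qed
      have "((\<lambda>t. ?K (w + t *\<^sub>R axis i 1)) has_real_derivative
          (if i = j then 1 else 0) * kern 2 (w + 0 *\<^sub>R axis i 1) + (- 4 * w $ i * kern 1 w) * (w + 0 *\<^sub>R axis i 1) $ j) (at 0)"
        by (rule DERIV_mult[OF d2 d1])
      moreover have "(if i = j then 1 else 0) * kern 2 (w + 0 *\<^sub>R axis i 1) + (- 4 * w $ i * kern 1 w) * (w + 0 *\<^sub>R axis i 1) $ j = L i j w"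
        by (simp add: L_def)
      ultimately show ?thesis by (simp only:)
    qed
    have K4: "?K w = 0" if "1 \<le> norm w" for w using kern_zero[OF that] by simp
    have K5: "L i j w = 0" if "1 \<le> norm w" for w using kern_zero[OF that] by (simp add: L_def)
    have 2: "s * unit_ball_integral (\<lambda>w. partial_deriv i g (x + s *\<^sub>R w) * ?K w) = - unit_ball_integral (\<lambda>w. g (x + s *\<^sub>R w) * L i j w)"
      by (rule mv_integration_by_parts[OF S D(1) g1 R(2) s K1 K2 K3 K4 K5])
    show ?thesis unfolding 1 mult.left_commute[of s 6] 2 by (rule mult_minus_right)
  qed
  note eq = this
  have "L i j = L j i" by (simp add: L_def fun_eq_iff mult.commute)
  then have "s * (s * (partial_deriv j (partial_deriv i g) x * ?m)) = s * (s * (partial_deriv i (partial_deriv j g) x * ?m))"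
    using eq[of j i] eq[of i j] by simp
  then show ?thesis using s kern_mass_pos[where 'a = "real ^ 'n"] by simp
qed

subsection \<open>Integration along normals\<close>

text \<open>Replaces integration of a bound by an explicit antiderivative \<open>G\<close> of the
  majorant: \<open>G - F\<close> and \<open>G + F\<close> are both nondecreasing.\<close>

lemma abs_diff_le_of_derivative_bound:
  fixes F G :: "real \<Rightarrow> real"
  assumes "a \<le> b"
    and F: "\<And>t. a \<le> t \<Longrightarrow> t \<le> b \<Longrightarrow> (F has_real_derivative F' t) (at t)"
    and G: "\<And>t. a \<le> t \<Longrightarrow> t \<le> b \<Longrightarrow> (G has_real_derivative G' t) (at t)"
    and bd: "\<And>t. a \<le> t \<Longrightarrow> t \<le> b \<Longrightarrow> \<bar>F' t\<bar> \<le> G' t"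
  shows "\<bar>F b - F a\<bar> \<le> G b - G a"
proof -
  have "G a - F a \<le> G b - F b"
  proof (rule DERIV_nonneg_imp_nondecreasing[OF assms(1)])
    fix t assume t: "a \<le> t" "t \<le> b"
    show "\<exists>y. ((\<lambda>t. G t - F t) has_real_derivative y) (at t) \<and> 0 \<le> y"
      using DERIV_diff[OF G[OF t] F[OF t]] bd[OF t] by (intro exI[of _ "G' t - F' t"]) auto
  qed
  moreover have "G a + F a \<le> G b + F b"
  proof (rule DERIV_nonneg_imp_nondecreasing[OF assms(1)])
    fix t assume t: "a \<le> t" "t \<le> b"
    show "\<exists>y. ((\<lambda>t. G t + F t) has_real_derivative y) (at t) \<and> 0 \<le> y"
      using DERIV_add[OF G[OF t] F[OF t]] bd[OF t] by (intro exI[of _ "G' t + F' t"]) auto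
  qed
  ultimately show ?thesis by (simp add: abs_le_iff)
qed

text \<open>The bound on the second derivative is integrated twice from \<open>r\<close> downwards,
  with powers as antiderivatives; the exponents 1 and 2 are excluded because they would produce
  logarithms. The absolute value of \<open>2 - m\<close> lets one formula serve both the convergent
  and the divergent case.\<close>

lemma decay_integration:
  fixes f k l :: "real \<Rightarrow> real"
  assumes m: "1 < m" "m \<noteq> 2" and e: "0 < \<epsilon>" "\<epsilon> \<le> r" and B: "0 \<le> B"
    and f: "\<And>t. 0 < t \<Longrightarrow> t \<le> r \<Longrightarrow> (f has_real_derivative k t) (at t)"
    and k: "\<And>t. 0 < t \<Longrightarrow> t \<le> r \<Longrightarrow> (k has_real_derivative l t) (at t)"
    and l: "\<And>t. 0 < t \<Longrightarrow> t \<le> r \<Longrightarrow> \<bar>l t\<bar> \<le> B * t powr (- m)" and kr: "\<bar>k r\<bar> \<le> B"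
  shows "\<bar>f r - f \<epsilon>\<bar> \<le> B * (r + (r powr (2 - m) + \<epsilon> powr (2 - m)) / ((m - 1) * \<bar>2 - m\<bar>))"
proof -
  have kb: "\<bar>k t\<bar> \<le> B + B / (m - 1) * t powr (1 - m)" if t: "0 < t" "t \<le> r" for t
  proof -
    define P where "P s = - (B / (m - 1)) * s powr (1 - m)" for s
    have "\<bar>k r - k t\<bar> \<le> P r - P t"
    proof (rule abs_diff_le_of_derivative_bound[OF t(2)])
      fix s assume s: "t \<le> s" "s \<le> r"
      then have s0: "0 < s" using t by simp
      show "(k has_real_derivative l s) (at s)" using k s s0 by simp
      show "\<bar>l s\<bar> \<le> B * s powr (- m)" using l s s0 by simp
      have "((\<lambda>s. s powr (1 - m)) has_real_derivative (1 - m) * s powr (1 - m - 1)) (at s)"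
        by (rule has_real_derivative_powr[OF s0])
      from DERIV_cmult[OF this, of "- (B / (m - 1))"]
      have "(P has_real_derivative - (B / (m - 1)) * ((1 - m) * s powr (1 - m - 1))) (at s)"
        unfolding P_def .
      moreover have "- (B / (m - 1)) * (1 - m) = B" using m by (simp add: field_simps)
      then have "- (B / (m - 1)) * ((1 - m) * s powr (1 - m - 1)) = B * s powr (- m)"
        by (simp add: mult.assoc[symmetric])
      ultimately show "(P has_real_derivative B * s powr (- m)) (at s)" by (simp only:)
    qed
    moreover have "P r \<le> 0" using B m by (simp add: P_def)
    ultimately show ?thesis using kr by (simp add: P_def)
  qed
  define Q where "Q t = B * t + B / (m - 1) * (t powr (2 - m) / (2 - m))" for t
  have "\<bar>f r - f \<epsilon>\<bar> \<le> Q r - Q \<epsilon>"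
  proof (rule abs_diff_le_of_derivative_bound[OF e(2)])
    fix t assume t: "\<epsilon> \<le> t" "t \<le> r"
    then have t0: "0 < t" using e by simp
    show "(f has_real_derivative k t) (at t)" using f t t0 by simp
    show "\<bar>k t\<bar> \<le> B + B / (m - 1) * t powr (1 - m)" using kb t t0 by simp
    have "((\<lambda>t. t powr (2 - m)) has_real_derivative (2 - m) * t powr (2 - m - 1)) (at t)"
      by (rule has_real_derivative_powr[OF t0])
    from DERIV_cdivide[OF this, of "2 - m"]
    have D: "((\<lambda>t. t powr (2 - m) / (2 - m)) has_real_derivative t powr (1 - m)) (at t)"
      using m by simp
    show "(Q has_real_derivative B + B / (m - 1) * t powr (1 - m)) (at t)"
      using DERIV_add[OF DERIV_cmult[OF DERIV_ident, of B] DERIV_cmult[OF D, of "B / (m - 1)"]]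
      unfolding Q_def by (simp only: mult_1_right)
  qed
  also have "Q r - Q \<epsilon> \<le> B * r + B / (m - 1) * ((r powr (2 - m) + \<epsilon> powr (2 - m)) / \<bar>2 - m\<bar>)"
  proof -
    have "(r powr (2 - m) - \<epsilon> powr (2 - m)) / (2 - m) \<le> (r powr (2 - m) + \<epsilon> powr (2 - m)) / \<bar>2 - m\<bar>"
    proof -
      have "(r powr (2 - m) - \<epsilon> powr (2 - m)) / (2 - m) \<le> \<bar>(r powr (2 - m) - \<epsilon> powr (2 - m)) / (2 - m)\<bar>"
        by (rule abs_ge_self)
      also have "\<dots> = \<bar>r powr (2 - m) - \<epsilon> powr (2 - m)\<bar> / \<bar>2 - m\<bar>" by (rule abs_divide)
      also have "\<dots> \<le> (r powr (2 - m) + \<epsilon> powr (2 - m)) / \<bar>2 - m\<bar>"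
      proof (intro divide_right_mono)
        have "0 \<le> r powr (2 - m)" "0 \<le> \<epsilon> powr (2 - m)" by simp_all
        then show "\<bar>r powr (2 - m) - \<epsilon> powr (2 - m)\<bar> \<le> r powr (2 - m) + \<epsilon> powr (2 - m)" by linarith
      qed simp
      finally show ?thesis .
    qed
    then have "B / (m - 1) * ((r powr (2 - m) - \<epsilon> powr (2 - m)) / (2 - m)) \<le>
        B / (m - 1) * ((r powr (2 - m) + \<epsilon> powr (2 - m)) / \<bar>2 - m\<bar>)"
      using B m by (intro mult_left_mono) auto
    moreover have "Q r - Q \<epsilon> = B * (r - \<epsilon>) + B / (m - 1) * ((r powr (2 - m) - \<epsilon> powr (2 - m)) / (2 - m))"
      by (simp add: Q_def algebra_simps diff_divide_distrib)
    moreover have "B * (r - \<epsilon>) \<le> B * r" using B e by (intro mult_left_mono) auto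
    ultimately show ?thesis by linarith
  qed
  also have "\<dots> = B * (r + (r powr (2 - m) + \<epsilon> powr (2 - m)) / ((m - 1) * \<bar>2 - m\<bar>))"
  proof -
    have "B * r + B / c * (X / D) = B * (r + X / (c * D))" for c X D by (simp add: distrib_left)
    then show ?thesis .
  qed
  finally show ?thesis .
qed

lemma line_sum_bound:
  fixes v :: "real ^ 'n::finite"
  assumes "\<And>j. \<bar>c j\<bar> \<le> M"
  shows "\<bar>\<Sum>j\<in>UNIV. v $ j * c j\<bar> \<le> CARD('n) * norm v * M"
proof -
  have "\<bar>\<Sum>j\<in>UNIV. v $ j * c j\<bar> \<le> (\<Sum>j\<in>(UNIV::'n set). norm v * M)"
    by (rule order_trans[OF sum_abs], rule sum_mono)
      (use assms component_le_norm_cart[of v] in \<open>auto simp: abs_mult intro!: mult_mono\<close>)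
  then show ?thesis by simp
qed

lemma diff_le_on_segment:
  fixes f :: "real ^ 'n::finite \<Rightarrow> real"
  assumes f: "\<And>w. w \<in> closed_segment x y \<Longrightarrow> f differentiable (at w)"
    and M: "\<And>w j. w \<in> closed_segment x y \<Longrightarrow> \<bar>partial_deriv j f w\<bar> \<le> M"
  shows "\<bar>f y - f x\<bar> \<le> CARD('n) * norm (y - x) * M"
proof -
  have mem: "x + t *\<^sub>R (y - x) \<in> closed_segment x y" if "0 \<le> t" "t \<le> 1" for t
    using that by (auto simp: closed_segment_def algebra_simps intro!: exI[of _ t])
  have "\<bar>f (x + 1 *\<^sub>R (y - x)) - f (x + 0 *\<^sub>R (y - x))\<bar> \<le>
      (CARD('n) * norm (y - x) * M) * 1 - (CARD('n) * norm (y - x) * M) * 0"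
  proof (rule abs_diff_le_of_derivative_bound)
    fix t :: real assume t: "0 \<le> t" "t \<le> 1"
    show "((\<lambda>t. f (x + t *\<^sub>R (y - x))) has_real_derivative
        (\<Sum>i\<in>UNIV. (y - x) $ i * partial_deriv i f (x + t *\<^sub>R (y - x)))) (at t)"
      by (rule has_real_derivative_along_line[OF f[OF mem[OF t]]])
    show "((\<lambda>t. (CARD('n) * norm (y - x) * M) * t) has_real_derivative CARD('n) * norm (y - x) * M) (at t)"
      by (auto intro!: derivative_eq_intros)
    show "\<bar>\<Sum>i\<in>UNIV. (y - x) $ i * partial_deriv i f (x + t *\<^sub>R (y - x))\<bar> \<le> CARD('n) * norm (y - x) * M"
      by (rule line_sum_bound) (rule M[OF mem[OF t]])
  qed simp
  then show ?thesis by simp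
qed

section \<open>Oscillation of the comparison function\<close>

lemma torsion_comparison_harmonic:
  fixes \<Omega> :: "(real ^ 'n::finite) set"
  assumes T: "torsion_domain r d \<Omega> u"
  shows "C2_on \<Omega> (comparison_fun u z a)" "\<And>x. x \<in> \<Omega> \<Longrightarrow> laplacian (comparison_fun u z a) x = 0"
    "mv \<Omega> (comparison_fun u z a)" "mv \<Omega> (partial_deriv i (comparison_fun u z a))"
    "mv \<Omega> (partial_deriv j (partial_deriv i (comparison_fun u z a)))"
    "continuous_on \<Omega> (partial_deriv i (comparison_fun u z a))"
    "continuous_on \<Omega> (partial_deriv j (partial_deriv i (comparison_fun u z a)))"
proof -
  note TD = torsion_domainD[OF T]
  let ?h = "comparison_fun u z a"
  show C: "C2_on \<Omega> ?h" by (rule comparison_fun_C2[OF TD(1,8)])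
  show L: "laplacian ?h x = 0" if "x \<in> \<Omega>" for x
    using T that comparison_fun_laplacian[OF TD(1,8) that]
    by (simp add: torsion_domain_def solves_torsion_problem_def)
  show mv0: "mv \<Omega> ?h" by (rule mv_harmonic[OF TD(1) C L])
  show c1: "continuous_on \<Omega> (partial_deriv i ?h)" for i
    using C by (intro continuous_at_imp_continuous_on ballI differentiable_imp_continuous_within) (auto simp: C2_on_def)
  show c2: "continuous_on \<Omega> (partial_deriv j (partial_deriv i ?h))" for i j
    using C by (auto simp: C2_on_def)
  show mv1: "mv \<Omega> (partial_deriv i ?h)" for i
    by (rule mv_partial_deriv[OF TD(1) C2_onD(1)[OF C] c1 mv0])
  show "mv \<Omega> (partial_deriv j (partial_deriv i ?h))" for i j
    by (rule mv_partial_deriv[OF TD(1) C2_onD(2)[OF C] c2 mv1])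
qed

text \<open>A bound by a real number, entry by entry, keeps the estimates in the reals; the norm
  with values in \<open>[0, \<infinity>]\<close> returns only at the end.\<close>

definition hess_bound :: "(real ^ 'n::finite) set \<Rightarrow> (real ^ 'n \<Rightarrow> real) \<Rightarrow> real \<Rightarrow> bool" where
  "hess_bound \<Omega> h B \<longleftrightarrow> (\<forall>i j. (\<integral>\<^sup>+y\<in>\<Omega>. ennreal ((partial_deriv i (partial_deriv j h) y)\<^sup>2) \<partial>lborel) \<le> ennreal (B\<^sup>2))"

lemma hessian_pointwise_bound:
  fixes \<Omega> :: "(real ^ 'n::finite) set"
  assumes T: "torsion_domain r d \<Omega> u" and B: "0 \<le> B" "hess_bound \<Omega> (comparison_fun u z a) B"
    and x: "0 < R" "ball x R \<subseteq> \<Omega>"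
  shows "\<bar>partial_deriv j (partial_deriv i (comparison_fun u z a)) x\<bar> \<le>
    sqrt (2 ^ CARD('n) / kern_mass TYPE(real ^ 'n)) * B * R powr (- (CARD('n) / 2))"
proof -
  let ?m = "kern_mass TYPE(real ^ 'n)" and ?N = "CARD('n)"
  define H where "H = partial_deriv j (partial_deriv i (comparison_fun u z a)) x"
  have m: "0 < ?m" by (rule kern_mass_pos)
  have "H\<^sup>2 * ?m * (R / 2) ^ ?N \<le> B\<^sup>2"
    unfolding H_def using x B
    by (intro mv_square_bound[OF torsion_comparison_harmonic(7,5)[OF T] x(2)]) (auto simp: hess_bound_def)
  then have "H\<^sup>2 \<le> 2 ^ ?N / ?m * B\<^sup>2 / R ^ ?N"
    using m x by (simp add: field_simps power_divide)
  also have "\<dots> = (sqrt (2 ^ ?N / ?m) * B * R powr (- (?N / 2)))\<^sup>2"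
  proof -
    have "(R powr (- (?N / 2)))\<^sup>2 = R powr (- real ?N)"
      using x by (simp add: power2_eq_square powr_add[symmetric])
    also have "\<dots> = inverse (R ^ ?N)" using x by (simp add: powr_minus powr_realpow)
    finally show ?thesis using m by (simp add: power_mult_distrib field_simps)
  qed
  finally have "\<bar>H\<bar>\<^sup>2 \<le> (sqrt (2 ^ ?N / ?m) * B * R powr (- (?N / 2)))\<^sup>2" by simp
  then show ?thesis unfolding H_def
    by (rule power2_le_imp_le) (use B m in simp)
qed

text \<open>The gradient of the comparison function vanishes at \<open>z\<close>. One chain turns
  this and the Hessian bound into a gradient bound on the component of the shrunk domain that
  contains \<open>z\<close>; a second chain, using that gradient bound, controls the function
  itself.\<close>

lemma interior_oscillation:
  assumes rho: "0 < \<rho>" "\<rho> \<le> r"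
  obtains C where "0 \<le> C"
    "\<And>(\<Omega> :: (real ^ 'n) set) u z a B x i. \<lbrakk>torsion_domain r d \<Omega> u; 0 \<le> B; hess_bound \<Omega> (comparison_fun u z a) B;
       critical_point u z; ball z \<rho> \<subseteq> \<Omega>; ball x \<rho> \<subseteq> \<Omega>\<rbrakk>
       \<Longrightarrow> \<bar>partial_deriv i (comparison_fun u z a) x\<bar> \<le> C * B \<and>
           \<bar>comparison_fun u z a x - comparison_fun u z a z\<bar> \<le> C * B"
proof -
  define N where "N = real CARD('n)"
  have N: "0 < N" by (simp add: N_def)
  \<comment> \<open>The depth supplied by \<open>inner_balls_connected\<close>. Steps of the chain
    are shorter than half of it, so that every point of a connecting segment still carries an inner
    ball of radius \<open>\<eta> / 2\<close>, where the Hessian is bounded by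
    \<open>M * B\<close>.\<close>
  define \<eta> where "\<eta> = \<rho> / 200"
  have \<eta>: "0 < \<eta>" "\<eta> < \<rho>" using rho by (auto simp: \<eta>_def)
  obtain K where K: "0 \<le> K"
    "\<And>(S :: (real ^ 'n) set) z F B. \<lbrakk>connected S; z \<in> S; S \<subseteq> cball z d; 0 \<le> (B::real);
        \<And>x y. \<lbrakk>x \<in> S; y \<in> S; dist x y < \<eta> / 2\<rbrakk> \<Longrightarrow> \<bar>F x - F y\<bar> \<le> B\<rbrakk>
        \<Longrightarrow> \<forall>x\<in>S. \<bar>F x - F z\<bar> \<le> K * B"
    using chain_bound[of "\<eta> / 2" d, where 'a = "real ^ 'n"] \<eta>(1) by (metis half_gt_zero)
  define M where "M = sqrt (2 ^ CARD('n) / kern_mass TYPE(real ^ 'n)) * (\<eta> / 2) powr (- (N / 2))"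
  have M: "0 \<le> M" using kern_mass_pos[where 'a = "real ^ 'n"] by (simp add: M_def)
  define C1 where "C1 = N * (\<eta> / 2) * M"
  have C1: "0 \<le> C1" using M N \<eta> by (simp add: C1_def)
  \<comment> \<open>The extra \<open>C1\<close> is due to segments between points of
    \<open>S\<close> that may leave \<open>S\<close>: there the gradient is compared with its value
    at an endpoint.\<close>
  define C2 where "C2 = N * (\<eta> / 2) * (K * C1 + C1)"
  have C2: "0 \<le> C2" using C1 K N \<eta> by (simp add: C2_def)
  define C where "C = K * C1 + K * C2"
  have main: "\<bar>partial_deriv i (comparison_fun u z a) x\<bar> \<le> C * B \<and>
      \<bar>comparison_fun u z a x - comparison_fun u z a z\<bar> \<le> C * B"
    if T: "torsion_domain r d \<Omega> u" and B: "0 \<le> B" "hess_bound \<Omega> (comparison_fun u z a) B"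
      and z: "critical_point u z" "ball z \<rho> \<subseteq> \<Omega>" and x: "ball x \<rho> \<subseteq> \<Omega>"
    for \<Omega> :: "(real ^ 'n) set" and u z a B x i
  proof -
    note TD = torsion_domainD[OF T]
    let ?h = "comparison_fun u z a"
    note h = torsion_comparison_harmonic[OF T]
    define Y where "Y = {y. cball y \<eta> \<subseteq> \<Omega>}"
    define S where "S = connected_component_set Y z"
    have Y\<Omega>: "Y \<subseteq> \<Omega>" using \<eta> by (auto simp: Y_def)
    have S: "connected S" "S \<subseteq> Y" by (auto simp: S_def connected_component_subset)
    have "connected_component Y z x"
      unfolding Y_def \<eta>_def by (rule inner_balls_connected[OF TD(1,3,2,5) rho z(2) x])
    then have xS: "x \<in> S" by (simp add: S_def)
    have "z \<in> Y" using z(2) \<eta> unfolding Y_def by (auto simp: subset_eq)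
    then have zS: "z \<in> S" by (simp add: S_def)
    have Sd: "S \<subseteq> cball z d"
    proof
      fix y assume "y \<in> S"
      then have "y \<in> closure \<Omega>" "z \<in> closure \<Omega>" using S Y\<Omega> zS closure_subset[of \<Omega>] by auto
      then show "y \<in> cball z d" using TD(12) by (simp add: dist_norm)
    qed
    have seg: "w \<in> \<Omega>" "\<bar>partial_deriv j (partial_deriv i ?h) w\<bar> \<le> M * B"
      if "x \<in> S" "dist x y < \<eta> / 2" "w \<in> closed_segment x y" for x y w i j
    proof -
      have "dist x w \<le> dist x y" using dist_in_closed_segment[OF that(3)] by (simp add: dist_commute)
      then have "ball w (\<eta> / 2) \<subseteq> cball x \<eta>"
        using that(2) by (simp add: ball_subset_cball_iff dist_commute)
      also have "\<dots> \<subseteq> \<Omega>" using that(1) S by (auto simp: Y_def)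
      finally have bw: "ball w (\<eta> / 2) \<subseteq> \<Omega>" .
      then show "w \<in> \<Omega>" using \<eta> by (auto simp: subset_eq)
      show "\<bar>partial_deriv j (partial_deriv i ?h) w\<bar> \<le> M * B"
        using hessian_pointwise_bound[OF T B half_gt_zero[OF \<eta>(1)] bw, of j i]
        by (simp add: M_def N_def mult_ac)
    qed
    have d1: "\<bar>partial_deriv i ?h y - partial_deriv i ?h x\<bar> \<le> C1 * B" if "x \<in> S" "dist x y < \<eta> / 2" for x y i
    proof -
      have "\<bar>partial_deriv i ?h y - partial_deriv i ?h x\<bar> \<le> CARD('n) * norm (y - x) * (M * B)"
        by (rule diff_le_on_segment) (use seg[OF that] C2_onD(2)[OF h(1)] in auto)
      also have "\<dots> \<le> N * (\<eta> / 2) * (M * B)"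
        using that(2) M B N by (intro mult_right_mono) (auto simp: N_def dist_norm norm_minus_commute)
      finally show ?thesis by (simp add: C1_def mult_ac)
    qed
    have g: "\<forall>x\<in>S. \<bar>partial_deriv i ?h x - partial_deriv i ?h z\<bar> \<le> K * (C1 * B)" for i
    proof (rule K(2)[OF S(1) zS Sd])
      show "\<bar>partial_deriv i ?h x - partial_deriv i ?h y\<bar> \<le> C1 * B" if "x \<in> S" "y \<in> S" "dist x y < \<eta> / 2" for x y
        using d1[OF that(1,3)] by (simp add: abs_minus_commute)
    qed (use C1 B in simp)
    have "partial_deriv i ?h z = 0" for i
      using z(1) comparison_fun_partial_deriv[of u z i z a] by (simp add: critical_point_def)
    then have g': "\<bar>partial_deriv i ?h x\<bar> \<le> K * (C1 * B)" if "x \<in> S" for i x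
      using g that by fastforce
    have "\<forall>x\<in>S. \<bar>?h x - ?h z\<bar> \<le> K * (C2 * B)"
    proof (rule K(2)[OF S(1) zS Sd])
      fix x y assume xy: "x \<in> S" "y \<in> S" "dist x y < \<eta> / 2"
      have "\<bar>?h y - ?h x\<bar> \<le> CARD('n) * norm (y - x) * (K * (C1 * B) + C1 * B)"
      proof (rule diff_le_on_segment)
        fix w assume w: "w \<in> closed_segment x y"
        show "?h differentiable (at w)" using seg[OF xy(1,3) w] C2_onD(1)[OF h(1)] by blast
        fix j
        have "dist x w < \<eta> / 2" using dist_in_closed_segment[OF w] xy(3) by (simp add: dist_commute)
        then show "\<bar>partial_deriv j ?h w\<bar> \<le> K * (C1 * B) + C1 * B"
          using d1[OF xy(1), of w j] g'[OF xy(1), of j] by linarith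
      qed
      also have "\<dots> \<le> N * (\<eta> / 2) * (K * (C1 * B) + C1 * B)"
        using xy(3) K C1 B N by (intro mult_right_mono) (auto simp: N_def dist_norm norm_minus_commute)
      also have "\<dots> = C2 * B" by (simp add: C2_def algebra_simps)
      finally show "\<bar>?h x - ?h y\<bar> \<le> C2 * B" by (simp add: abs_minus_commute)
    qed (use C2 B in simp)
    then have "\<bar>?h x - ?h z\<bar> \<le> K * (C2 * B)" using xS by blast
    moreover have "K * (C1 * B) \<le> C * B" "K * (C2 * B) \<le> C * B"
      using K C1 C2 B by (simp_all add: C_def algebra_simps)
    ultimately show ?thesis using g'[OF xS, of i] by linarith
  qed
  have "0 \<le> C" using K C1 C2 by (simp add: C_def)
  then show ?thesis by (rule that) (rule main)
qed

lemma comparison_fun_near_boundary: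
  fixes \<Omega> :: "(real ^ 'n::finite) set"
  assumes T: "torsion_domain r d \<Omega> u" and p: "p \<in> frontier \<Omega>" and x: "x \<in> closure \<Omega>" and z: "z \<in> closure \<Omega>"
    and G: "\<bar>u x\<bar> \<le> G * norm (x - p)"
  shows "\<bar>comparison_fun u z a p - comparison_fun u z a x\<bar> \<le> (G + d) * norm (x - p)"
proof -
  note TD = torsion_domainD[OF T]
  define b c where "b = norm (p - z)" and "c = norm (x - z)"
  have bc: "0 \<le> b" "0 \<le> c" "b \<le> d" "c \<le> d" using TD(12)[OF TD(14)[OF p] z] TD(12)[OF x z] by (auto simp: b_def c_def)
  have "\<bar>b - c\<bar> \<le> norm (x - p)"
    using norm_triangle_ineq3[of "p - z" "x - z"] by (simp add: b_def c_def norm_minus_commute)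
  then have "\<bar>b - c\<bar> * (b + c) \<le> norm (x - p) * (2 * d)" using bc by (intro mult_mono) auto
  then have "\<bar>(b - c) * (b + c)\<bar> \<le> 2 * (d * norm (x - p))" using bc by (simp add: abs_mult mult_ac)
  moreover have "comparison_fun u z a p - comparison_fun u z a x = 1 / 2 * ((b - c) * (b + c)) + u x"
    using TD(11)[OF p] by (simp add: comparison_fun_def b_def c_def power2_eq_square algebra_simps)
  ultimately show ?thesis using G by (simp add: distrib_right)
qed

text \<open>Every \<open>m\<close> not below \<open>N / 2\<close> is an admissible decay exponent up
  to a constant. For \<tau> below 1 the choice of \<open>m\<close> solves
  \<open>1 + \<tau> * (2 - m) = \<tau>\<close>, so that the interior cost
  \<open>B * \<epsilon> powr (2 - m)\<close> and the width \<open>\<epsilon> = B powr \<tau>\<close>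
  of the boundary layer are of the same order. For \<tau> equal to 1 the exponent 3/2 keeps the
  double integral bounded as \<epsilon> tends to zero.\<close>

lemma boundary_oscillation:
  assumes r: "0 < r" and dl: "0 < \<delta>" and \<tau>: "0 < \<tau>" "\<tau> \<le> 1"
    and m: "m = (if \<tau> = 1 then 3 / 2 else 1 + 1 / \<tau>)" "CARD('n) / 2 \<le> m"
  obtains C where "0 \<le> C"
    "\<And>(\<Omega> :: (real ^ 'n) set) u z a B p. \<lbrakk>torsion_domain r d \<Omega> u; 0 < B; B \<le> 1; hess_bound \<Omega> (comparison_fun u z a) B;
       critical_point u z; z \<in> \<Omega>; infdist z (frontier \<Omega>) = \<delta>; p \<in> frontier \<Omega>\<rbrakk>
       \<Longrightarrow> \<bar>comparison_fun u z a p - comparison_fun u z a z\<bar> \<le> C * B powr \<tau>"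
proof -
  \<comment> \<open>With this radius both \<open>z\<close> and the centre of each interior tangent
    ball carry an inner ball.\<close>
  define \<rho> where "\<rho> = min r \<delta>"
  have \<rho>: "0 < \<rho>" "\<rho> \<le> r" "\<rho> \<le> \<delta>" using r dl by (auto simp: \<rho>_def)
  define N where "N = real CARD('n)"
  have N: "0 < N" by (simp add: N_def)
  obtain C1 where C1: "0 \<le> C1"
    "\<And>(\<Omega> :: (real ^ 'n) set) u z a B x i. \<lbrakk>torsion_domain r d \<Omega> u; 0 \<le> B; hess_bound \<Omega> (comparison_fun u z a) B;
       critical_point u z; ball z \<rho> \<subseteq> \<Omega>; ball x \<rho> \<subseteq> \<Omega>\<rbrakk>
       \<Longrightarrow> \<bar>partial_deriv i (comparison_fun u z a) x\<bar> \<le> C1 * B \<and>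
           \<bar>comparison_fun u z a x - comparison_fun u z a z\<bar> \<le> C1 * B"
    using interior_oscillation[OF \<rho>(1,2), where 'n = 'n and d = d] by metis
  obtain G where G: "0 < G"
    "\<And>(\<Omega> :: (real ^ 'n) set) u x p. \<lbrakk>torsion_domain r d \<Omega> u; p \<in> frontier \<Omega>; x \<in> closure \<Omega>\<rbrakk>
       \<Longrightarrow> \<bar>u x\<bar> \<le> G * norm (x - p)"
    using torsion_boundary_growth[OF r, where 'n = 'n and d = d] by metis
  have m12: "1 < m" "m \<noteq> 2" using m(1) \<tau> by (auto split: if_splits)
  define C0 where "C0 = sqrt (2 ^ CARD('n) / kern_mass TYPE(real ^ 'n))"
  have C0: "0 \<le> C0" using kern_mass_pos[where 'a = "real ^ 'n"] by (simp add: C0_def)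
  \<comment> \<open>The first summand includes the price \<open>r powr (m - N / 2)\<close> of
    passing from the exponent \<open>N / 2\<close> to \<open>m\<close> on \<open>(0, r]\<close>; the
    second bounds the slope at the starting point \<open>r\<close>.\<close>
  define b where "b = N * N * C0 * r powr (m - N / 2) + N * C1"
  have b: "0 \<le> b" using N C0 C1 by (simp add: b_def)
  define A where "A = 1 / ((m - 1) * \<bar>2 - m\<bar>)"
  have A: "0 \<le> A" using m12 by (simp add: A_def)
  define C where "C = (G + \<bar>d\<bar>) + b * (r + (2 * r powr (2 - m) + 1) * A) + C1"
  have main: "\<bar>comparison_fun u z a p - comparison_fun u z a z\<bar> \<le> C * B powr \<tau>"
    if T: "torsion_domain r d \<Omega> u" and B: "0 < B" "B \<le> 1" and hb: "hess_bound \<Omega> (comparison_fun u z a) B"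
      and z: "critical_point u z" "z \<in> \<Omega>" "infdist z (frontier \<Omega>) = \<delta>" and p: "p \<in> frontier \<Omega>"
    for \<Omega> :: "(real ^ 'n) set" and u z a B p
  proof -
    note TD = torsion_domainD[OF T]
    let ?h = "comparison_fun u z a"
    note h = torsion_comparison_harmonic[OF T]
    have bz: "ball z \<rho> \<subseteq> \<Omega>" using ball_infdist_frontier_subset[OF TD(1) z(2)] z(3) \<rho>(3) by fastforce
    obtain \<nu> where \<nu>: "inner_normal \<Omega> r p \<nu>" using TD(13)[OF p] by blast
    have n: "norm \<nu> = 1" using \<nu> by (simp add: inner_normal_def)
    have bt: "ball (p + t *\<^sub>R \<nu>) t \<subseteq> \<Omega>" if "t \<le> r" for t
      using normal_ball_nested[OF n that, of p] \<nu> by (auto simp: inner_normal_def)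
    have xt: "p + t *\<^sub>R \<nu> \<in> \<Omega>" if "0 < t" "t \<le> r" for t using bt[OF that(2)] that(1) by auto
    have bc: "ball (p + r *\<^sub>R \<nu>) \<rho> \<subseteq> \<Omega>" using bt[of r] \<rho>(2) by fastforce
    note osc = C1(2)[OF T less_imp_le[OF B(1)] hb z(1) bz bc]
    define f where "f t = ?h (p + t *\<^sub>R \<nu>)" for t
    define k where "k t = (\<Sum>i\<in>UNIV. \<nu> $ i * partial_deriv i ?h (p + t *\<^sub>R \<nu>))" for t
    define l where "l t = (\<Sum>i\<in>UNIV. \<nu> $ i * (\<Sum>j\<in>UNIV. \<nu> $ j * partial_deriv j (partial_deriv i ?h) (p + t *\<^sub>R \<nu>)))" for t
    \<comment> \<open>The cap by \<open>r\<close> keeps the point at distance \<epsilon> inside the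
      interior tangent ball; it is active only when \<open>B powr \<tau>\<close> is at least
      \<open>r\<close>, where \<open>\<epsilon> powr (2 - m)\<close> is a constant.\<close>
    define \<epsilon> where "\<epsilon> = min r (B powr \<tau>)"
    have e: "0 < \<epsilon>" "\<epsilon> \<le> r" "\<epsilon> \<le> B powr \<tau>" using r B by (auto simp: \<epsilon>_def)
    have "\<bar>f r - f \<epsilon>\<bar> \<le> (b * B) * (r + (r powr (2 - m) + \<epsilon> powr (2 - m)) / ((m - 1) * \<bar>2 - m\<bar>))"
    proof (rule decay_integration[OF m12 e(1,2)])
      show "0 \<le> b * B" using b B by simp
      fix t assume t: "0 < t" "t \<le> r"
      show "(f has_real_derivative k t) (at t)"
        unfolding f_def k_def by (rule has_real_derivative_along_line[OF C2_onD(1)[OF h(1) xt[OF t]]])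
      show "(k has_real_derivative l t) (at t)"
        unfolding k_def l_def
        by (intro DERIV_sum DERIV_cmult has_real_derivative_along_line C2_onD(2)[OF h(1) xt[OF t]])
      define M where "M = C0 * B * t powr (- (N / 2))"
      have "\<bar>partial_deriv j (partial_deriv i ?h) (p + t *\<^sub>R \<nu>)\<bar> \<le> M" for i j
        using hessian_pointwise_bound[OF T less_imp_le[OF B(1)] hb t(1) bt[OF t(2)], of j i] by (simp add: M_def C0_def N_def)
      then have "\<bar>\<Sum>j\<in>UNIV. \<nu> $ j * partial_deriv j (partial_deriv i ?h) (p + t *\<^sub>R \<nu>)\<bar> \<le> N * M" for i
        using line_sum_bound[of _ M \<nu>] n by (simp add: N_def)
      then have "\<bar>l t\<bar> \<le> N * (N * M)"
        using line_sum_bound[of _ "N * M" \<nu>] n by (simp add: N_def l_def)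
      also have "\<dots> \<le> b * B * t powr (- m)"
      proof -
        have "t powr (- (N / 2)) = t powr (m - N / 2) * t powr (- m)"
          by (simp add: powr_add[symmetric])
        also have "\<dots> \<le> r powr (m - N / 2) * t powr (- m)"
          using t m(2) by (intro mult_right_mono powr_mono2) (auto simp: N_def)
        finally have "N * N * C0 * B * t powr (- (N / 2)) \<le> N * N * C0 * B * (r powr (m - N / 2) * t powr (- m))"
          using N C0 B by (intro mult_left_mono) auto
        moreover have "0 \<le> N * C1 * B * t powr (- m)" using N C1 B by simp
        ultimately show ?thesis by (simp add: b_def M_def algebra_simps)
      qed
      finally show "\<bar>l t\<bar> \<le> b * B * t powr (- m)" .
    next
      have "\<bar>k r\<bar> \<le> N * (C1 * B)"
        using line_sum_bound[of "\<lambda>i. partial_deriv i ?h (p + r *\<^sub>R \<nu>)" "C1 * B" \<nu>] osc n by (simp add: N_def k_def)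
      also have "\<dots> \<le> b * B" using N C0 B by (simp add: b_def algebra_simps)
      finally show "\<bar>k r\<bar> \<le> b * B" .
    qed
    also have "\<dots> = b * (B * r + (B * r powr (2 - m) + B * \<epsilon> powr (2 - m)) * A)"
      by (simp add: A_def distrib_left distrib_right add_divide_distrib mult_ac)
    also have "\<dots> \<le> b * (B powr \<tau> * r + (B powr \<tau> * r powr (2 - m) + B powr \<tau> * (r powr (2 - m) + 1)) * A)"
    proof -
      have B\<tau>: "B \<le> B powr \<tau>" using powr_mono'[of \<tau> 1 B] \<tau> B by simp
      have "B * \<epsilon> powr (2 - m) \<le> B powr \<tau> * (r powr (2 - m) + 1)"
      proof (cases "\<epsilon> = r")
        case True
        have "B * r powr (2 - m) \<le> B powr \<tau> * (r powr (2 - m) + 1)"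
          using B\<tau> B by (intro mult_mono) auto
        then show ?thesis using True by simp
      next
        case False
        then have "\<epsilon> = B powr \<tau>" by (auto simp: \<epsilon>_def)
        then have "B * \<epsilon> powr (2 - m) = B powr (1 + \<tau> * (2 - m))"
          using B by (simp add: powr_powr powr_add)
        also have "\<dots> \<le> B powr \<tau>"
        proof (rule powr_mono')
          show "\<tau> \<le> 1 + \<tau> * (2 - m)" using m(1) \<tau> by (auto simp: field_simps)
        qed (use B in auto)
        also have "\<dots> \<le> B powr \<tau> * (r powr (2 - m) + 1)" by (simp add: algebra_simps)
        finally show ?thesis .
      qed
      then show ?thesis using b A B\<tau> r
        by (intro mult_left_mono add_mono mult_right_mono) auto
    qed
    finally have 1: "\<bar>f r - f \<epsilon>\<bar> \<le> b * (r + (2 * r powr (2 - m) + 1) * A) * B powr \<tau>"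
      by (simp add: algebra_simps)
    have xc: "p + \<epsilon> *\<^sub>R \<nu> \<in> closure \<Omega>" "z \<in> closure \<Omega>" using xt[OF e(1,2)] z(2) closure_subset[of \<Omega>] by auto
    have "\<bar>?h p - f \<epsilon>\<bar> \<le> (G + d) * \<epsilon>"
      using comparison_fun_near_boundary[OF T p xc G(2)[OF T p xc(1)], of a] n e by (simp add: f_def)
    also have "\<dots> \<le> (G + \<bar>d\<bar>) * B powr \<tau>" using G(1) e by (intro mult_mono) auto
    finally have 2: "\<bar>?h p - f \<epsilon>\<bar> \<le> (G + \<bar>d\<bar>) * B powr \<tau>" .
    have "\<bar>f r - ?h z\<bar> \<le> C1 * B" using osc by (simp add: f_def)
    also have "\<dots> \<le> C1 * B powr \<tau>" using powr_mono'[of \<tau> 1 B] \<tau> B C1 by (intro mult_left_mono) auto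
    finally have 3: "\<bar>f r - ?h z\<bar> \<le> C1 * B powr \<tau>" .
    show ?thesis using 1 2 3 unfolding C_def by (simp only: distrib_right)
  qed
  have "0 \<le> C" using G b A C1 r by (simp add: C_def)
  then show ?thesis by (rule that) (rule main)
qed

lemma rho_difference_le:
  fixes \<Omega> :: "(real ^ 'n::finite) set"
  assumes T: "torsion_domain r d \<Omega> u" and z: "infdist z (frontier \<Omega>) = \<delta>" and dl: "0 < \<delta>"
    and M: "\<And>p. p \<in> frontier \<Omega> \<Longrightarrow> \<bar>comparison_fun u z a p - b\<bar> \<le> M"
  shows "rho_e \<Omega> z - rho_i \<Omega> z \<le> 2 * M / \<delta>"
proof -
  note TD = torsion_domainD[OF T]
  have F: "compact (frontier \<Omega>)" "frontier \<Omega> \<noteq> {}"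
    using TD frontier_not_empty_bounded compact_frontier_bounded by blast+
  have c: "continuous_on (frontier \<Omega>) (\<lambda>x. norm (x - z))" by (intro continuous_intros)
  obtain q where q: "q \<in> frontier \<Omega>" "\<And>x. x \<in> frontier \<Omega> \<Longrightarrow> norm (x - z) \<le> norm (q - z)"
    using continuous_attains_sup[OF F c] by blast
  obtain p where p: "p \<in> frontier \<Omega>" "\<And>x. x \<in> frontier \<Omega> \<Longrightarrow> norm (p - z) \<le> norm (x - z)"
    using continuous_attains_inf[OF F c] by blast
  have e: "rho_e \<Omega> z = norm (q - z)" unfolding rho_e_def by (rule cSup_eq_maximum) (use q in auto)
  have i: "rho_i \<Omega> z = norm (p - z)" unfolding rho_i_def by (rule cInf_eq_minimum) (use p in auto)
  have pd: "\<delta> \<le> norm (p - z)" "\<delta> \<le> norm (q - z)"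
    using infdist_le[OF p(1), of z] infdist_le[OF q(1), of z] z by (auto simp: dist_norm norm_minus_commute)
  have qp: "norm (p - z) \<le> norm (q - z)" using p q by blast
  have "2 * \<delta> * (norm (q - z) - norm (p - z)) \<le> (norm (q - z) + norm (p - z)) * (norm (q - z) - norm (p - z))"
    using pd qp by (intro mult_right_mono) auto
  also have "\<dots> = 2 * (comparison_fun u z a q - comparison_fun u z a p)"
    using TD(11)[OF p(1)] TD(11)[OF q(1)] by (simp add: comparison_fun_def power2_eq_square algebra_simps)
  also have "\<dots> \<le> 2 * (2 * M)" using abs_le_D1[OF M[OF q(1)]] abs_le_D2[OF M[OF p(1)]] by simp
  finally have "\<delta> * (norm (q - z) - norm (p - z)) \<le> 2 * M" by simp
  then show ?thesis unfolding e i using dl by (simp add: field_simps)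
qed

subsection \<open>Tangential regularity at the boundary\<close>

text \<open>On the largest inner ball around \<open>x\<close> the comparison function is bounded by
  a multiple of the radius, and the gradient estimate divides by that radius. A segment that leaves
  the domain meets the frontier, where \<open>u\<close> vanishes, so boundary growth handles that
  case.\<close>

lemma torsion_gradient_bound:
  assumes r: "0 < r"
  obtains L where "0 < L"
    "\<And>(\<Omega> :: (real ^ 'n) set) u x y. \<lbrakk>torsion_domain r d \<Omega> u; x \<in> closure \<Omega>; y \<in> closure \<Omega>\<rbrakk>
       \<Longrightarrow> \<bar>u x - u y\<bar> \<le> L * norm (x - y)"
proof -
  obtain G where G: "0 < G"
    "\<And>(\<Omega> :: (real ^ 'n) set) u x p. \<lbrakk>torsion_domain r d \<Omega> u; p \<in> frontier \<Omega>; x \<in> closure \<Omega>\<rbrakk>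
       \<Longrightarrow> \<bar>u x\<bar> \<le> G * norm (x - p)"
    using torsion_boundary_growth[OF r, where 'n = 'n and d = d] by metis
  define cE where "cE = 6 * measure lborel (cball (0 :: real ^ 'n) 1) / kern_mass TYPE(real ^ 'n)"
  have cE: "0 \<le> cE" using kern_mass_pos[where 'a = "real ^ 'n"] by (simp add: cE_def)
  define G1 where "G1 = cE * (\<bar>d\<bar> + 4 * G)"
  have G1: "0 \<le> G1" using cE G by (simp add: G1_def)
  define L where "L = CARD('n) * G1 + G"
  have grad: "\<bar>partial_deriv j u x\<bar> \<le> G1"
    if T: "torsion_domain r d \<Omega> u" and x: "x \<in> \<Omega>" for \<Omega> :: "(real ^ 'n) set" and u x j
  proof -
    note TD = torsion_domainD[OF T]
    note h = torsion_comparison_harmonic[OF T]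
    \<comment> \<open>Centring the quadratic at \<open>x\<close> makes its gradient vanish there and
      its size quadratic in the radius.\<close>
    let ?h = "comparison_fun u x 0"
    obtain p where p: "p \<in> frontier \<Omega>" "dist x p = infdist x (frontier \<Omega>)"
      using nearest_boundary_point[OF TD(3,4)] by blast
    define R where "R = infdist x (frontier \<Omega>)"
    have R: "0 < R" using infdist_frontier_pos[OF TD(1,3) x] by (simp add: R_def)
    have bR: "ball x R \<subseteq> \<Omega>" using ball_infdist_frontier_subset[OF TD(1) x] by (simp add: R_def)
    have Rd: "R \<le> d" using TD(12)[OF _ TD(14)[OF p(1)], of x] x closure_subset[of \<Omega>] p(2) by (auto simp: R_def dist_norm)
    have bd: "\<bar>?h y\<bar> \<le> R * (d / 2 + 2 * G)" if y: "y \<in> ball x R" for y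
    proof -
      have yx: "norm (y - x) \<le> R" using y by (simp add: dist_norm norm_minus_commute)
      have "norm (y - p) \<le> norm (y - x) + norm (x - p)" using norm_triangle_ineq[of "y - x" "x - p"] by simp
      then have "norm (y - p) \<le> 2 * R" using yx p(2) by (simp add: R_def dist_norm)
      then have "G * norm (y - p) \<le> G * (2 * R)" using G by (intro mult_left_mono) auto
      then have "\<bar>u y\<bar> \<le> R * (2 * G)"
        using G(2)[OF T p(1), of y] y bR closure_subset[of \<Omega>] by (fastforce simp: mult_ac)
      moreover have "(norm (y - x))\<^sup>2 \<le> R * d"
        unfolding power2_eq_square using yx Rd R by (intro mult_mono) auto
      moreover have "?h y = 1 / 2 * (norm (y - x))\<^sup>2 - u y" by (simp add: comparison_fun_def)
      moreover have "R * (d / 2 + 2 * G) = 1 / 2 * (R * d) + R * (2 * G)" by (simp add: algebra_simps)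
      moreover have "0 \<le> (norm (y - x))\<^sup>2" by simp
      ultimately show ?thesis by linarith
    qed
    have "\<bar>partial_deriv j ?h x\<bar> \<le> cE * (R * (d / 2 + 2 * G) / (R / 2))"
      unfolding cE_def
      by (rule mv_gradient_bound[OF TD(1) C2_onD(1)[OF h(1)] h(6,3) bR _ _ bd]) (use R in auto)
    also have "\<dots> = cE * (d + 4 * G)" using R by simp
    also have "\<dots> \<le> G1" unfolding G1_def using cE by (intro mult_left_mono) auto
    finally show ?thesis
      using comparison_fun_partial_deriv[OF C2_onD(1)[OF TD(8) x], of j x 0] by simp
  qed
  have main: "\<bar>u x - u y\<bar> \<le> L * norm (x - y)"
    if T: "torsion_domain r d \<Omega> u" and xy: "x \<in> closure \<Omega>" "y \<in> closure \<Omega>" for \<Omega> :: "(real ^ 'n) set" and u x y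
  proof (cases "closed_segment y x \<subseteq> \<Omega>")
    case True
    note TD = torsion_domainD[OF T]
    have "\<bar>u x - u y\<bar> \<le> CARD('n) * norm (x - y) * G1"
      by (rule diff_le_on_segment) (use True grad[OF T] C2_onD(1)[OF TD(8)] in auto)
    also have "\<dots> \<le> L * norm (x - y)" using G by (simp add: L_def algebra_simps)
    finally show ?thesis .
  next
    case False
    note TD = torsion_domainD[OF T]
    have "closed_segment y x \<inter> frontier \<Omega> \<noteq> {}"
    proof (cases "y \<in> \<Omega>")
      case True
      then show ?thesis using connected_Int_frontier[OF connected_segment(1), of y x \<Omega>] False by auto
    next
      case False
      then have "y \<in> frontier \<Omega>" using xy TD(1) by (simp add: frontier_def interior_open)
      then show ?thesis by auto
    qed
    then obtain p where p: "p \<in> frontier \<Omega>" "p \<in> closed_segment y x" by blast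
    have "norm (x - p) \<le> norm (x - y)" "norm (y - p) \<le> norm (x - y)"
      using dist_in_closed_segment[OF p(2)] by (auto simp: dist_norm norm_minus_commute)
    then have "G * norm (x - p) \<le> G * norm (x - y)" "G * norm (y - p) \<le> G * norm (x - y)"
      using G by auto
    then have "\<bar>u x\<bar> \<le> G * norm (x - y)" "\<bar>u y\<bar> \<le> G * norm (x - y)"
      using G(2)[OF T p(1) xy(1)] G(2)[OF T p(1) xy(2)] by linarith+
    moreover have "u x \<le> 0" "u y \<le> 0" using torsion_nonpos[OF T] xy by auto
    ultimately have "\<bar>u x - u y\<bar> \<le> G * norm (x - y)" by linarith
    also have "\<dots> \<le> L * norm (x - y)" using G1 by (simp add: L_def mult_right_mono)
    finally show ?thesis .
  qed
  have "0 < L" using G1 G by (simp add: L_def add_nonneg_pos)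
  then show ?thesis by (rule that) (rule main)
qed

text \<open>This says that the tangential gradient at scale \<open>R\<close> around \<open>p\<close>
  is of order \<open>R powr \<alpha>\<close>. Finite differences are used because they are harmonic
  where both points are inside and make sense up to the boundary, so that the maximum principle
  applies to them.\<close>

definition tang :: "real \<Rightarrow> real \<Rightarrow> real \<Rightarrow> (real ^ 'n::finite) set \<Rightarrow> (real ^ 'n \<Rightarrow> real) \<Rightarrow> bool" where
  "tang \<alpha> C r \<Omega> u \<longleftrightarrow> (\<forall>p \<nu> R x v. p \<in> frontier \<Omega> \<longrightarrow> inner_normal \<Omega> r p \<nu> \<longrightarrow> 0 < R \<longrightarrow> v \<bullet> \<nu> = 0 \<longrightarrow>
     x \<in> closure \<Omega> \<longrightarrow> x + v \<in> closure \<Omega> \<longrightarrow> norm (x - p) \<le> R \<longrightarrow> norm (x + v - p) \<le> R \<longrightarrow>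
     \<bar>u (x + v) - u x\<bar> \<le> C * norm v * R powr \<alpha>)"

text \<open>The vector \<open>v\<close> is orthogonal to the normal at \<open>p\<close>, hence
  almost orthogonal to the normal at \<open>x\<close>, as normals are Lipschitz. Moving from
  \<open>x\<close> along \<open>v\<close> thus increases the distance to the exterior ball at
  \<open>x\<close> only to second order.\<close>

lemma tangential_growth:
  fixes \<Omega> :: "(real ^ 'n::finite) set"
  assumes r: "0 < r" and \<nu>: "inner_normal \<Omega> r p \<nu>" and \<mu>: "inner_normal \<Omega> r x \<mu>" and v: "v \<bullet> \<nu> = 0"
  shows "norm (x + v - (x - r *\<^sub>R \<mu>)) - r \<le> 1 / r * norm v * (norm (x - p) + norm v)"
proof -
  have n: "\<mu> \<bullet> \<mu> = 1" using \<mu> by (simp add: inner_normal_def norm_eq_1)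
  define X where "X = norm (v + r *\<^sub>R \<mu>)"
  have "v \<bullet> \<mu> = v \<bullet> (\<mu> - \<nu>)" using v by (simp add: inner_diff_right)
  also have "\<dots> \<le> norm v * norm (\<mu> - \<nu>)" by (rule norm_cauchy_schwarz)
  also have "\<dots> \<le> norm v * (norm (x - p) / r)"
    by (intro mult_left_mono inner_normal_lipschitz[OF \<mu> \<nu> r]) auto
  finally have vm: "v \<bullet> \<mu> \<le> norm v * (norm (x - p) / r)" .
  have "X\<^sup>2 = (norm v)\<^sup>2 + 2 * r * (v \<bullet> \<mu>) + r\<^sup>2"
    unfolding X_def power2_norm_eq_inner using n by (simp add: algebra_simps inner_commute power2_eq_square)
  moreover have "0 \<le> (X - r)\<^sup>2" by simp
  ultimately have "2 * r * X \<le> (norm v)\<^sup>2 + 2 * r * (v \<bullet> \<mu>) + 2 * r\<^sup>2"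
    by (simp add: power2_eq_square algebra_simps)
  also have "\<dots> \<le> (norm v)\<^sup>2 + 2 * r * (norm v * (norm (x - p) / r)) + 2 * r\<^sup>2"
    using vm r by (intro add_mono mult_left_mono order_refl) auto
  also have "\<dots> = (norm v)\<^sup>2 + 2 * (norm v * norm (x - p)) + 2 * r\<^sup>2" using r by simp
  finally have "2 * r * X \<le> (norm v)\<^sup>2 + 2 * (norm v * norm (x - p)) + 2 * r\<^sup>2" .
  moreover have "(norm v)\<^sup>2 \<le> 2 * (norm v * norm v)" by (simp add: power2_eq_square)
  moreover have "2 * (r * (X - r)) = 2 * r * X - 2 * r\<^sup>2" by (simp add: algebra_simps power2_eq_square)
  ultimately have "r * (X - r) \<le> norm v * (norm (x - p) + norm v)" unfolding distrib_left by linarith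
  then have "X - r \<le> norm v * (norm (x - p) + norm v) / r" using r by (simp add: pos_le_divide_eq mult.commute)
  then have "X - r \<le> 1 / r * norm v * (norm (x - p) + norm v)" by simp
  then show ?thesis by (simp add: X_def)
qed

text \<open>The difference \<open>w\<close> is harmonic on the set \<open>D\<close> where
  \<open>y\<close> and \<open>y + v\<close> are both inside. Where the boundary of \<open>D\<close>
  comes from the frontier of the domain, one of the two values is zero and tangential growth bounds
  \<open>w\<close> by \<open>K\<close>; on the sphere of radius \<sigma> the old rate bounds it by
  \<open>M\<close>. Since \<open>q\<close> is at least 1 on that sphere but small near
  \<open>p\<close> when \<open>R\<close> is much smaller than \<sigma>, the old rate at scale
  \<sigma> improves to a better one at scale \<open>R\<close>.\<close>

lemma tang_step_small:
  fixes \<Omega> :: "(real ^ 'n::finite) set"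
  assumes T: "torsion_domain r d \<Omega> u"
    and G: "0 < G" "\<And>x p \<nu>. \<lbrakk>inner_normal \<Omega> r p \<nu>; p \<in> frontier \<Omega>; x \<in> closure \<Omega>\<rbrakk>
       \<Longrightarrow> \<bar>u x\<bar> \<le> G * (norm (x - (p - r *\<^sub>R \<nu>)) - r)"
    and C: "0 < C" and tang: "tang \<alpha> C r \<Omega> u"
    and p: "p \<in> frontier \<Omega>" "inner_normal \<Omega> r p \<nu>" and R: "0 < R" "R < \<sigma>" "\<sigma> \<le> r"
    and v: "v \<bullet> \<nu> = 0" "norm v \<le> \<sigma>"
    and x: "x \<in> closure \<Omega>" "x + v \<in> closure \<Omega>" "norm (x - p) \<le> R"
  shows "\<bar>u (x + v) - u x\<bar> \<le> 3 * G / r * norm v * \<sigma> +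
    C * norm v * (2 * \<sigma>) powr \<alpha> * (R\<^sup>2 / \<sigma>\<^sup>2 + (real CARD('n) + 1) * (R / \<sigma>) + (real CARD('n) + 1) * (\<sigma> / r))"
proof (cases "v = 0")
  case True
  then show ?thesis by simp
next
  case v0: False
  note TD = torsion_domainD[OF T]
  have r: "0 < r" by (rule TD(6))
  have \<sigma>: "0 < \<sigma>" using R by simp
  have nn: "norm \<nu> = 1" using p(2) by (simp add: inner_normal_def)
  define N where "N = real CARD('n)"
  have N: "0 < N" by (simp add: N_def)
  define t where "t = norm v"
  have t: "0 < t" "t \<le> \<sigma>" using v0 v(2) by (auto simp: t_def)
  define K where "K = 3 * G / r * t * \<sigma>"
  have K: "0 \<le> K" using G r t \<sigma> by (simp add: K_def)
  define M where "M = C * t * (2 * \<sigma>) powr \<alpha>"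
  have M: "0 < M" using C t \<sigma> by (simp add: M_def)
  define w where "w y = u (y + v) - u y" for y
  \<comment> \<open>The squared height, with coefficient \<open>N + 1\<close>, makes the Laplacian
    of \<open>q\<close> equal to \<open>- 2 / \<sigma>\<^sup>2\<close>, hence strictly negative. The
    linear height term compensates it above the tangent plane, and the constant covers the points
    below that plane.\<close>
  define q where "q y = (norm (y - p))\<^sup>2 / \<sigma>\<^sup>2 + (N + 1) * (((y - p) \<bullet> \<nu>) / \<sigma> - ((y - p) \<bullet> \<nu>)\<^sup>2 / \<sigma>\<^sup>2) + (N + 1) * (\<sigma> / r)" for y
  define b where "b y = K + M * q y" for y
  define F where "F = {y. y \<in> closure \<Omega> \<and> y + v \<in> closure \<Omega> \<and> norm (y - p) \<le> \<sigma>}"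
  define D where "D = {y. y \<in> \<Omega> \<and> y + v \<in> \<Omega> \<and> norm (y - p) < \<sigma>}"
  have F: "closed F"
  proof -
    have "F = closure \<Omega> \<inter> (\<lambda>y. y + v) -` closure \<Omega> \<inter> cball p \<sigma>"
      by (auto simp: F_def dist_norm norm_minus_commute)
    moreover have "closed ((\<lambda>y. y + v) -` closure \<Omega>)"
      by (rule closed_vimage) (auto intro!: continuous_intros)
    ultimately show ?thesis by (simp add: closed_Int)
  qed
  have Deq: "D = \<Omega> \<inter> (\<lambda>y. y + v) -` \<Omega> \<inter> ball p \<sigma>"
    by (auto simp: D_def dist_norm norm_minus_commute)
  have "open ((\<lambda>y. y + v) -` \<Omega>)"
    by (rule open_vimage[OF TD(1)]) (auto intro!: continuous_intros)
  then have oD: "open D" unfolding Deq using TD(1) by (simp add: open_Int)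
  have bD: "bounded D" unfolding Deq by (rule bounded_subset[OF TD(3)]) auto
  have "D \<subseteq> F" using closure_subset[of \<Omega>] by (auto simp: D_def F_def)
  then have DF: "closure D \<subseteq> F" using F by (rule closure_minimal)
  have fr: "y \<in> F \<and> (y \<in> frontier \<Omega> \<or> y + v \<in> frontier \<Omega> \<or> norm (y - p) = \<sigma>)" if "y \<in> frontier D" for y
  proof -
    have "y \<in> closure D" "y \<notin> D" using that oD by (auto simp: frontier_def interior_open)
    then have "y \<in> F" "y \<notin> D" using DF by auto
    then show ?thesis using TD(1) by (auto simp: F_def D_def frontier_def interior_open)
  qed
  have q0: "(norm (y - p))\<^sup>2 / \<sigma>\<^sup>2 \<le> q y" if y: "y \<in> F" for y
  proof -
    define s where "s = ((y - p) \<bullet> \<nu>) / \<sigma>"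
    \<comment> \<open>Negative heights are at least \<open>- (\<sigma> / (2 * r))\<close> after
      scaling, as the domain dips only quadratically; the square adds at most the same amount
      again.\<close>
    have "- (\<sigma> / r) \<le> s - s\<^sup>2"
    proof (cases "0 \<le> s")
      case True
      have "(y - p) \<bullet> \<nu> \<le> norm (y - p) * norm \<nu>" by (rule norm_cauchy_schwarz)
      then have "(y - p) \<bullet> \<nu> \<le> \<sigma>" using y nn by (simp add: F_def)
      then have "s \<le> 1" using \<sigma> by (simp add: s_def)
      then have "s * s \<le> s * 1" using True by (intro mult_left_mono) auto
      moreover have "0 \<le> \<sigma> / r" using \<sigma> r by simp
      ultimately show ?thesis unfolding power2_eq_square by linarith
    next
      case False
      have "(norm (y - p))\<^sup>2 \<le> \<sigma>\<^sup>2" using y by (intro power_mono) (auto simp: F_def)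
      then have "(norm (y - p))\<^sup>2 / (2 * r) \<le> \<sigma>\<^sup>2 / (2 * r)" using r by (simp add: divide_right_mono)
      then have "- (\<sigma>\<^sup>2 / (2 * r)) \<le> (y - p) \<bullet> \<nu>"
        using inner_normal_height[OF p(2), of y] y r by (simp add: F_def)
      then have "- (\<sigma>\<^sup>2 / (2 * r)) / \<sigma> \<le> s" using \<sigma> unfolding s_def by (intro divide_right_mono) auto
      then have s1: "- s \<le> \<sigma> / (2 * r)" using \<sigma> by (simp add: power2_eq_square field_simps)
      have "\<sigma> / (2 * r) \<le> 1" using R r by simp
      then have "- s \<le> 1" using s1 by linarith
      then have "(- s) * (- s) \<le> 1 * (- s)" using False by (intro mult_right_mono) auto
      then have "s\<^sup>2 \<le> - s" by (simp add: power2_eq_square)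
      moreover have "\<sigma> / (2 * r) + \<sigma> / (2 * r) = \<sigma> / r" using r by (simp add: field_simps)
      ultimately show ?thesis using s1 by linarith
    qed
    then have "0 \<le> (N + 1) * (s - s\<^sup>2 + \<sigma> / r)" using N by simp
    then show ?thesis by (simp add: q_def s_def power_divide distrib_left)
  qed
  have wb: "\<bar>w y\<bar> \<le> b y" if y: "y \<in> F" "y \<in> frontier \<Omega> \<or> y + v \<in> frontier \<Omega> \<or> norm (y - p) = \<sigma>" for y
  proof -
    have q1: "0 \<le> q y" using q0[OF y(1)] by (smt (verit) zero_le_divide_iff zero_le_power2)
    \<comment> \<open>The factor 3 in \<open>K\<close>: both points are within
      \<open>2 * \<sigma>\<close> of \<open>p\<close>, and the length of \<open>v\<close> adds at
      most one more \<sigma>.\<close>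
    have KG: "G * (1 / r * t * k) \<le> K" if "k \<le> 3 * \<sigma>" for k
    proof -
      have "G * (1 / r * t * k) \<le> G * (1 / r * t * (3 * \<sigma>))" using that G r t by (intro mult_left_mono) auto
      then show ?thesis by (simp add: K_def mult_ac)
    qed
    consider "y \<in> frontier \<Omega>" | "y + v \<in> frontier \<Omega>" | "norm (y - p) = \<sigma>" using y(2) by blast
    then have "\<bar>w y\<bar> \<le> K \<or> \<bar>w y\<bar> \<le> M * q y"
    proof cases
      case 1
      obtain \<mu> where \<mu>: "inner_normal \<Omega> r y \<mu>" using TD(13)[OF 1] by blast
      have "\<bar>w y\<bar> \<le> G * (norm (y + v - (y - r *\<^sub>R \<mu>)) - r)"
        using G(2)[OF \<mu> 1, of "y + v"] y(1) TD(11)[OF 1] by (simp add: w_def F_def)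
      also have "\<dots> \<le> G * (1 / r * t * (norm (y - p) + t))"
        unfolding t_def using G by (intro mult_left_mono tangential_growth[OF r p(2) \<mu> v(1)]) auto
      also have "\<dots> \<le> K" by (rule KG) (use y(1) t \<sigma> in \<open>simp add: F_def\<close>)
      finally show ?thesis by blast
    next
      case 2
      obtain \<mu> where \<mu>: "inner_normal \<Omega> r (y + v) \<mu>" using TD(13)[OF 2] by blast
      have "\<bar>w y\<bar> \<le> G * (norm (y + v + (- v) - (y + v - r *\<^sub>R \<mu>)) - r)"
        using G(2)[OF \<mu> 2, of y] y(1) TD(11)[OF 2] by (simp add: w_def F_def)
      also have "\<dots> \<le> G * (1 / r * t * (norm (y + v - p) + t))"
        unfolding t_def using G v(1) tangential_growth[OF r p(2) \<mu>, of "- v"] by (intro mult_left_mono) auto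
      also have "\<dots> \<le> K"
      proof (rule KG)
        have "norm (y + v - p) \<le> norm (y - p) + t"
          unfolding t_def using norm_triangle_ineq[of "y - p" v] by (simp add: algebra_simps)
        then show "norm (y + v - p) + t \<le> 3 * \<sigma>" using y(1) t by (simp add: F_def)
      qed
      finally show ?thesis by blast
    next
      case 3
      have "norm (y + v - p) \<le> norm (y - p) + t"
        unfolding t_def using norm_triangle_ineq[of "y - p" v] by (simp add: algebra_simps)
      \<comment> \<open>The shifted point may be at distance up to \<open>2 * \<sigma>\<close> from
        \<open>p\<close>, so the old rate is applied at that scale.\<close>
      then have "\<bar>w y\<bar> \<le> C * norm v * (2 * \<sigma>) powr \<alpha>"
        unfolding w_def using tang[unfolded tang_def, rule_format, OF p, of "2 * \<sigma>" v y] y(1) 3 t v(1) \<sigma>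
        by (simp add: F_def)
      then have "\<bar>w y\<bar> \<le> M * 1" by (simp add: M_def t_def)
      also have "\<dots> \<le> M * q y" using q0[OF y(1)] 3 \<sigma> M by (intro mult_left_mono) auto
      finally show ?thesis by blast
    qed
    moreover have "0 \<le> M * q y" using M q1 by simp
    ultimately show ?thesis using K by (auto simp: b_def)
  qed
  have main: "k * w y - b y \<le> 0" if k: "k = 1 \<or> k = - 1" and y: "y \<in> closure D" for k y
  proof (rule strict_maximum_principle[OF oD bD, of "\<lambda>y. k * w y - b y", OF _ _ _ y])
    have c1: "continuous_on F u"
      by (rule continuous_on_subset[OF TD(9)]) (auto simp: F_def)
    have c2: "continuous_on F (\<lambda>y. u (y + v))"
      by (rule continuous_on_compose2[OF TD(9)]) (auto simp: F_def intro!: continuous_intros)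
    have "continuous_on F (\<lambda>y. k * w y - b y)"
      unfolding w_def b_def q_def using \<sigma> by (intro continuous_intros c1 c2) auto
    then show "continuous_on (closure D) (\<lambda>y. k * w y - b y)" using DF by (rule continuous_on_subset)
    show "k * w y - b y \<le> 0" if "y \<in> frontier D" for y
      using wb[of y] fr[OF that] k by (auto simp: abs_le_iff)
    fix y assume "y \<in> D"
    then have yD: "y \<in> \<Omega>" "y + v \<in> \<Omega>" by (auto simp: D_def)
    have lq: "has_lap q y ((1 / \<sigma>\<^sup>2) * (2 * DIM(real ^ 'n)) + (N + 1) * ((1 / \<sigma>) * 0 - (1 / \<sigma>\<^sup>2) * (2 * (norm \<nu>)\<^sup>2)) + 0)"
    proof -
      have "has_lap (\<lambda>y. (1 / \<sigma>\<^sup>2) * (norm (y - p))\<^sup>2 + (N + 1) * ((1 / \<sigma>) * ((y - p) \<bullet> \<nu>) - (1 / \<sigma>\<^sup>2) * ((y - p) \<bullet> \<nu>)\<^sup>2) + (N + 1) * (\<sigma> / r)) y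
          ((1 / \<sigma>\<^sup>2) * (2 * DIM(real ^ 'n)) + (N + 1) * ((1 / \<sigma>) * 0 - (1 / \<sigma>\<^sup>2) * (2 * (norm \<nu>)\<^sup>2)) + 0)"
        by (intro has_lap_add has_lap_cmult has_lap_diff has_lap_const has_lap_height has_lap_height_square
            has_lap_norm_square)
      then show ?thesis by (simp add: q_def[abs_def])
    qed
    have lw: "has_lap w y (real CARD('n) - real CARD('n))"
      unfolding w_def[abs_def]
      by (intro has_lap_diff has_lap_translate TD(10) yD)
    have "has_lap (\<lambda>y. k * w y - b y) y (k * (real CARD('n) - real CARD('n)) - (0 + M * ((1 / \<sigma>\<^sup>2) * (2 * DIM(real ^ 'n)) +
        (N + 1) * ((1 / \<sigma>) * 0 - (1 / \<sigma>\<^sup>2) * (2 * (norm \<nu>)\<^sup>2)) + 0)))"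
      unfolding b_def[abs_def] by (intro has_lap_add has_lap_cmult has_lap_diff has_lap_const lw lq)
    moreover have "k * (real CARD('n) - real CARD('n)) - (0 + M * ((1 / \<sigma>\<^sup>2) * (2 * DIM(real ^ 'n)) +
        (N + 1) * ((1 / \<sigma>) * 0 - (1 / \<sigma>\<^sup>2) * (2 * (norm \<nu>)\<^sup>2)) + 0)) = 2 * M / \<sigma>\<^sup>2"
      using nn \<sigma> by (simp add: N_def field_simps)
    moreover have "0 < 2 * M / \<sigma>\<^sup>2" using M \<sigma> by simp
    ultimately show "\<exists>L>0. has_lap (\<lambda>y. k * w y - b y) y L" by metis
  qed
  have xF: "x \<in> F" using x R by (simp add: F_def)
  have "\<bar>w x\<bar> \<le> b x"
  proof (cases "x \<in> \<Omega> \<and> x + v \<in> \<Omega>")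
    case True
    then have "x \<in> closure D" using x(3) R(2) closure_subset[of D] by (auto simp: D_def)
    from main[of 1, OF _ this] main[of "- 1", OF _ this] show ?thesis by (simp add: abs_le_iff)
  next
    case False
    then have "x \<in> frontier \<Omega> \<or> x + v \<in> frontier \<Omega>" using x TD(1) by (auto simp: frontier_def interior_open)
    then show ?thesis using wb[OF xF] by blast
  qed
  also have "b x \<le> K + M * (R\<^sup>2 / \<sigma>\<^sup>2 + (N + 1) * (R / \<sigma>) + (N + 1) * (\<sigma> / r))"
  proof -
    have "(y::real) - z \<le> y" if "0 \<le> z" for y z using that by simp
    have "(x - p) \<bullet> \<nu> \<le> norm (x - p) * norm \<nu>" by (rule norm_cauchy_schwarz)
    then have "(x - p) \<bullet> \<nu> \<le> R" using x(3) nn by simp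
    then have "(x - p) \<bullet> \<nu> / \<sigma> \<le> R / \<sigma>" using \<sigma> by (simp add: divide_right_mono)
    moreover have "0 \<le> ((x - p) \<bullet> \<nu>)\<^sup>2 / \<sigma>\<^sup>2" by simp
    ultimately have "(x - p) \<bullet> \<nu> / \<sigma> - ((x - p) \<bullet> \<nu>)\<^sup>2 / \<sigma>\<^sup>2 \<le> R / \<sigma>" by linarith
    moreover have "(norm (x - p))\<^sup>2 / \<sigma>\<^sup>2 \<le> R\<^sup>2 / \<sigma>\<^sup>2" using x(3) by (intro divide_right_mono power_mono) auto
    ultimately have "q x \<le> R\<^sup>2 / \<sigma>\<^sup>2 + (N + 1) * (R / \<sigma>) + (N + 1) * (\<sigma> / r)"
      unfolding q_def using N by (intro add_mono mult_left_mono order_refl) auto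
    then show ?thesis unfolding b_def using M by simp
  qed
  finally show ?thesis by (simp add: w_def K_def M_def N_def t_def mult_ac)
qed

text \<open>For an outer radius proportional to \<open>R powr \<beta>\<close> the two competing
  terms are of order \<open>R powr \<beta>\<close> and
  \<open>R powr (\<alpha> * \<beta> + 1 - \<beta>)\<close>. They agree when \<beta> times
  \<open>2 - \<alpha>\<close> is 1.\<close>

lemma tang_step:
  assumes r: "0 < r" and \<alpha>: "0 \<le> \<alpha>" "\<alpha> < 1" and C: "0 < C"
  obtains C' where "0 < C'"
    "\<And>(\<Omega> :: (real ^ 'n) set) u. torsion_domain r d \<Omega> u \<Longrightarrow> tang \<alpha> C r \<Omega> u \<Longrightarrow> tang (1 / (2 - \<alpha>)) C' r \<Omega> u"
proof -
  obtain L where L: "0 < L"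
    "\<And>(\<Omega> :: (real ^ 'n) set) u x y. \<lbrakk>torsion_domain r d \<Omega> u; x \<in> closure \<Omega>; y \<in> closure \<Omega>\<rbrakk>
       \<Longrightarrow> \<bar>u x - u y\<bar> \<le> L * norm (x - y)"
    using torsion_gradient_bound[OF r, where 'n = 'n and d = d] by metis
  obtain G where G: "0 < G"
    "\<And>(\<Omega> :: (real ^ 'n) set) u x p \<nu>. \<lbrakk>torsion_domain r d \<Omega> u; inner_normal \<Omega> r p \<nu>; p \<in> frontier \<Omega>; x \<in> closure \<Omega>\<rbrakk>
       \<Longrightarrow> \<bar>u x\<bar> \<le> G * (norm (x - (p - r *\<^sub>R \<nu>)) - r)"
    using torsion_boundary_growth[OF r, where 'n = 'n and d = d] by metis
  define N where "N = real CARD('n)"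
  have N: "0 < N" by (simp add: N_def)
  define \<beta> where "\<beta> = 1 / (2 - \<alpha>)"
  have \<beta>: "0 < \<beta>" "\<beta> \<le> 1" "\<alpha> * \<beta> + (1 - \<beta>) = \<beta>" using \<alpha> by (auto simp: \<beta>_def field_simps)
  \<comment> \<open>Below \<open>R0\<close> the outer radius \<open>2 * P\<close> does not exceed
    \<open>r\<close> and all powers of \<open>R\<close> are at most 1; above it the Lipschitz bound
    is already of the desired form.\<close>
  define R0 where "R0 = min 1 ((r / 2) powr (2 - \<alpha>))"
  have R0: "0 < R0" "R0 \<le> 1" using r by (auto simp: R0_def)
  define A where "A = 6 * G / r + 4 * C * (N + 2) + 8 * C * (N + 1) / r"
  have A: "0 < A" using G r C N by (simp add: A_def add_pos_nonneg)
  define C' where "C' = L / R0 powr \<beta> + A"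
  have main: "tang \<beta> C' r \<Omega> u" if T: "torsion_domain r d \<Omega> u" and tang: "tang \<alpha> C r \<Omega> u"
    for \<Omega> :: "(real ^ 'n) set" and u
    unfolding tang_def
  proof (intro allI impI)
    fix p \<nu> R x v
    assume p: "p \<in> frontier \<Omega>" "inner_normal \<Omega> r p \<nu>" and R: "0 < R" and v: "v \<bullet> \<nu> = 0"
      and x: "x \<in> closure \<Omega>" "x + v \<in> closure \<Omega>" "norm (x - p) \<le> R" "norm (x + v - p) \<le> R"
    define P where "P = R powr \<beta>"
    have P: "0 < P" using R by (simp add: P_def)
    show "\<bar>u (x + v) - u x\<bar> \<le> C' * norm v * R powr \<beta>"
    proof (cases "R0 \<le> R")
      case True
      have "R0 powr \<beta> \<le> P" unfolding P_def using True R0 \<beta> by (intro powr_mono2) auto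
      then have "1 \<le> P / R0 powr \<beta>" using R0 by simp
      have "\<bar>u (x + v) - u x\<bar> \<le> L * norm v * 1" using L(2)[OF T x(2,1)] by simp
      also have "\<dots> \<le> L * norm v * (P / R0 powr \<beta>)"
        using L(1) \<open>1 \<le> P / R0 powr \<beta>\<close> by (intro mult_left_mono) auto
      also have "\<dots> = L / R0 powr \<beta> * norm v * P" by simp
      also have "\<dots> \<le> C' * norm v * P"
        unfolding C'_def using A P by (intro mult_right_mono) auto
      finally show ?thesis by (simp add: P_def)
    next
      case False
      then have R1: "R < 1" "R < (r / 2) powr (2 - \<alpha>)" using R0 by (auto simp: R0_def)
      have RP: "R \<le> P" unfolding P_def using powr_mono'[of \<beta> 1 R] \<beta> R R1 by simp
      have P1: "P \<le> 1" unfolding P_def using R R1 \<beta> by (simp add: powr_le1)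
      have "P \<le> ((r / 2) powr (2 - \<alpha>)) powr \<beta>" unfolding P_def using R R1 \<beta> by (intro powr_mono2) auto
      also have "\<dots> = r / 2" using r \<alpha> by (simp add: powr_powr \<beta>_def)
      finally have Pr: "2 * P \<le> r" by simp
      have nv: "norm v \<le> 2 * P"
      proof -
        have "norm v \<le> norm (x + v - p) + norm (x - p)" using norm_triangle_ineq4[of "x + v - p" "x - p"] by simp
        then show ?thesis using x RP by simp
      qed
      have st: "\<bar>u (x + v) - u x\<bar> \<le> 3 * G / r * norm v * (2 * P) +
          C * norm v * (2 * (2 * P)) powr \<alpha> * (R\<^sup>2 / (2 * P)\<^sup>2 + (N + 1) * (R / (2 * P)) + (N + 1) * (2 * P / r))"
        unfolding N_def
        by (rule tang_step_small[OF T G(1) G(2)[OF T] C tang p R _ Pr v nv x(1,2,3)]) (use RP P in auto)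
      define \<kappa> where "\<kappa> = R / P"
      have \<kappa>: "0 \<le> \<kappa>" "\<kappa> \<le> 1" using R RP P by (auto simp: \<kappa>_def)
      have e1: "R\<^sup>2 / (2 * P)\<^sup>2 \<le> \<kappa>"
      proof -
        have "R\<^sup>2 / (2 * P)\<^sup>2 = (\<kappa> * \<kappa>) / 4" using P by (simp add: \<kappa>_def power2_eq_square)
        also have "\<kappa> * \<kappa> \<le> 1 * \<kappa>" using \<kappa> by (intro mult_right_mono) auto
        finally show ?thesis using \<kappa> by simp
      qed
      have e2: "R / (2 * P) \<le> \<kappa>"
        using \<kappa> by (simp add: \<kappa>_def)
      have e3: "(2 * (2 * P)) powr \<alpha> \<le> 4 * P powr \<alpha>"
      proof -
        have "(2 * (2 * P)) powr \<alpha> = 4 powr \<alpha> * P powr \<alpha>" using P by (simp add: powr_mult[symmetric])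
        also have "(4::real) powr \<alpha> \<le> 4 powr 1" using \<alpha> by (intro powr_mono) auto
        finally show ?thesis by (simp add: mult_right_mono)
      qed
      have e4: "P powr \<alpha> * \<kappa> = P"
      proof -
        have "\<kappa> = R powr (1 - \<beta>)" using R by (simp add: \<kappa>_def P_def powr_diff)
        then have "P powr \<alpha> * \<kappa> = R powr (\<alpha> * \<beta> + (1 - \<beta>))"
          by (simp add: P_def powr_powr powr_add mult.commute)
        then show ?thesis by (simp add: \<beta>(3) P_def)
      qed
      have e5: "P powr \<alpha> * P \<le> P"
      proof -
        have "P powr \<alpha> \<le> 1" using P P1 \<alpha> by (simp add: powr_le1)
        then show ?thesis using P by (simp add: mult_le_cancel_right1)
      qed
      have "C * norm v * (2 * (2 * P)) powr \<alpha> * (R\<^sup>2 / (2 * P)\<^sup>2 + (N + 1) * (R / (2 * P)) + (N + 1) * (2 * P / r)) \<le>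
          C * norm v * (4 * P powr \<alpha>) * (\<kappa> + (N + 1) * \<kappa> + (N + 1) * (2 * P / r))"
        using C N P r R e1 e2 e3 by (intro mult_mono add_mono mult_left_mono order_refl) auto
      also have "\<dots> = C * norm v * (4 * (N + 2) * (P powr \<alpha> * \<kappa>) + 8 * (N + 1) / r * (P powr \<alpha> * P))"
        by (simp add: algebra_simps)
      also have "\<dots> \<le> C * norm v * (4 * (N + 2) * P + 8 * (N + 1) / r * P)"
        unfolding e4 using C N r e5 by (intro mult_left_mono add_mono order_refl) auto
      finally have "\<bar>u (x + v) - u x\<bar> \<le> 3 * G / r * norm v * (2 * P) + C * norm v * (4 * (N + 2) * P + 8 * (N + 1) / r * P)"
        using st by linarith
      also have "\<dots> = A * norm v * P" by (simp add: A_def algebra_simps)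
      also have "\<dots> \<le> C' * norm v * P"
        unfolding C'_def using L P by (intro mult_right_mono) auto
      finally show ?thesis by (simp add: P_def)
    qed
  qed
  have "0 < C'" using A L by (simp add: C'_def add_nonneg_pos)
  then show ?thesis by (rule that) (use main in \<open>simp add: \<beta>_def\<close>)
qed

text \<open>The Lipschitz bound is the case of exponent 0, and two improvements lead through 1/2 to
  2/3. One improvement would not do: the exponent \<alpha> yields a Hessian bound of order
  \<open>\<alpha> - 1\<close> in the distance to the boundary, and its square is integrable only for
  \<alpha> above 1/2.\<close>

lemma torsion_tangential:
  assumes r: "0 < r"
  obtains C where "0 < C" "\<And>(\<Omega> :: (real ^ 'n) set) u. torsion_domain r d \<Omega> u \<Longrightarrow> tang (2 / 3) C r \<Omega> u"
proof -
  obtain L where L: "0 < L"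
    "\<And>(\<Omega> :: (real ^ 'n) set) u x y. \<lbrakk>torsion_domain r d \<Omega> u; x \<in> closure \<Omega>; y \<in> closure \<Omega>\<rbrakk>
       \<Longrightarrow> \<bar>u x - u y\<bar> \<le> L * norm (x - y)"
    using torsion_gradient_bound[OF r, where 'n = 'n and d = d] by metis
  have 0: "tang 0 L r \<Omega> u" if "torsion_domain r d \<Omega> u" for \<Omega> :: "(real ^ 'n) set" and u
    unfolding tang_def
  proof (intro allI impI)
    fix p \<nu> and R :: real and x v
    assume "0 < R" "x \<in> closure \<Omega>" "x + v \<in> closure \<Omega>"
    then show "\<bar>u (x + v) - u x\<bar> \<le> L * norm v * R powr 0"
      using L(2)[OF that, of "x + v" x] by simp
  qed
  obtain C1 where C1: "0 < C1" "\<And>(\<Omega> :: (real ^ 'n) set) u. torsion_domain r d \<Omega> u \<Longrightarrow> tang 0 L r \<Omega> u \<Longrightarrow> tang (1 / (2 - 0)) C1 r \<Omega> u"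
    using tang_step[OF r order_refl zero_less_one L(1), where 'n = 'n and d = d] by metis
  obtain C2 where C2: "0 < C2" "\<And>(\<Omega> :: (real ^ 'n) set) u. torsion_domain r d \<Omega> u \<Longrightarrow> tang (1 / (2 - 0)) C1 r \<Omega> u \<Longrightarrow> tang (1 / (2 - 1 / (2 - 0))) C2 r \<Omega> u"
    using tang_step[OF r _ _ C1(1), of "1 / (2 - 0)", where 'n = 'n and d = d] by (auto 4 3)
  have "1 / (2 - 1 / (2 - 0)) = (2 / 3 :: real)" by simp
  with C2 C1(2) 0 show ?thesis by (intro that[of C2]) metis+
qed

section \<open>Pointwise Hessian bound near the boundary\<close>

lemma abs_derivative_le:
  fixes f :: "real \<Rightarrow> real"
  assumes "(f has_real_derivative D) (at 0)" "0 < \<epsilon>" "\<And>s. 0 < s \<Longrightarrow> s < \<epsilon> \<Longrightarrow> \<bar>f s - f 0\<bar> \<le> K * s"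
  shows "\<bar>D\<bar> \<le> K"
proof -
  have "((\<lambda>h. (f (0 + h) - f 0) / h) \<longlongrightarrow> D) (at 0)" using assms(1) unfolding DERIV_def .
  then have "((\<lambda>h. (f h - f 0) / h) \<longlongrightarrow> D) (at_right 0)" by (simp add: filterlim_at_split)
  then have "((\<lambda>h. \<bar>(f h - f 0) / h\<bar>) \<longlongrightarrow> \<bar>D\<bar>) (at_right 0)" by (rule tendsto_rabs)
  moreover have "\<forall>\<^sub>F h in at_right 0. \<bar>(f h - f 0) / h\<bar> \<le> K"
    unfolding eventually_at_right_field
  proof (intro exI[of _ \<epsilon>] conjI assms(2) allI impI)
    fix h assume h: "(0::real) < h" "h < \<epsilon>"
    then show "\<bar>(f h - f 0) / h\<bar> \<le> K" using assms(3)[OF h] by (simp add: abs_divide pos_divide_le_eq)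
  qed
  ultimately show ?thesis by (rule tendsto_upperbound) simp
qed

lemma partial_deriv_sum:
  fixes g :: "'i \<Rightarrow> real ^ 'n::finite \<Rightarrow> real"
  assumes "\<And>k. k \<in> A \<Longrightarrow> g k differentiable (at y)"
  shows "(\<lambda>y. \<Sum>k\<in>A. c k * g k y) differentiable (at y)"
    and "partial_deriv j (\<lambda>y. \<Sum>k\<in>A. c k * g k y) y = (\<Sum>k\<in>A. c k * partial_deriv j (g k) y)"
proof -
  have *: "((\<lambda>y. \<Sum>k\<in>A. c k * g k y) has_derivative (\<lambda>v. \<Sum>k\<in>A. c k * frechet_derivative (g k) (at y) v)) (at y)"
    by (intro has_derivative_sum has_derivative_mult_right) (use assms frechet_derivative_works in blast)
  then show "(\<lambda>y. \<Sum>k\<in>A. c k * g k y) differentiable (at y)" by (rule differentiableI)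
  show "partial_deriv j (\<lambda>y. \<Sum>k\<in>A. c k * g k y) y = (\<Sum>k\<in>A. c k * partial_deriv j (g k) y)"
    using partial_deriv_eq[OF *, of j] by (simp add: partial_deriv_def)
qed

text \<open>The rows have small tangential parts by hypothesis, and the columns by symmetry, so up
  to a small error the matrix is a multiple \<open>s\<close> of the projection onto \<nu>. That
  projection has trace 1, hence the vanishing trace makes \<open>s\<close> small.\<close>

lemma traceless_rank_one_bound:
  fixes H :: "'n::finite \<Rightarrow> 'n \<Rightarrow> real" and \<nu> :: "real ^ 'n"
  assumes \<nu>: "norm \<nu> = 1" and sym: "\<And>i j. H i j = H j i" and tr: "(\<Sum>i\<in>UNIV. H i i) = 0"
    and Q: "\<And>i j. \<bar>H j i - \<nu> $ i * (\<Sum>k\<in>UNIV. \<nu> $ k * H j k)\<bar> \<le> Q"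
  shows "\<bar>H j i\<bar> \<le> (real CARD('n) + 1)\<^sup>2 * Q"
proof -
  define N where "N = real CARD('n)"
  define a where "a j = (\<Sum>k\<in>UNIV. \<nu> $ k * H j k)" for j
  define s where "s = (\<Sum>j\<in>UNIV. \<nu> $ j * a j)"
  have Q': "\<bar>H j i - \<nu> $ i * a j\<bar> \<le> Q" for i j using Q by (simp add: a_def)
  have \<nu>1: "\<bar>\<nu> $ i\<bar> \<le> 1" for i using component_le_norm_cart[of \<nu> i] \<nu> by simp
  have \<nu>2: "(\<Sum>i\<in>UNIV. \<nu> $ i * \<nu> $ i) = 1"
    using \<nu> by (simp add: norm_eq_1 inner_vec_def)
  have Q0: "0 \<le> Q" using Q'[of i i] by (meson abs_ge_zero order_trans)
  have a: "\<bar>a i - \<nu> $ i * s\<bar> \<le> N * Q" for i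
  proof -
    have "(\<Sum>j\<in>UNIV. \<nu> $ j * (H j i - \<nu> $ i * a j)) = (\<Sum>j\<in>UNIV. \<nu> $ j * H j i) - \<nu> $ i * s"
      by (simp add: s_def right_diff_distrib sum_subtractf sum_distrib_left mult_ac)
    also have "(\<Sum>j\<in>UNIV. \<nu> $ j * H j i) = a i" unfolding a_def by (intro sum.cong refl) (simp add: sym[of _ i])
    finally show ?thesis
      using line_sum_bound[of "\<lambda>j. H j i - \<nu> $ i * a j" Q \<nu>] Q' \<nu> by (simp add: N_def)
  qed
  have H: "\<bar>H j i - \<nu> $ i * \<nu> $ j * s\<bar> \<le> (N + 1) * Q" for i j
  proof -
    have "\<bar>\<nu> $ i * (a j - \<nu> $ j * s)\<bar> \<le> 1 * (N * Q)"
      unfolding abs_mult using \<nu>1 a by (intro mult_mono) auto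
    moreover have "H j i - \<nu> $ i * \<nu> $ j * s = (H j i - \<nu> $ i * a j) + \<nu> $ i * (a j - \<nu> $ j * s)"
      by (simp add: algebra_simps)
    moreover have "(N + 1) * Q = N * Q + Q" by (simp add: algebra_simps)
    ultimately show ?thesis using Q'[of j i] by linarith
  qed
  have s: "\<bar>s\<bar> \<le> N * ((N + 1) * Q)"
  proof -
    have "(\<Sum>i\<in>UNIV. H i i - \<nu> $ i * \<nu> $ i * s) = - s"
      using tr \<nu>2 by (simp add: sum_subtractf sum_distrib_right[symmetric])
    then have "\<bar>s\<bar> = \<bar>\<Sum>i\<in>UNIV. H i i - \<nu> $ i * \<nu> $ i * s\<bar>" by simp
    also have "\<dots> \<le> (\<Sum>i\<in>(UNIV::'n set). (N + 1) * Q)"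
      by (rule order_trans[OF sum_abs], rule sum_mono) (rule H)
    finally show ?thesis by (simp add: N_def)
  qed
  have "\<bar>\<nu> $ i * \<nu> $ j * s\<bar> \<le> 1 * 1 * (N * ((N + 1) * Q))"
    unfolding abs_mult using \<nu>1 s by (intro mult_mono) auto
  then have "\<bar>H j i\<bar> \<le> (N + 1) * Q + N * ((N + 1) * Q)"
    using H[of j i] by linarith
  also have "\<dots> = (N + 1)\<^sup>2 * Q" by (simp add: power2_eq_square algebra_simps)
  finally show ?thesis by (simp add: N_def)
qed

text \<open>A derivative of the comparison function in a direction tangential at the nearest
  boundary point is harmonic and of order \<open>R powr (2 / 3)\<close> on the inner ball of radius
  \<open>R\<close>; the gradient estimate divides by \<open>R\<close>. The purely normal entry
  follows from the trace.\<close>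

lemma torsion_hessian_bound:
  assumes r: "0 < r"
  obtains C where "0 \<le> C"
    "\<And>(\<Omega> :: (real ^ 'n) set) u z a x i j. \<lbrakk>torsion_domain r d \<Omega> u; x \<in> \<Omega>\<rbrakk> \<Longrightarrow>
       \<bar>partial_deriv j (partial_deriv i (comparison_fun u z a)) x\<bar> \<le> C * infdist x (frontier \<Omega>) powr (- 1 / 3)"
proof -
  obtain Ct where Ct: "0 < Ct" "\<And>(\<Omega> :: (real ^ 'n) set) u. torsion_domain r d \<Omega> u \<Longrightarrow> tang (2 / 3) Ct r \<Omega> u"
    using torsion_tangential[OF r, where 'n = 'n and d = d] by metis
  define cE where "cE = 6 * measure lborel (cball (0 :: real ^ 'n) 1) / kern_mass TYPE(real ^ 'n)"
  have cE: "0 \<le> cE" using kern_mass_pos[where 'a = "real ^ 'n"] by (simp add: cE_def)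
  define A where "A = 2 * \<bar>d\<bar> powr (1 / 3) + 2 * Ct * 2 powr (2 / 3)"
  have A: "0 \<le> A" using Ct by (simp add: A_def)
  define C where "C = (real CARD('n) + 1)\<^sup>2 * (cE * (2 * A))"
  have main: "\<bar>partial_deriv j (partial_deriv i (comparison_fun u z a)) x\<bar> \<le> C * infdist x (frontier \<Omega>) powr (- 1 / 3)"
    if T: "torsion_domain r d \<Omega> u" and x: "x \<in> \<Omega>" for \<Omega> :: "(real ^ 'n) set" and u z a x i j
  proof -
    note TD = torsion_domainD[OF T]
    note h = torsion_comparison_harmonic[OF T]
    \<comment> \<open>The Hessian does not depend on \<open>z\<close> and \<open>a\<close>, so the
      quadratic may be centred at \<open>x\<close>, where its first derivatives are at most of order
      \<open>R\<close> on the ball.\<close>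
    let ?h = "comparison_fun u x 0"
    obtain p where p: "p \<in> frontier \<Omega>" "dist x p = infdist x (frontier \<Omega>)"
      using nearest_boundary_point[OF TD(3,4)] by blast
    obtain \<nu> where \<nu>: "inner_normal \<Omega> r p \<nu>" using TD(13)[OF p(1)] by blast
    have nn: "norm \<nu> = 1" using \<nu> by (simp add: inner_normal_def)
    define R where "R = infdist x (frontier \<Omega>)"
    have R: "0 < R" using infdist_frontier_pos[OF TD(1,3) x] by (simp add: R_def)
    have bR: "ball x R \<subseteq> \<Omega>" using ball_infdist_frontier_subset[OF TD(1) x] by (simp add: R_def)
    have Rd: "R \<le> d" using TD(12)[OF _ TD(14)[OF p(1)], of x] x closure_subset[of \<Omega>] p(2) by (auto simp: R_def dist_norm)
    define H where "H j k = partial_deriv j (partial_deriv k ?h) x" for j k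
    define Q where "Q = cE * (2 * A) * R powr (- 1 / 3)"
    have "\<bar>H j i - \<nu> $ i * (\<Sum>k\<in>UNIV. \<nu> $ k * H j k)\<bar> \<le> Q" for i j
    proof -
      \<comment> \<open>The projection of the coordinate vector to the tangent plane at
        \<open>p\<close>.\<close>
      define e where "e = axis i 1 - (\<nu> $ i) *\<^sub>R \<nu>"
      have e0: "e \<bullet> \<nu> = 0" using nn by (simp add: e_def inner_diff_left inner_axis' norm_eq_1)
      have "norm e \<le> norm (axis i (1::real)) + norm ((\<nu> $ i) *\<^sub>R \<nu>)" unfolding e_def by (rule norm_triangle_ineq4)
      then have e2: "norm e \<le> 2" using component_le_norm_cart[of \<nu> i] nn by simp
      define f where "f y = (\<Sum>k\<in>UNIV. e $ k * partial_deriv k ?h y)" for y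
      have fd: "f differentiable (at y)" "partial_deriv j f y = (\<Sum>k\<in>UNIV. e $ k * partial_deriv j (partial_deriv k ?h) y)"
        if "y \<in> \<Omega>" for y
        unfolding f_def[abs_def] using partial_deriv_sum[of UNIV "\<lambda>k. partial_deriv k ?h" y] C2_onD(2)[OF h(1) that] by auto
      have fmv: "mv \<Omega> f" unfolding f_def[abs_def] by (rule mv_sum) (rule h(4), rule h(6))
      have fc: "continuous_on \<Omega> (partial_deriv j f)"
      proof (rule continuous_on_eq)
        show "continuous_on \<Omega> (\<lambda>y. \<Sum>k\<in>UNIV. e $ k * partial_deriv j (partial_deriv k ?h) y)"
          by (intro continuous_intros h(7))
      qed (simp add: fd)
      have fb: "\<bar>f y\<bar> \<le> A * R powr (2 / 3)" if y: "y \<in> ball x R" for y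
      proof -
        have y\<Omega>: "y \<in> \<Omega>" using y bR by blast
        have yx: "norm (y - x) \<le> R" using y by (simp add: dist_norm norm_minus_commute)
        define D where "D = (\<Sum>k\<in>UNIV. e $ k * partial_deriv k u y)"
        have D: "\<bar>D\<bar> \<le> Ct * 2 * (2 * R) powr (2 / 3)"
        proof -
          have der: "((\<lambda>s. u (y + s *\<^sub>R e)) has_real_derivative D) (at 0)"
            using has_real_derivative_along_line[of u y 0 e] C2_onD(1)[OF TD(8) y\<Omega>] by (simp add: D_def)
          define \<epsilon> where "\<epsilon> = (R - norm (y - x)) / 2"
          have \<epsilon>: "0 < \<epsilon>" using y by (simp add: \<epsilon>_def dist_norm norm_minus_commute)
          have "\<bar>u (y + s *\<^sub>R e) - u (y + 0 *\<^sub>R e)\<bar> \<le> Ct * 2 * (2 * R) powr (2 / 3) * s" if s: "0 < s" "s < \<epsilon>" for s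
          proof -
            have "norm (s *\<^sub>R e) \<le> s * 2" using s e2 by simp
            moreover have "norm (y + s *\<^sub>R e - x) \<le> norm (y - x) + norm (s *\<^sub>R e)"
              using norm_triangle_ineq[of "y - x" "s *\<^sub>R e"] by (simp add: algebra_simps)
            moreover have "2 * s < R - norm (y - x)" using s by (simp add: \<epsilon>_def)
            ultimately have ys: "norm (y + s *\<^sub>R e - x) < R" by linarith
            then have "y + s *\<^sub>R e \<in> ball x R" by (simp add: dist_norm norm_minus_commute)
            then have c: "y \<in> closure \<Omega>" "y + s *\<^sub>R e \<in> closure \<Omega>" using bR y\<Omega> closure_subset[of \<Omega>] by auto
            have "norm (w - p) \<le> 2 * R" if "norm (w - x) \<le> R" for w
              using norm_triangle_ineq[of "w - x" "x - p"] that p(2) by (simp add: R_def dist_norm)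
            then have d: "norm (y - p) \<le> 2 * R" "norm (y + s *\<^sub>R e - p) \<le> 2 * R" using yx ys by auto
            have "\<bar>u (y + s *\<^sub>R e) - u y\<bar> \<le> Ct * norm (s *\<^sub>R e) * (2 * R) powr (2 / 3)"
              using Ct(2)[OF T, unfolded tang_def, rule_format, OF p(1) \<nu> _ _ c d] R e0 by simp
            also have "\<dots> \<le> Ct * (s * 2) * (2 * R) powr (2 / 3)"
              using Ct(1) s e2 by (intro mult_right_mono mult_left_mono) auto
            finally show ?thesis by (simp add: mult_ac)
          qed
          from abs_derivative_le[OF der \<epsilon>] this show ?thesis by simp
        qed
        have "f y = e \<bullet> (y - x) - D"
          using comparison_fun_partial_deriv[OF C2_onD(1)[OF TD(8) y\<Omega>], of _ x 0]
          by (simp add: f_def D_def inner_vec_def right_diff_distrib sum_subtractf)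
        moreover have "\<bar>e \<bullet> (y - x)\<bar> \<le> 2 * R"
          using Cauchy_Schwarz_ineq2[of e "y - x"] mult_mono[OF e2 yx] by simp
        moreover have "2 * R \<le> 2 * \<bar>d\<bar> powr (1 / 3) * R powr (2 / 3)"
        proof -
          have "R = R powr (1 / 3) * R powr (2 / 3)" using R by (simp add: powr_add[symmetric])
          also have "\<dots> \<le> \<bar>d\<bar> powr (1 / 3) * R powr (2 / 3)"
            using R Rd by (intro mult_right_mono powr_mono2) auto
          finally show ?thesis by simp
        qed
        moreover have "Ct * 2 * (2 * R) powr (2 / 3) = 2 * Ct * 2 powr (2 / 3) * R powr (2 / 3)"
          using R by (simp add: powr_mult)
        ultimately have "\<bar>f y\<bar> \<le> 2 * \<bar>d\<bar> powr (1 / 3) * R powr (2 / 3) + 2 * Ct * 2 powr (2 / 3) * R powr (2 / 3)"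
          using D by linarith
        then show ?thesis by (simp add: A_def distrib_right)
      qed
      have "\<bar>partial_deriv j f x\<bar> \<le> cE * (A * R powr (2 / 3) / (R / 2))"
        unfolding cE_def by (rule mv_gradient_bound[OF TD(1) fd(1) fc fmv bR _ _ fb]) (use R in auto)
      also have "\<dots> = Q"
      proof -
        have "R powr (2 / 3) / R = R powr (2 / 3 - 1)" using R powr_diff[of R "2 / 3" 1] by simp
        also have "(2 / 3 - 1 :: real) = - 1 / 3" by simp
        finally have e: "R powr (2 / 3) / R = R powr (- 1 / 3)" .
        have "cE * (A * R powr (2 / 3) / (R / 2)) = cE * (2 * A) * (R powr (2 / 3) / R)" by simp
        then show ?thesis unfolding e Q_def .
      qed
      also have "partial_deriv j f x = H j i - \<nu> $ i * (\<Sum>k\<in>UNIV. \<nu> $ k * H j k)"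
      proof -
        have "(\<Sum>k\<in>UNIV. e $ k * c k) = c i - \<nu> $ i * (\<Sum>k\<in>UNIV. \<nu> $ k * c k)" for c
        proof -
          have "(\<Sum>k\<in>UNIV. e $ k * c k) = (\<Sum>k\<in>UNIV. axis i 1 $ k * c k - \<nu> $ i * (\<nu> $ k * c k))"
            by (intro sum.cong refl) (simp add: e_def left_diff_distrib)
          then show ?thesis by (simp only: sum_subtractf sum_distrib_left[symmetric] sum_axis_mult)
        qed
        then show ?thesis unfolding fd(2)[OF x] H_def .
      qed
      finally show ?thesis .
    qed
    moreover have "H i j = H j i" for i j
      unfolding H_def by (rule hessian_symmetric_harmonic[OF TD(1) h(1,2) x])
    moreover have "(\<Sum>i\<in>UNIV. H i i) = 0" using h(2)[OF x] by (simp add: laplacian_def H_def)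
    ultimately have "\<bar>H j i\<bar> \<le> (real CARD('n) + 1)\<^sup>2 * Q"
      using traceless_rank_one_bound[OF nn] by blast
    moreover have "H j i = partial_deriv j (partial_deriv i (comparison_fun u z a)) x"
      by (simp add: H_def comparison_fun_second_derivative(2)[OF TD(1,8) x])
    ultimately show ?thesis by (simp add: C_def Q_def R_def mult_ac)
  qed
  have "0 \<le> C" using cE A by (simp add: C_def)
  then show ?thesis by (rule that) (rule main)
qed

subsection \<open>Square integrability of the Hessian\<close>

lemma torsion_negative:
  assumes T: "torsion_domain r d \<Omega> u" and x: "x \<in> \<Omega>"
  shows "u x < 0"
proof -
  obtain s where s: "0 < s" "ball x s \<subseteq> \<Omega>" using torsion_domainD(1)[OF T] x by (meson openE)
  have "u x \<le> 1 / 4 * (0 - s\<^sup>2)" using torsion_upper_in_ball[OF T s(2,1), of x] s by simp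
  also have "\<dots> < 0" using s by simp
  finally show ?thesis .
qed

text \<open>Linear growth of \<open>- u\<close> gives a point on the normal between the boundary and
  \<open>x\<close> with normal derivative at most \<open>- (r / 4)\<close>. The Hessian bound with
  exponent -1/3 is integrable along the normal, so close to the boundary at least half of this slope
  survives up to \<open>x\<close>.\<close>

lemma torsion_gradient_lower_bound:
  assumes r: "0 < r"
  obtains t0 c0 where "0 < t0" "0 < c0"
    "\<And>(\<Omega> :: (real ^ 'n) set) u x. \<lbrakk>torsion_domain r d \<Omega> u; x \<in> \<Omega>; infdist x (frontier \<Omega>) \<le> t0\<rbrakk>
       \<Longrightarrow> c0 \<le> (\<Sum>i\<in>UNIV. (partial_deriv i u x)\<^sup>2)"
proof -
  obtain C where C: "0 \<le> C"
    "\<And>(\<Omega> :: (real ^ 'n) set) u z a x i j. \<lbrakk>torsion_domain r d \<Omega> u; x \<in> \<Omega>\<rbrakk> \<Longrightarrow>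
       \<bar>partial_deriv j (partial_deriv i (comparison_fun u z a)) x\<bar> \<le> C * infdist x (frontier \<Omega>) powr (- 1 / 3)"
    using torsion_hessian_bound[OF r, where 'n = 'n and d = d] by metis
  define N where "N = real CARD('n)"
  have N: "0 < N" by (simp add: N_def)
  define C3 where "C3 = N * (N * (r powr (1 / 3) + C))"
  have C3: "0 \<le> C3" using C N by (simp add: C3_def)
  \<comment> \<open>Chosen so that the change of slope \<open>3 / 2 * C3 * t powr (2 / 3)\<close> is
    at most \<open>r / 8\<close>; the summand 1 keeps the quotient defined when \<open>C3\<close> is
    zero.\<close>
  define t0 where "t0 = min r ((r / (12 * (C3 + 1))) powr (3 / 2))"
  have t0: "0 < t0" using r C3 by (simp add: t0_def)
  have main: "(r / 8)\<^sup>2 \<le> (\<Sum>i\<in>UNIV. (partial_deriv i u x)\<^sup>2)"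
    if T: "torsion_domain r d \<Omega> u" and x: "x \<in> \<Omega>" and xt: "infdist x (frontier \<Omega>) \<le> t0"
    for \<Omega> :: "(real ^ 'n) set" and u x
  proof -
    note TD = torsion_domainD[OF T]
    obtain p where p: "p \<in> frontier \<Omega>" "dist x p = infdist x (frontier \<Omega>)"
      using nearest_boundary_point[OF TD(3,4)] by blast
    obtain \<nu> where \<nu>: "inner_normal \<Omega> r p \<nu>" using TD(13)[OF p(1)] by blast
    have n: "norm \<nu> = 1" using \<nu> by (simp add: inner_normal_def)
    define t where "t = infdist x (frontier \<Omega>)"
    have t: "0 < t" using infdist_frontier_pos[OF TD(1,3) x] by (simp add: t_def)
    have tr: "t \<le> r" "t \<le> (r / (12 * (C3 + 1))) powr (3 / 2)" using xt by (auto simp: t_def t0_def)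
    have xeq: "x = p + t *\<^sub>R \<nu>"
      using nearest_on_normal[OF \<nu> r t] p(2) ball_infdist_frontier_subset[OF TD(1) x] by (simp add: t_def)
    have bs: "ball (p + s *\<^sub>R \<nu>) s \<subseteq> \<Omega>" if "s \<le> r" for s
      using normal_ball_nested[OF n that, of p] \<nu> by (auto simp: inner_normal_def)
    have mem: "p + s *\<^sub>R \<nu> \<in> \<Omega>" if "0 < s" "s \<le> r" for s using bs[OF that(2)] that(1) by auto
    \<comment> \<open>The Hessian bound decreases with the distance to the frontier, so a lower
      bound for that distance is what is required.\<close>
    have dst: "s \<le> infdist (p + s *\<^sub>R \<nu>) (frontier \<Omega>)" if s: "0 < s" "s \<le> r" for s
    proof -
      obtain q where q: "q \<in> frontier \<Omega>" "dist (p + s *\<^sub>R \<nu>) q = infdist (p + s *\<^sub>R \<nu>) (frontier \<Omega>)"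
        using nearest_boundary_point[OF TD(3,4)] by blast
      have "q \<notin> \<Omega>" using q(1) TD(1) by (simp add: frontier_def interior_open)
      then have "q \<notin> ball (p + s *\<^sub>R \<nu>) s" using bs[OF s(2)] by blast
      then show ?thesis using q(2) by simp
    qed
    define f where "f s = u (p + s *\<^sub>R \<nu>)" for s
    define k where "k s = (\<Sum>i\<in>UNIV. \<nu> $ i * partial_deriv i u (p + s *\<^sub>R \<nu>))" for s
    define l where "l s = (\<Sum>i\<in>UNIV. \<nu> $ i * (\<Sum>j\<in>UNIV. \<nu> $ j * partial_deriv j (partial_deriv i u) (p + s *\<^sub>R \<nu>)))" for s
    have f: "(f has_real_derivative k s) (at s)" if s: "0 < s" "s \<le> r" for s
      unfolding f_def k_def by (rule has_real_derivative_along_line[OF C2_onD(1)[OF TD(8) mem[OF s]]])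
    have k: "(k has_real_derivative l s) (at s)" if s: "0 < s" "s \<le> r" for s
      unfolding k_def l_def
      by (intro DERIV_sum DERIV_cmult has_real_derivative_along_line C2_onD(2)[OF TD(8) mem[OF s]])
    have l: "\<bar>l s\<bar> \<le> C3 * s powr (- 1 / 3)" if s: "0 < s" "s \<le> r" for s
    proof -
      \<comment> \<open>The Hessian of \<open>u\<close> is the identity minus that of the comparison
        function. On \<open>(0, r]\<close> the identity is absorbed because
        \<open>r powr (1 / 3) * s powr (- 1 / 3)\<close> is at least 1.\<close>
      define M where "M = (r powr (1 / 3) + C) * s powr (- 1 / 3)"
      have "\<bar>partial_deriv j (partial_deriv i u) (p + s *\<^sub>R \<nu>)\<bar> \<le> M" for i j
      proof -
        define H where "H = partial_deriv j (partial_deriv i (comparison_fun u 0 0)) (p + s *\<^sub>R \<nu>)"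
        have "\<bar>H\<bar> \<le> C * infdist (p + s *\<^sub>R \<nu>) (frontier \<Omega>) powr (- 1 / 3)"
          unfolding H_def by (rule C(2)[OF T mem[OF s]])
        also have "\<dots> \<le> C * s powr (- 1 / 3)"
          using C(1) dst[OF s] s by (intro mult_left_mono powr_mono2') auto
        finally have "\<bar>H\<bar> \<le> C * s powr (- 1 / 3)" .
        moreover have "1 \<le> r powr (1 / 3) * s powr (- 1 / 3)"
        proof -
          have "1 = s powr (1 / 3) * s powr (- 1 / 3)" using s by (simp add: powr_add[symmetric])
          also have "\<dots> \<le> r powr (1 / 3) * s powr (- 1 / 3)"
            using s by (intro mult_right_mono powr_mono2) auto
          finally show ?thesis .
        qed
        moreover have "\<bar>partial_deriv j (partial_deriv i u) (p + s *\<^sub>R \<nu>)\<bar> \<le> 1 + \<bar>H\<bar>"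
          unfolding H_def comparison_fun_second_derivative(2)[OF TD(1,8) mem[OF s]] by (cases "i = j") auto
        ultimately show ?thesis unfolding M_def distrib_right by linarith
      qed
      then have "\<bar>\<Sum>j\<in>UNIV. \<nu> $ j * partial_deriv j (partial_deriv i u) (p + s *\<^sub>R \<nu>)\<bar> \<le> N * M" for i
        using line_sum_bound[of _ M \<nu>] n by (simp add: N_def)
      then have "\<bar>l s\<bar> \<le> N * (N * M)"
        using line_sum_bound[of _ "N * M" \<nu>] n by (simp add: N_def l_def)
      then show ?thesis by (simp add: C3_def M_def mult_ac)
    qed
    \<comment> \<open>At \<open>s = 0\<close> the normal meets the frontier, where \<open>u\<close>
      is only known to be continuous; the mean value theorem asks for no more at the
      endpoints.\<close>
    have "continuous_on {0..t} f"
      unfolding f_def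
    proof (rule continuous_on_compose2[OF TD(9)])
      show "continuous_on {0..t} (\<lambda>s. p + s *\<^sub>R \<nu>)" by (intro continuous_intros)
      have "p + s *\<^sub>R \<nu> \<in> closure \<Omega>" if "s \<in> {0..t}" for s
        using that mem[of s] tr(1) TD(14)[OF p(1)] closure_subset[of \<Omega>] by (cases "s = 0") auto
      then show "(\<lambda>s. p + s *\<^sub>R \<nu>) ` {0..t} \<subseteq> closure \<Omega>" by blast
    qed
    moreover have "f differentiable (at s)" if "0 < s" "s < t" for s
      using f[of s] that tr(1) by (auto simp: real_differentiable_def)
    ultimately obtain \<xi> k' where \<xi>: "0 < \<xi>" "\<xi> < t" "(f has_real_derivative k') (at \<xi>)" "f t - f 0 = (t - 0) * k'"
      using MVT[OF t, of f] by blast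
    have "k' = k \<xi>" using DERIV_unique[OF \<xi>(3) f[of \<xi>]] \<xi>(1,2) tr(1) by simp
    moreover have "f t \<le> - (r / 4 * t)" unfolding f_def by (rule torsion_interior_upper[OF T \<nu>]) (use t tr in auto)
    moreover have "f 0 = 0" using TD(11)[OF p(1)] by (simp add: f_def)
    ultimately have "t * k \<xi> \<le> t * (- (r / 4))" using \<xi>(4) by (simp add: mult_ac)
    then have k\<xi>: "k \<xi> \<le> - (r / 4)" using t by (simp only: mult_le_cancel_left_pos)
    define P where "P s = 3 / 2 * C3 * s powr (2 / 3)" for s
    have "\<bar>k t - k \<xi>\<bar> \<le> P t - P \<xi>"
    proof (rule abs_diff_le_of_derivative_bound[where F' = l and G' = "\<lambda>s. C3 * s powr (- 1 / 3)"])
      fix s assume "\<xi> \<le> s" "s \<le> t"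
      then have s: "0 < s" "s \<le> r" using \<xi>(1) tr(1) by auto
      show "(k has_real_derivative l s) (at s)" by (rule k[OF s])
      show "\<bar>l s\<bar> \<le> C3 * s powr (- 1 / 3)" by (rule l[OF s])
      have "((\<lambda>s. s powr (2 / 3)) has_real_derivative 2 / 3 * s powr (2 / 3 - 1)) (at s)"
        by (rule has_real_derivative_powr[OF s(1)])
      from DERIV_cmult[OF this, of "3 / 2 * C3"]
      show "(P has_real_derivative C3 * s powr (- 1 / 3)) (at s)" unfolding P_def by simp
    qed (use \<xi> in simp)
    also have "\<dots> \<le> P t" using C3 by (simp add: P_def)
    also have "P t \<le> r / 8"
    proof -
      have "t powr (2 / 3) \<le> ((r / (12 * (C3 + 1))) powr (3 / 2)) powr (2 / 3)"
        using t tr(2) by (intro powr_mono2) auto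
      also have "\<dots> = r / (12 * (C3 + 1))" using r C3 by (simp add: powr_powr)
      finally have "P t \<le> 3 / 2 * C3 * (r / (12 * (C3 + 1)))"
        unfolding P_def using C3 by (intro mult_left_mono) auto
      also have "\<dots> = r / 8 * (C3 / (C3 + 1))"
      proof -
        have "3 / 2 * C3 * (r / (12 * q)) = r / 8 * (C3 / q)" if "q \<noteq> 0" for q
          using that by (simp add: field_simps)
        from this[of "C3 + 1"] show ?thesis using C3 by linarith
      qed
      also have "\<dots> \<le> r / 8 * 1" using C3 r by (intro mult_left_mono) auto
      finally show ?thesis by simp
    qed
    finally have "k t \<le> - (r / 8)" using k\<xi> unfolding abs_le_iff by linarith
    then have "(r / 8)\<^sup>2 \<le> (- k t)\<^sup>2" using r by (intro power_mono) auto
    also have "\<dots> \<le> (\<Sum>i\<in>UNIV. (partial_deriv i u x)\<^sup>2)"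
    proof -
      define w :: "real ^ 'n" where "w = (\<chi> i. partial_deriv i u x)"
      have "k t = \<nu> \<bullet> w" by (simp add: k_def w_def inner_vec_def xeq)
      then have "(- k t)\<^sup>2 \<le> (norm w)\<^sup>2"
        using Cauchy_Schwarz_ineq[of \<nu> w] n by (simp add: norm_eq_1 power2_norm_eq_inner)
      also have "\<dots> = (\<Sum>i\<in>UNIV. (partial_deriv i u x)\<^sup>2)"
        unfolding power2_norm_eq_inner by (simp add: w_def inner_vec_def power2_eq_square)
      finally show ?thesis .
    qed
    finally show ?thesis .
  qed
  have "0 < (r / 8)\<^sup>2" using r by simp
  with t0 show ?thesis by (rule that) (rule main)
qed

text \<open>The weight \<open>cutoff \<epsilon>\<close> vanishes on \<open>(-\<infinity>, \<epsilon>]\<close>, so that \<open>cutoff \<epsilon> (- u) \<nabla>u\<close> has compact support; up to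
  constants it is an antiderivative of \<open>s\<^bsup>-2/3\<^esup>\<close> away from \<open>\<epsilon>\<close>.\<close>

definition cutoff :: "real \<Rightarrow> real \<Rightarrow> real" where
  "cutoff \<epsilon> s = (max 0 (s - \<epsilon>))\<^sup>2 * s powr (- 5 / 3)"

definition cutoff' :: "real \<Rightarrow> real \<Rightarrow> real" where
  "cutoff' \<epsilon> s = 2 * max 0 (s - \<epsilon>) * s powr (- 5 / 3) + (max 0 (s - \<epsilon>))\<^sup>2 * (- 5 / 3 * s powr (- 8 / 3))"

lemma cutoff_derivative:
  assumes "0 < s"
  shows "(cutoff \<epsilon> has_real_derivative cutoff' \<epsilon> s) (at s)"
proof -
  have 1: "((\<lambda>x. (max 0 x) ^ Suc 1) has_real_derivative real (Suc 1) * (max 0 (s - \<epsilon>)) ^ 1) (at (s - \<epsilon>))"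
    by (rule has_real_derivative_max_power) simp
  have 2: "((\<lambda>s. s - \<epsilon>) has_real_derivative 1) (at s)" by (auto intro!: derivative_eq_intros)
  have 3: "((\<lambda>s. (max 0 (s - \<epsilon>)) ^ Suc 1) has_real_derivative (real (Suc 1) * (max 0 (s - \<epsilon>)) ^ 1) * 1) (at s)"
    by (rule DERIV_chain2[OF 1 2])
  have 4: "((\<lambda>s. s powr (- 5 / 3)) has_real_derivative - 5 / 3 * s powr (- 5 / 3 - 1)) (at s)"
    by (rule has_real_derivative_powr[OF assms])
  have "(- 5 / 3 - 1 :: real) = - 8 / 3" by simp
  with DERIV_mult[OF 3 4] show ?thesis
    unfolding cutoff_def[abs_def] cutoff'_def by (simp add: power2_eq_square mult_ac)
qed

text \<open>Because \<open>m\<close> is at most \<open>s\<close>, the factor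
  \<open>2 * s - 5 / 3 * m\<close> in the derivative is at least \<open>s / 3\<close>; this uses
  that 5/3 is less than the power 2 of the cutoff. Beyond \<open>2 * \<epsilon>\<close> also
  \<open>m\<close> is at least \<open>s / 2\<close>, which gives the factor 6.\<close>

lemma cutoff_bounds:
  assumes s: "0 < s" and e: "0 < \<epsilon>"
  shows "0 \<le> cutoff \<epsilon> s" "cutoff \<epsilon> s \<le> s powr (1 / 3)" "0 \<le> cutoff' \<epsilon> s"
    "2 * \<epsilon> \<le> s \<Longrightarrow> s powr (- 2 / 3) \<le> 6 * cutoff' \<epsilon> s"
proof -
  define m where "m = max 0 (s - \<epsilon>)"
  have m: "0 \<le> m" "m \<le> s" using s e by (auto simp: m_def)
  define X where "X = s powr (- 8 / 3)"
  have X: "0 < X" using s by (simp add: X_def)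
  have sX: "s powr (- 5 / 3) = s * X"
    using s powr_add[of s 1 "- 8 / 3"] by (simp add: X_def)
  show "0 \<le> cutoff \<epsilon> s" by (simp add: cutoff_def)
  have "m\<^sup>2 * s powr (- 5 / 3) \<le> s\<^sup>2 * s powr (- 5 / 3)"
    using m by (intro mult_right_mono power_mono) auto
  also have "\<dots> = s powr (1 / 3)"
    using s powr_add[of s 2 "- 5 / 3"] by (simp add: powr_numeral)
  finally show "cutoff \<epsilon> s \<le> s powr (1 / 3)" by (simp add: cutoff_def m_def)
  have eq: "cutoff' \<epsilon> s = m * (2 * s - 5 / 3 * m) * X"
    unfolding cutoff'_def m_def[symmetric] sX by (simp add: X_def power2_eq_square algebra_simps)
  have low: "m * (s / 3) * X \<le> cutoff' \<epsilon> s"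
    unfolding eq using m X by (intro mult_right_mono mult_left_mono) auto
  show "0 \<le> cutoff' \<epsilon> s" using low m X s by (smt (verit) divide_nonneg_nonneg mult_nonneg_nonneg)
  show "s powr (- 2 / 3) \<le> 6 * cutoff' \<epsilon> s" if "2 * \<epsilon> \<le> s"
  proof -
    have "s / 2 \<le> s - \<epsilon>" using that by simp
    then have "s / 2 \<le> m" unfolding m_def by linarith
    then have "s / 2 * (s / 3) * X \<le> m * (s / 3) * X" using s X by (intro mult_right_mono) auto
    moreover have "s powr (- 2 / 3) = s\<^sup>2 * X"
      using s powr_add[of s 2 "- 8 / 3"] by (simp add: X_def powr_numeral)
    moreover have "6 * (s / 2 * (s / 3) * X) = s\<^sup>2 * X" by (simp add: power2_eq_square)
    ultimately show ?thesis using low by linarith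
  qed
qed

lemma cutoff_continuous: "continuous_on {0<..} (cutoff \<epsilon>)" "continuous_on {0<..} (cutoff' \<epsilon>)"
  unfolding cutoff_def[abs_def] cutoff'_def[abs_def] by (auto intro!: continuous_intros)

text \<open>The divergence of the gradient of \<open>u\<close> times
  \<open>cutoff \<epsilon> (- u)\<close> is \<open>CARD('n) * Q - P\<close>, by the equation for
  \<open>u\<close>. Each coordinate part is a line derivative of a compactly supported function and
  integrates to zero.\<close>

lemma torsion_cutoff_identity:
  fixes \<Omega> :: "(real ^ 'n::finite) set"
  assumes T: "torsion_domain r d \<Omega> u" and e: "0 < \<epsilon>"
  defines "P \<equiv> \<lambda>x. if x \<in> \<Omega> then cutoff' \<epsilon> (- u x) * (\<Sum>i\<in>UNIV. (partial_deriv i u x)\<^sup>2) else 0"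
    and "Q \<equiv> \<lambda>x. if x \<in> \<Omega> then cutoff \<epsilon> (- u x) else 0"
  shows "integrable lborel P" "integrable lborel Q" "(LINT x|lborel. P x) = CARD('n) * (LINT x|lborel. Q x)"
proof -
  note TD = torsion_domainD[OF T]
  have u0: "continuous_on \<Omega> u" using TD(9) closure_subset by (rule continuous_on_subset)
  have u1: "continuous_on \<Omega> (partial_deriv i u)" for i
    using TD(8) by (intro continuous_at_imp_continuous_on ballI differentiable_imp_continuous_within) (auto simp: C2_on_def)
  have u2: "continuous_on \<Omega> (partial_deriv i (partial_deriv j u))" for i j
    using TD(8) by (auto simp: C2_on_def)
  have neg: "0 < - u x" if "x \<in> \<Omega>" for x using torsion_negative[OF T that] by simp
  have c: "continuous_on \<Omega> (\<lambda>x. cutoff \<epsilon> (- u x))" "continuous_on \<Omega> (\<lambda>x. cutoff' \<epsilon> (- u x))"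
    by (rule continuous_on_compose2[OF cutoff_continuous(1)] continuous_on_compose2[OF cutoff_continuous(2)];
        use neg in \<open>auto intro!: continuous_intros u0\<close>)+
  \<comment> \<open>On \<open>V\<close> the cutoff vanishes wherever it is evaluated. As
    \<open>u\<close> is zero on the frontier, \<open>V\<close> is an open set that covers the space
    together with the domain, so extension by zero is continuous.\<close>
  define V where "V = - {x \<in> closure \<Omega>. u x \<le> - \<epsilon>}"
  have V: "open V"
    unfolding V_def
    using continuous_on_closed_Collect_le[OF TD(9) continuous_on_const closed_closure] by (simp add: open_Compl)
  have UV: "\<Omega> \<union> V = UNIV"
  proof -
    have "x \<in> V" if "x \<notin> \<Omega>" for x
    proof (cases "x \<in> closure \<Omega>")
      case True
      then have "x \<in> frontier \<Omega>" using that TD(1) by (simp add: frontier_def interior_open)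
      then show ?thesis using TD(11) e by (simp add: V_def)
    qed (simp add: V_def)
    then show ?thesis by blast
  qed
  have zero: "cutoff \<epsilon> (- u x) = 0" "cutoff' \<epsilon> (- u x) = 0" if "x \<in> \<Omega>" "x \<in> V" for x
  proof -
    have "max 0 (- u x - \<epsilon>) = 0" using that closure_subset[of \<Omega>] by (auto simp: V_def)
    then show "cutoff \<epsilon> (- u x) = 0" "cutoff' \<epsilon> (- u x) = 0" by (simp_all add: cutoff_def cutoff'_def)
  qed
  have ext: "continuous_on UNIV (\<lambda>x. if x \<in> \<Omega> then f x else 0)"
    if "continuous_on \<Omega> f" "\<And>x. x \<in> \<Omega> \<Longrightarrow> x \<in> V \<Longrightarrow> f x = 0" for f :: "real ^ 'n \<Rightarrow> real"
  proof -
    have c1: "continuous_on \<Omega> (\<lambda>x. if x \<in> \<Omega> then f x else 0)"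
      using that(1) by (rule continuous_on_eq) auto
    have c2: "continuous_on V (\<lambda>x. if x \<in> \<Omega> then f x else 0)"
      by (rule continuous_on_eq[of _ "\<lambda>_. 0"]) (use that(2) in auto)
    show ?thesis using continuous_on_open_Un[OF TD(1) V c1 c2] unfolding UV .
  qed
  obtain b where b: "\<And>x. x \<in> \<Omega> \<Longrightarrow> norm x \<le> b" using TD(3) unfolding bounded_iff by blast
  define R where "R = max 0 b + 1"
  have R: "0 < R" by (simp add: R_def)
  have out: "x \<notin> \<Omega>" if "R \<le> norm x" for x using b[of x] that by (auto simp: R_def)
  have Pc: "continuous_on UNIV P"
    unfolding P_def by (rule ext) (auto intro!: continuous_intros c u1 simp: zero)
  show Pi: "integrable lborel P"
    by (rule integrable_compact_support[OF Pc, of R]) (use out in \<open>auto simp: P_def\<close>)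
  have Qc: "continuous_on UNIV Q"
    unfolding Q_def by (rule ext) (auto intro!: continuous_intros c simp: zero)
  show Qi: "integrable lborel Q"
    by (rule integrable_compact_support[OF Qc, of R]) (use out in \<open>auto simp: Q_def\<close>)
  define F' where "F' i x = (if x \<in> \<Omega> then - cutoff' \<epsilon> (- u x) * (partial_deriv i u x)\<^sup>2 + cutoff \<epsilon> (- u x) * partial_deriv i (partial_deriv i u) x else 0)" for i x
  have F'c: "continuous_on UNIV (F' i)" for i
    unfolding F'_def by (rule ext) (auto intro!: continuous_intros c u1 u2 simp: zero)
  have F'i: "integrable lborel (F' i)" for i
    by (rule integrable_compact_support[OF F'c, of R]) (use out in \<open>auto simp: F'_def\<close>)
  have F'0: "(LINT x|lborel. F' i x) = 0" for i
  proof -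
    define F where "F x = (if x \<in> \<Omega> then cutoff \<epsilon> (- u x) * partial_deriv i u x else 0)" for x
    show ?thesis
    proof (rule integral_line_derivative_zero[of F "F' i" R "axis i 1"])
      show "continuous_on UNIV F"
        unfolding F_def by (rule ext) (auto intro!: continuous_intros c u1 simp: zero)
      show "continuous_on UNIV (F' i)" by (rule F'c)
      show "F x = 0" "F' i x = 0" if "R \<le> norm x" for x using out[OF that] by (auto simp: F_def F'_def)
      show "0 < R" by (rule R)
      fix x :: "real ^ 'n"
      have lim: "((\<lambda>s. x + s *\<^sub>R axis i 1) \<longlongrightarrow> x + 0 *\<^sub>R axis i 1) (nhds (0::real))"
        by (intro tendsto_intros filterlim_ident)
      show "((\<lambda>s. F (x + s *\<^sub>R axis i 1)) has_real_derivative F' i x) (at 0)"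
      proof (cases "x \<in> \<Omega>")
        case True
        then have "\<forall>\<^sub>F s in nhds (0::real). x + s *\<^sub>R axis i 1 \<in> \<Omega>"
          using lim TD(1) by (intro topological_tendstoD) auto
        then have ev: "\<forall>\<^sub>F s in nhds (0::real). cutoff \<epsilon> (- u (x + s *\<^sub>R axis i 1)) * partial_deriv i u (x + s *\<^sub>R axis i 1) = F (x + s *\<^sub>R axis i 1)"
          by eventually_elim (simp add: F_def)
        have d1: "((\<lambda>s. - u (x + s *\<^sub>R axis i 1)) has_real_derivative - partial_deriv i u (x + 0 *\<^sub>R axis i 1)) (at 0)"
          by (intro DERIV_minus partial_deriv_line) (use C2_onD(1)[OF TD(8) True] in simp)
        have d2: "((\<lambda>s. partial_deriv i u (x + s *\<^sub>R axis i 1)) has_real_derivative partial_deriv i (partial_deriv i u) (x + 0 *\<^sub>R axis i 1)) (at 0)"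
          by (intro partial_deriv_line) (use C2_onD(2)[OF TD(8) True] in simp)
        have d0: "(cutoff \<epsilon> has_real_derivative cutoff' \<epsilon> (- u (x + 0 *\<^sub>R axis i 1))) (at (- u (x + 0 *\<^sub>R axis i 1)))"
          by (rule cutoff_derivative) (use neg[OF True] in simp)
        have "((\<lambda>s. cutoff \<epsilon> (- u (x + s *\<^sub>R axis i 1)) * partial_deriv i u (x + s *\<^sub>R axis i 1)) has_real_derivative F' i x) (at 0)"
          using DERIV_mult[OF DERIV_chain2[OF d0 d1] d2] True by (simp add: F'_def power2_eq_square mult_ac)
        then show ?thesis using DERIV_cong_ev[OF refl ev refl] by blast
      next
        case False
        then have "x \<in> V" using UV by blast
        then have "\<forall>\<^sub>F s in nhds (0::real). x + s *\<^sub>R axis i 1 \<in> V"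
          using lim V by (intro topological_tendstoD) auto
        then have ev: "\<forall>\<^sub>F s in nhds (0::real). 0 = F (x + s *\<^sub>R axis i 1)"
          by eventually_elim (simp add: F_def zero)
        have "((\<lambda>s. 0) has_real_derivative F' i x) (at 0)" using False by (simp add: F'_def)
        then show ?thesis using DERIV_cong_ev[OF refl ev refl] by blast
      qed
    qed
  qed
  have sum: "(\<Sum>i\<in>UNIV. F' i x) = CARD('n) * Q x - P x" for x
  proof (cases "x \<in> \<Omega>")
    case True
    have lap: "(\<Sum>i\<in>UNIV. partial_deriv i (partial_deriv i u) x) = CARD('n)"
      using T True by (simp add: torsion_domain_def solves_torsion_problem_def laplacian_def)
    have "(\<Sum>i\<in>UNIV. F' i x) = - cutoff' \<epsilon> (- u x) * (\<Sum>i\<in>UNIV. (partial_deriv i u x)\<^sup>2) +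
        cutoff \<epsilon> (- u x) * (\<Sum>i\<in>UNIV. partial_deriv i (partial_deriv i u) x)"
      using True by (simp add: F'_def sum.distrib sum_distrib_left sum_negf sum_subtractf)
    then show ?thesis using True unfolding lap by (simp add: P_def Q_def)
  qed (simp add: F'_def P_def Q_def)
  have "0 = (\<Sum>i\<in>UNIV. (LINT x|lborel. F' i x))" by (simp add: F'0)
  also have "\<dots> = (LINT x|lborel. (\<Sum>i\<in>UNIV. F' i x))"
    by (rule Bochner_Integration.integral_sum[symmetric]) (rule F'i)
  also have "\<dots> = CARD('n) * (LINT x|lborel. Q x) - (LINT x|lborel. P x)"
    unfolding sum using Pi Qi by simp
  finally show "(LINT x|lborel. P x) = CARD('n) * (LINT x|lborel. Q x)" by simp
qed

text \<open>Near the boundary \<open>- u\<close> is at most \<open>G\<close> times the distance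
  \<delta>, so \<open>\<delta> powr (- 2 / 3)\<close> is controlled by the same power of
  \<open>- u\<close>, hence by the derivative of the cutoff, and the lower gradient bound turns this
  into \<open>P\<close>. The integral of \<open>P\<close> is a multiple of that of \<open>Q\<close>,
  which is bounded uniformly in \<epsilon>; monotone convergence removes the cutoff.\<close>

lemma torsion_hess_bound:
  assumes r: "0 < r"
  obtains K where "0 \<le> K"
    "\<And>(\<Omega> :: (real ^ 'n) set) u z a. torsion_domain r d \<Omega> u \<Longrightarrow> hess_bound \<Omega> (comparison_fun u z a) K"
proof -
  obtain C where C: "0 \<le> C"
    "\<And>(\<Omega> :: (real ^ 'n) set) u z a x i j. \<lbrakk>torsion_domain r d \<Omega> u; x \<in> \<Omega>\<rbrakk> \<Longrightarrow>
       \<bar>partial_deriv j (partial_deriv i (comparison_fun u z a)) x\<bar> \<le> C * infdist x (frontier \<Omega>) powr (- 1 / 3)"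
    using torsion_hessian_bound[OF r, where 'n = 'n and d = d] by metis
  obtain t0 c0 where tc: "0 < t0" "0 < c0"
    "\<And>(\<Omega> :: (real ^ 'n) set) u x. \<lbrakk>torsion_domain r d \<Omega> u; x \<in> \<Omega>; infdist x (frontier \<Omega>) \<le> t0\<rbrakk>
       \<Longrightarrow> c0 \<le> (\<Sum>i\<in>UNIV. (partial_deriv i u x)\<^sup>2)"
    using torsion_gradient_lower_bound[OF r, where 'n = 'n and d = d] by metis
  obtain G where G: "0 < G"
    "\<And>(\<Omega> :: (real ^ 'n) set) u x p. \<lbrakk>torsion_domain r d \<Omega> u; p \<in> frontier \<Omega>; x \<in> closure \<Omega>\<rbrakk>
       \<Longrightarrow> \<bar>u x\<bar> \<le> G * norm (x - p)"
    using torsion_boundary_growth[OF r, where 'n = 'n and d = d] by metis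
  define V where "V = measure lborel (cball (0 :: real ^ 'n) \<bar>d\<bar>)"
  \<comment> \<open>The 6 comes from \<open>cutoff_bounds\<close>, the power of \<open>G\<close>
    from replacing \<delta> by \<open>- u\<close>, and \<open>c0\<close> from the lower gradient
    bound.\<close>
  define c1 where "c1 = 6 * G powr (2 / 3) / c0"
  have c1: "0 < c1" using G tc by (simp add: c1_def)
  define Z where "Z = C\<^sup>2 * (t0 powr (- 2 / 3) * V + c1 * (CARD('n) * ((G * \<bar>d\<bar>) powr (1 / 3) * V)))"
  have Z0: "0 \<le> Z" using c1 tc by (simp add: Z_def V_def)
  have main: "(\<integral>\<^sup>+y\<in>\<Omega>. ennreal ((partial_deriv i (partial_deriv j (comparison_fun u z a)) y)\<^sup>2) \<partial>lborel) \<le> ennreal Z"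
    if T: "torsion_domain r d \<Omega> u" for \<Omega> :: "(real ^ 'n) set" and u z a i j
  proof -
    note TD = torsion_domainD[OF T]
    note h = torsion_comparison_harmonic[OF T]
    define f where "f y = (partial_deriv i (partial_deriv j (comparison_fun u z a)) y)\<^sup>2" for y
    \<comment> \<open>The sets where \<open>- u\<close> is at least \<open>2 * \<epsilon>\<close>
      for \<open>\<epsilon> = 1 / Suc n\<close>, so that the lower bound on \<open>cutoff'\<close>
      holds; they are closed and exhaust the domain because \<open>u\<close> is negative
      inside.\<close>
    define Wn where "Wn n = {x \<in> \<Omega>. 2 / real (Suc n) \<le> - u x}" for n
    obtain x0 where x0: "x0 \<in> \<Omega>" using TD(4) by blast
    have sub: "\<Omega> \<subseteq> cball x0 \<bar>d\<bar>"
    proof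
      fix y assume "y \<in> \<Omega>"
      then show "y \<in> cball x0 \<bar>d\<bar>"
        using TD(7) TD(12)[of x0 y] x0 closure_subset[of \<Omega>] by (auto simp: dist_norm)
    qed
    have V: "measure lborel (cball x0 \<bar>d\<bar>) = V" by (simp add: V_def content_cball)
    have Wc: "closed (Wn n)" for n
    proof -
      have "Wn n = {x \<in> closure \<Omega>. u x \<le> - (2 / real (Suc n))}"
        using TD(1,11) closure_subset[of \<Omega>] by (fastforce simp: Wn_def frontier_def interior_open)
      then show ?thesis using continuous_on_closed_Collect_le[OF TD(9) continuous_on_const closed_closure] by simp
    qed
    have W\<Omega>: "Wn n \<subseteq> \<Omega>" for n by (auto simp: Wn_def)
    have fc: "continuous_on \<Omega> f" unfolding f_def by (intro continuous_intros h(7))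
    define fn where "fn n y = ennreal (indicat_real (Wn n) y *\<^sub>R f y)" for n y
    have fnm: "fn n \<in> borel_measurable lborel" for n
    proof -
      have "(\<lambda>y. indicat_real (Wn n) y *\<^sub>R f y) \<in> borel_measurable borel"
        by (rule borel_measurable_continuous_on_indicator) (use Wc continuous_on_subset[OF fc W\<Omega>] in auto)
      then show ?thesis unfolding fn_def by simp
    qed
    have inc: "incseq fn"
    proof (rule incseq_SucI)
      fix n
      have "Wn n \<subseteq> Wn (Suc n)"
      proof
        fix x assume x: "x \<in> Wn n"
        have "2 / real (Suc (Suc n)) \<le> 2 / real (Suc n)" by (intro divide_left_mono) auto
        then show "x \<in> Wn (Suc n)" using x by (auto simp: Wn_def)
      qed
      then show "fn n \<le> fn (Suc n)"
        by (auto simp: le_fun_def fn_def f_def indicator_def)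
    qed
    have fnb: "(\<integral>\<^sup>+y. fn n y \<partial>lborel) \<le> ennreal Z" for n
    proof -
      define \<epsilon> where "\<epsilon> = 1 / real (Suc n)"
      have e: "0 < \<epsilon>" by (simp add: \<epsilon>_def)
      define P where "P x = (if x \<in> \<Omega> then cutoff' \<epsilon> (- u x) * (\<Sum>i\<in>UNIV. (partial_deriv i u x)\<^sup>2) else 0)" for x
      define Q where "Q x = (if x \<in> \<Omega> then cutoff \<epsilon> (- u x) else 0)" for x
      note id = torsion_cutoff_identity[OF T e, folded P_def[abs_def] Q_def[abs_def]]
      have neg: "0 < - u x" if "x \<in> \<Omega>" for x using torsion_negative[OF T that] by simp
      have P0: "0 \<le> P x" for x
        using cutoff_bounds(3)[OF neg e] by (auto simp: P_def intro!: mult_nonneg_nonneg sum_nonneg)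
      have uG: "- u x \<le> G * infdist x (frontier \<Omega>)" if "x \<in> \<Omega>" for x
      proof -
        obtain p where "p \<in> frontier \<Omega>" "dist x p = infdist x (frontier \<Omega>)"
          using nearest_boundary_point[OF TD(3,4)] by blast
        then show ?thesis using G(2)[OF T, of p x] that closure_subset[of \<Omega>] by (fastforce simp: dist_norm)
      qed
      have uGd: "- u x \<le> G * \<bar>d\<bar>" if "x \<in> \<Omega>" for x
      proof -
        obtain p where p: "p \<in> frontier \<Omega>" using frontier_not_empty_bounded[OF TD(3,4)] by blast
        have x: "x \<in> closure \<Omega>" using that closure_subset by blast
        have "G * norm (x - p) \<le> G * \<bar>d\<bar>" using G(1) TD(12)[OF x TD(14)[OF p]] by (intro mult_left_mono) auto
        then show ?thesis using G(2)[OF T p x] by linarith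
      qed
      let ?B = "indicat_real (cball x0 \<bar>d\<bar>)"
      have "(LINT x|lborel. Q x) \<le> (LINT x|lborel. (G * \<bar>d\<bar>) powr (1 / 3) * ?B x)"
      proof (rule integral_mono[OF id(2)])
        show "integrable lborel (\<lambda>x. (G * \<bar>d\<bar>) powr (1 / 3) * ?B x)"
          by (intro integrable_mult_right integrable_indicator_cball)
        fix x
        show "Q x \<le> (G * \<bar>d\<bar>) powr (1 / 3) * ?B x"
        proof (cases "x \<in> \<Omega>")
          case True
          have "cutoff \<epsilon> (- u x) \<le> (- u x) powr (1 / 3)" by (rule cutoff_bounds(2)[OF neg[OF True] e])
          also have "\<dots> \<le> (G * \<bar>d\<bar>) powr (1 / 3)"
            using uGd[OF True] neg[OF True] by (intro powr_mono2) auto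
          finally show ?thesis using True sub by (auto simp: Q_def indicator_def)
        qed (simp add: Q_def)
      qed
      then have Qb: "(LINT x|lborel. Q x) \<le> (G * \<bar>d\<bar>) powr (1 / 3) * V" using V by simp
      \<comment> \<open>The first summand dominates at distance more than \<open>t0\<close> from the
        boundary, the second in the boundary layer.\<close>
      define g where "g x = C\<^sup>2 * (t0 powr (- 2 / 3) * ?B x + c1 * P x)" for x
      have gi: "integrable lborel g"
        unfolding g_def by (intro integrable_mult_right Bochner_Integration.integrable_add integrable_indicator_cball id(1))
      have g0: "0 \<le> g x" for x using P0[of x] c1 by (simp add: g_def)
      have fg: "fn n y \<le> ennreal (g y)" for y
      proof (cases "y \<in> Wn n")
        case True
        then have y: "y \<in> \<Omega>" "2 * \<epsilon> \<le> - u y" by (auto simp: Wn_def \<epsilon>_def)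
        define \<delta> where "\<delta> = infdist y (frontier \<Omega>)"
        have dl: "0 < \<delta>" using infdist_frontier_pos[OF TD(1,3) y(1)] by (simp add: \<delta>_def)
        have "f y \<le> (C * \<delta> powr (- 1 / 3))\<^sup>2"
          unfolding f_def \<delta>_def using power_mono[OF C(2)[OF T y(1)] abs_ge_zero, of _ _ _ _ 2] by simp
        also have "\<dots> = C\<^sup>2 * \<delta> powr (- 2 / 3)"
          by (simp add: power_mult_distrib power2_eq_square powr_add[symmetric])
        also have "\<delta> powr (- 2 / 3) \<le> t0 powr (- 2 / 3) + c1 * P y"
        proof (cases "\<delta> \<le> t0")
          case True
          have W: "c0 \<le> (\<Sum>i\<in>UNIV. (partial_deriv i u y)\<^sup>2)" using tc(3)[OF T y(1)] True by (simp add: \<delta>_def)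
          have "\<delta> = G * \<delta> / G" using G by simp
          then have "\<delta> powr (- 2 / 3) = (G * \<delta>) powr (- 2 / 3) * G powr (2 / 3)"
            using G dl powr_divide[of "G * \<delta>" G "- 2 / 3"] by (simp add: powr_minus field_simps)
          also have "\<dots> \<le> (- u y) powr (- 2 / 3) * G powr (2 / 3)"
            using uG[OF y(1)] neg[OF y(1)] by (intro mult_right_mono powr_mono2') (auto simp: \<delta>_def)
          also have "\<dots> \<le> 6 * cutoff' \<epsilon> (- u y) * G powr (2 / 3)"
            by (intro mult_right_mono cutoff_bounds(4) neg y e) auto
          also have "\<dots> = c1 * (cutoff' \<epsilon> (- u y) * c0)" using tc by (simp add: c1_def)
          also have "\<dots> \<le> c1 * P y"
            unfolding P_def using y(1) c1 W cutoff_bounds(3)[OF neg[OF y(1)] e] by (simp add: mult_left_mono)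
          finally show ?thesis by (simp add: add_increasing)
        next
          case False
          then have "\<delta> powr (- 2 / 3) \<le> t0 powr (- 2 / 3)" using tc by (intro powr_mono2') auto
          moreover have "0 \<le> c1 * P y" using c1 P0[of y] by simp
          ultimately show ?thesis by linarith
        qed
        finally have "f y \<le> g y"
          using y(1) sub C(1) by (auto simp: g_def indicator_def mult_left_mono)
        then show ?thesis using True by (simp add: fn_def ennreal_leI)
      qed (simp add: fn_def)
      have "(\<integral>\<^sup>+y. fn n y \<partial>lborel) \<le> (\<integral>\<^sup>+y. ennreal (g y) \<partial>lborel)" by (intro nn_integral_mono fg)
      also have "\<dots> = ennreal (LINT y|lborel. g y)" by (rule nn_integral_eq_integral[OF gi]) (simp add: g0)
      also have "(LINT y|lborel. g y) = C\<^sup>2 * (t0 powr (- 2 / 3) * V + c1 * (LINT x|lborel. P x))"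
      proof -
        have "(LINT x|lborel. t0 powr (- 2 / 3) * ?B x + c1 * P x) =
            (LINT x|lborel. t0 powr (- 2 / 3) * ?B x) + (LINT x|lborel. c1 * P x)"
          by (intro Bochner_Integration.integral_add integrable_mult_right integrable_indicator_cball id(1))
        then show ?thesis unfolding g_def using V by simp
      qed
      \<comment> \<open>Only here is the divergence identity used: it replaces the integral of
        \<open>P\<close> by one that is bounded independently of \<epsilon>.\<close>
      also have "\<dots> \<le> Z"
        unfolding Z_def id(3) using Qb c1 by (intro mult_left_mono add_left_mono) auto
      finally show ?thesis by (simp add: ennreal_leI)
    qed
    have "(\<integral>\<^sup>+y\<in>\<Omega>. ennreal (f y) \<partial>lborel) \<le> (\<integral>\<^sup>+y. (SUP n. fn n y) \<partial>lborel)"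
    proof (rule nn_integral_mono)
      fix y
      show "ennreal (f y) * indicator \<Omega> y \<le> (SUP n. fn n y)"
      proof (cases "y \<in> \<Omega>")
        case True
        have u0: "0 < - u y" using torsion_negative[OF T True] by simp
        obtain n where "2 / (- u y) < real n" using reals_Archimedean2 by blast
        then have "2 / (- u y) \<le> real (Suc n)" by simp
        then have "y \<in> Wn n" using True u0 by (simp add: Wn_def field_simps)
        then have "ennreal (f y) = fn n y" by (simp add: fn_def)
        also have "\<dots> \<le> (SUP n. fn n y)" by (rule SUP_upper) simp
        finally show ?thesis using True by simp
      qed simp
    qed
    also have "\<dots> = (SUP n. \<integral>\<^sup>+y. fn n y \<partial>lborel)"
      by (rule nn_integral_monotone_convergence_SUP[OF inc fnm])
    also have "\<dots> \<le> ennreal Z" by (rule SUP_least) (rule fnb)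
    finally show ?thesis by (simp add: f_def)
  qed
  have "hess_bound \<Omega> (comparison_fun u z a) (sqrt Z)"
    if "torsion_domain r d \<Omega> u" for \<Omega> :: "(real ^ 'n) set" and u z a
    using main[OF that] Z0 by (simp add: hess_bound_def)
  moreover have "0 \<le> sqrt Z" using Z0 by simp
  ultimately show ?thesis using that by blast
qed

subsection \<open>The stability estimate\<close>

text \<open>The exponent 1/2 gives an exact square root on all of \<open>[0, \<infinity>]\<close>,
  so the roots in the norms can be removed without any integrability assumption.\<close>

lemma ennreal_powr_half_square: "(ennreal_powr x (1 / 2))\<^sup>2 = x"
proof (cases x)
  case (real y)
  then show ?thesis
    by (auto simp: ennreal_powr_def power2_eq_square ennreal_mult[symmetric] powr_add[symmetric])
next
  case top
  then show ?thesis by (simp add: ennreal_powr_def power2_eq_square)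
qed

lemma hessian_L2_norm_square:
  "(hessian_L2_norm \<Omega> h)\<^sup>2 =
    (\<Sum>i\<in>UNIV. \<Sum>j\<in>UNIV. \<integral>\<^sup>+x\<in>\<Omega>. ennreal ((partial_deriv i (partial_deriv j h) x)\<^sup>2) \<partial>lborel)"
  by (simp add: hessian_L2_norm_def L2_norm_on_def ennreal_powr_half_square)

lemma hess_bound_of_norm:
  assumes "hessian_L2_norm \<Omega> h \<le> ennreal B" "0 \<le> B"
  shows "hess_bound \<Omega> h B"
  unfolding hess_bound_def
proof (intro allI)
  fix i j
  let ?X = "\<lambda>i j. \<integral>\<^sup>+x\<in>\<Omega>. ennreal ((partial_deriv i (partial_deriv j h) x)\<^sup>2) \<partial>lborel"
  have "?X i j \<le> (\<Sum>j\<in>UNIV. ?X i j)" by (rule member_le_sum) auto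
  also have "\<dots> \<le> (\<Sum>i\<in>UNIV. \<Sum>j\<in>UNIV. ?X i j)"
    by (rule member_le_sum[of i UNIV "\<lambda>i. \<Sum>j\<in>UNIV. ?X i j"]) auto
  also have "\<dots> = (hessian_L2_norm \<Omega> h)\<^sup>2" by (rule hessian_L2_norm_square[symmetric])
  also have "\<dots> \<le> (ennreal B)\<^sup>2" using assms(1) by (rule power_mono) simp
  also have "\<dots> = ennreal (B\<^sup>2)" using assms(2) by (simp add: ennreal_power)
  finally show "?X i j \<le> ennreal (B\<^sup>2)" .
qed

lemma norm_le_of_hess_bound:
  fixes \<Omega> :: "(real ^ 'n::finite) set" and K :: real
  assumes "hess_bound \<Omega> h K" "0 \<le> K"
  shows "hessian_L2_norm \<Omega> h \<le> ennreal (CARD('n) * K)"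
proof -
  let ?X = "\<lambda>i j. \<integral>\<^sup>+x\<in>\<Omega>. ennreal ((partial_deriv i (partial_deriv j h) x)\<^sup>2) \<partial>lborel"
  have "(hessian_L2_norm \<Omega> h)\<^sup>2 = (\<Sum>i\<in>UNIV. \<Sum>j\<in>UNIV. ?X i j)" by (rule hessian_L2_norm_square)
  also have "\<dots> \<le> (\<Sum>i\<in>(UNIV::'n set). \<Sum>j\<in>(UNIV::'n set). ennreal (K\<^sup>2))"
    using assms(1) by (intro sum_mono) (simp add: hess_bound_def)
  also have "\<dots> = (ennreal (CARD('n) * K))\<^sup>2"
    using assms(2) by (simp add: ennreal_power ennreal_mult power_mult_distrib power2_eq_square ennreal_of_nat_eq_real_of_nat mult_ac)
  finally have sq: "(hessian_L2_norm \<Omega> h)\<^sup>2 \<le> (ennreal (CARD('n) * K))\<^sup>2" .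
  show ?thesis
  proof (cases "hessian_L2_norm \<Omega> h")
    case (real A)
    have "ennreal (A\<^sup>2) \<le> ennreal ((CARD('n) * K)\<^sup>2)"
      using sq real assms(2) by (simp add: ennreal_power)
    then have "A\<^sup>2 \<le> (CARD('n) * K)\<^sup>2" by (simp add: ennreal_le_iff)
    then have "A \<le> CARD('n) * K" by (rule power2_le_imp_le) (use assms(2) in simp)
    then show ?thesis using real by (simp add: ennreal_leI)
  next
    case top
    then show ?thesis using sq by (simp add: top_unique power2_eq_square ennreal_mult_eq_top_iff)
  qed
qed

text \<open>The trivial bound takes over when the power of the norm is bounded from below: for large
  norms with a positive exponent, and for all norms otherwise.\<close>

lemma rho_difference_le_diameter:
  assumes T: "torsion_domain r d \<Omega> u" and z: "z \<in> \<Omega>"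
  shows "rho_e \<Omega> z - rho_i \<Omega> z \<le> d"
proof -
  note TD = torsion_domainD[OF T]
  have ne: "frontier \<Omega> \<noteq> {}" using frontier_not_empty_bounded[OF TD(3,4)] .
  have zc: "z \<in> closure \<Omega>" using z closure_subset by blast
  have "rho_e \<Omega> z \<le> d"
    unfolding rho_e_def using ne TD(12)[OF TD(14) zc] by (intro cSUP_least) auto
  moreover have "0 \<le> rho_i \<Omega> z"
    unfolding rho_i_def using ne by (intro cINF_greatest) auto
  ultimately show ?thesis by linarith
qed

lemma torsion_domain_of_sphere_conditions:
  assumes "C2_bounded_domain \<Omega>" "interior_sphere_condition \<Omega> r\<^sub>i" "exterior_sphere_condition \<Omega> r\<^sub>e"
    "diameter \<Omega> = d" "solves_torsion_problem \<Omega> u"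
  shows "torsion_domain (min r\<^sub>i r\<^sub>e) d \<Omega> u"
  using assms two_balls_of_sphere_conditions
  by (auto simp: torsion_domain_def C2_bounded_domain_def)

text \<open>The oscillation estimate covers norms in \<open>(0, 1]\<close>. Larger finite norms are
  covered by the diameter bound, an infinite norm makes the right-hand side infinite, and the norm
  zero is a limiting case.\<close>

lemma stability_positive_exponent:
  assumes r: "0 < r" and dl: "0 < \<delta>" and \<tau>: "0 < \<tau>" "\<tau> \<le> 1"
    and N: "CARD('n) / 2 \<le> (if \<tau> = 1 then 3 / 2 else 1 + 1 / \<tau>)"
  obtains C where "0 < C"
    "\<And>(\<Omega> :: (real ^ 'n) set) u z a. \<lbrakk>torsion_domain r d \<Omega> u; critical_point u z; z \<in> \<Omega>; infdist z (frontier \<Omega>) = \<delta>\<rbrakk>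
      \<Longrightarrow> ennreal (rho_e \<Omega> z - rho_i \<Omega> z) \<le> ennreal C * ennreal_powr (hessian_L2_norm \<Omega> (comparison_fun u z a)) \<tau>"
proof -
  obtain C1 where C1: "0 \<le> C1"
    "\<And>(\<Omega> :: (real ^ 'n) set) u z a B p. \<lbrakk>torsion_domain r d \<Omega> u; 0 < B; B \<le> 1; hess_bound \<Omega> (comparison_fun u z a) B;
       critical_point u z; z \<in> \<Omega>; infdist z (frontier \<Omega>) = \<delta>; p \<in> frontier \<Omega>\<rbrakk>
       \<Longrightarrow> \<bar>comparison_fun u z a p - comparison_fun u z a z\<bar> \<le> C1 * B powr \<tau>"
    using boundary_oscillation[OF r dl \<tau> refl N, where d = d] by metis
  define C0 where "C0 = 2 * C1 / \<delta>"
  have C0: "0 \<le> C0" using C1 dl by (simp add: C0_def)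
  define C where "C = C0 + \<bar>d\<bar> + 1"
  have C: "0 < C" "C0 \<le> C" "d \<le> C" using C0 by (auto simp: C_def)
  have main: "ennreal (rho_e \<Omega> z - rho_i \<Omega> z) \<le> ennreal C * ennreal_powr (hessian_L2_norm \<Omega> (comparison_fun u z a)) \<tau>"
    if T: "torsion_domain r d \<Omega> u" and z: "critical_point u z" "z \<in> \<Omega>" "infdist z (frontier \<Omega>) = \<delta>"
    for \<Omega> :: "(real ^ 'n) set" and u z a
  proof -
    let ?A = "hessian_L2_norm \<Omega> (comparison_fun u z a)" and ?x = "rho_e \<Omega> z - rho_i \<Omega> z"
    have small: "?x \<le> C0 * B powr \<tau>" if B: "0 < B" "B \<le> 1" "?A \<le> ennreal B" for B
    proof -
      have "?x \<le> 2 * (C1 * B powr \<tau>) / \<delta>"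
        by (rule rho_difference_le[OF T z(3) dl], rule C1(2)[OF T B(1,2) _ z])
          (use hess_bound_of_norm[OF B(3)] B(1) in auto)
      then show ?thesis by (simp add: C0_def)
    qed
    show ?thesis
    proof (cases ?A)
      case top
      then show ?thesis using \<tau> C by (simp add: ennreal_powr_def ennreal_mult_top)
    next
      case (real A)
      consider "A = 0" | "0 < A" "A \<le> 1" | "1 < A" using real by linarith
      then show ?thesis
      proof cases
        case 1
        have "?x \<le> 0"
        proof (rule ccontr)
          assume "\<not> ?x \<le> 0"
          then have x: "0 < ?x" by simp
          \<comment> \<open>The estimate \<open>small\<close> asks for a positive \<open>B\<close>;
            this one makes \<open>C0 * B powr \<tau>\<close> at most half of the supposedly positive
            difference.\<close>
          define B where "B = min 1 ((?x / (2 * (C0 + 1))) powr (1 / \<tau>))"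
          have B: "0 < B" "B \<le> 1" using x C0 by (auto simp: B_def)
          have "B powr \<tau> \<le> ((?x / (2 * (C0 + 1))) powr (1 / \<tau>)) powr \<tau>"
            using B \<tau> by (intro powr_mono2) (auto simp: B_def)
          also have "\<dots> = ?x / (2 * (C0 + 1))" using x C0 \<tau> by (simp add: powr_powr)
          finally have "C0 * B powr \<tau> \<le> C0 * (?x / (2 * (C0 + 1)))" using C0 by (intro mult_left_mono)
          also have "\<dots> \<le> (C0 + 1) * (?x / (2 * (C0 + 1)))" using x C0 by (intro mult_right_mono) auto
          also have "\<dots> = ?x / 2"
          proof -
            have h: "q * (y / (2 * q)) = y / 2" if "q \<noteq> 0" for q y :: real using that by simp
            show ?thesis by (rule h) (use C0 in simp)
          qed
          also have "\<dots> < ?x" using x by simp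
          finally show False using small[OF B] 1 real by simp
        qed
        then show ?thesis by (simp add: ennreal_neg)
      next
        case 2
        have "?x \<le> C0 * A powr \<tau>" using small[OF 2] real by simp
        also have "\<dots> \<le> C * A powr \<tau>" using C by (intro mult_right_mono) auto
        finally have "ennreal ?x \<le> ennreal (C * A powr \<tau>)" by (rule ennreal_leI)
        also have "\<dots> = ennreal C * ennreal_powr ?A \<tau>"
          using real 2 \<tau> C by (simp add: ennreal_powr_def ennreal_mult)
        finally show ?thesis .
      next
        case 3
        have "?x \<le> d" by (rule rho_difference_le_diameter[OF T z(2)])
        also have "d \<le> C * 1" using C by simp
        also have "\<dots> \<le> C * A powr \<tau>" using C 3 \<tau> by (intro mult_left_mono ge_one_powr_ge_zero) auto
        finally have "ennreal ?x \<le> ennreal (C * A powr \<tau>)" by (rule ennreal_leI)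
        also have "\<dots> = ennreal C * ennreal_powr ?A \<tau>"
          using real 3 \<tau> C by (simp add: ennreal_powr_def ennreal_mult)
        finally show ?thesis .
      qed
    qed
  qed
  from C(1) show ?thesis by (rule that) (rule main)
qed

text \<open>For a negative exponent the right-hand side decreases as the norm grows, so a uniform
  upper bound on the norm bounds it from below, and the diameter bound suffices.\<close>

lemma stability_nonpositive_exponent:
  assumes r: "0 < r" and \<tau>: "\<tau> \<le> 0"
  obtains C where "0 < C"
    "\<And>(\<Omega> :: (real ^ 'n) set) u z a. \<lbrakk>torsion_domain r d \<Omega> u; z \<in> \<Omega>\<rbrakk>
      \<Longrightarrow> ennreal (rho_e \<Omega> z - rho_i \<Omega> z) \<le> ennreal C * ennreal_powr (hessian_L2_norm \<Omega> (comparison_fun u z a)) \<tau>"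
proof -
  obtain K where K: "0 \<le> K"
    "\<And>(\<Omega> :: (real ^ 'n) set) u z a. torsion_domain r d \<Omega> u \<Longrightarrow> hess_bound \<Omega> (comparison_fun u z a) K"
    using torsion_hess_bound[OF r, where 'n = 'n and d = d] by metis
  define M where "M = CARD('n) * K + 1"
  have M: "0 < M" using K by (simp add: M_def add_nonneg_pos)
  define C where "C = (\<bar>d\<bar> + 1) * M powr (- \<tau>)"
  have C: "0 < C" using M by (simp add: C_def add_nonneg_pos)
  have main: "ennreal (rho_e \<Omega> z - rho_i \<Omega> z) \<le> ennreal C * ennreal_powr (hessian_L2_norm \<Omega> (comparison_fun u z a)) \<tau>"
    if T: "torsion_domain r d \<Omega> u" and z: "z \<in> \<Omega>" for \<Omega> :: "(real ^ 'n) set" and u z a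
  proof -
    let ?A = "hessian_L2_norm \<Omega> (comparison_fun u z a)" and ?x = "rho_e \<Omega> z - rho_i \<Omega> z"
    have x: "?x \<le> \<bar>d\<bar> + 1" using rho_difference_le_diameter[OF T z] by linarith
    have "?A \<le> ennreal (CARD('n) * K)" by (rule norm_le_of_hess_bound[OF K(2)[OF T] K(1)])
    also have "\<dots> \<le> ennreal M" by (rule ennreal_leI) (simp add: M_def)
    finally have AM: "?A \<le> ennreal M" .
    then obtain A where A: "?A = ennreal A" "0 \<le> A" by (cases ?A) (auto simp: top_unique)
    then have AM': "A \<le> M" using AM M by simp
    \<comment> \<open>The exponent 0 is separated because \<open>ennreal_powr\<close> is then 1 even
      at the norm zero, and the norm zero because a negative power of it is infinite.\<close>
    consider "\<tau> = 0" | "\<tau> < 0" "A = 0" | "\<tau> < 0" "0 < A" using \<tau> A(2) by linarith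
    then show ?thesis
    proof cases
      case 1
      then have "C = \<bar>d\<bar> + 1" using M by (simp add: C_def)
      then have "ennreal ?x \<le> ennreal C" using x by (intro ennreal_leI) simp
      then show ?thesis using 1 by (simp add: ennreal_powr_def)
    next
      case 2
      then show ?thesis using A C by (simp add: ennreal_powr_def ennreal_mult_top)
    next
      case 3
      have "M powr \<tau> \<le> A powr \<tau>" using 3 AM' by (intro powr_mono2') auto
      then have "(\<bar>d\<bar> + 1) * M powr (- \<tau>) * M powr \<tau> \<le> C * A powr \<tau>"
        unfolding C_def by (intro mult_left_mono) auto
      moreover have "(\<bar>d\<bar> + 1) * M powr (- \<tau>) * M powr \<tau> = \<bar>d\<bar> + 1"
        using M by (simp add: powr_minus)
      ultimately have "ennreal ?x \<le> ennreal (C * A powr \<tau>)" using x by (intro ennreal_leI) linarith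
      also have "\<dots> = ennreal C * ennreal_powr ?A \<tau>"
        using A 3 C by (simp add: ennreal_powr_def ennreal_mult)
      finally show ?thesis .
    qed
  qed
  from C show ?thesis by (rule that) (rule main)
qed

theorem theorem3p20:
  fixes r_i r_e d \<delta> \<tau> :: real
  assumes "CARD('n::finite) \<ge> 2"
    and "(CARD('n) = 2 \<or> CARD('n) = 3) \<and> \<tau> = 1 \<or>
         CARD('n) = 4 \<and> (\<exists>\<theta>>0. \<tau> = 1 - \<theta>) \<or>
         CARD('n) \<ge> 5 \<and> \<tau> = 2 / (real CARD('n) - 2)"
  shows "\<exists>C>0. \<forall>(\<Omega> :: (real ^ 'n) set) u z a.
           C2_bounded_domain \<Omega> \<and>
           interior_sphere_condition \<Omega> r_i \<and>
           exterior_sphere_condition \<Omega> r_e \<and>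
           diameter \<Omega> = d \<and>
           solves_torsion_problem \<Omega> u \<and>
           z \<in> \<Omega> \<and> critical_point u z \<and>
           infdist z (frontier \<Omega>) = \<delta> \<longrightarrow>
           ennreal (rho_e \<Omega> z - rho_i \<Omega> z)
             \<le> ennreal C * ennreal_powr (hessian_L2_norm \<Omega> (comparison_fun u z a)) \<tau>"
proof (cases "0 < min r_i r_e \<and> 0 < \<delta>")
  \<comment> \<open>A nonpositive radius or distance contradicts the hypotheses on the domain and on
    \<open>z\<close>, so any constant will do.\<close>
  case False
  have "0 < min r_i r_e \<and> 0 < \<delta>"
    if "C2_bounded_domain \<Omega>" "interior_sphere_condition \<Omega> r_i" "exterior_sphere_condition \<Omega> r_e"
      "z \<in> \<Omega>" "infdist z (frontier \<Omega>) = \<delta>" for \<Omega> :: "(real ^ 'n) set" and z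
    using that infdist_frontier_pos[of \<Omega> z]
    by (auto simp: interior_sphere_condition_def exterior_sphere_condition_def C2_bounded_domain_def)
  with False show ?thesis by (intro exI[of _ 1]) auto
next
  case True
  define r where "r = min r_i r_e"
  have r: "0 < r" "0 < \<delta>" using True by (auto simp: r_def)
  have "\<exists>C>0. \<forall>(\<Omega> :: (real ^ 'n) set) u z a. torsion_domain r d \<Omega> u \<longrightarrow> critical_point u z \<longrightarrow> z \<in> \<Omega> \<longrightarrow>
      infdist z (frontier \<Omega>) = \<delta> \<longrightarrow> ennreal (rho_e \<Omega> z - rho_i \<Omega> z)
        \<le> ennreal C * ennreal_powr (hessian_L2_norm \<Omega> (comparison_fun u z a)) \<tau>"
  proof (cases "0 < \<tau>")
    case pos: True
    \<comment> \<open>Equality holds in the second inequality for dimension 3 and from dimension 5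
      on; in dimension 4 it reads \<open>2 \<le> 1 + 1 / \<tau>\<close> with \<tau> below 1.\<close>
    have \<tau>: "\<tau> \<le> 1" "CARD('n) / 2 \<le> (if \<tau> = 1 then 3 / 2 else 1 + 1 / \<tau>)"
      using assms(2) pos by (auto simp: field_simps)
    obtain C where C: "0 < C"
      "\<And>(\<Omega> :: (real ^ 'n) set) u z a. \<lbrakk>torsion_domain r d \<Omega> u; critical_point u z; z \<in> \<Omega>; infdist z (frontier \<Omega>) = \<delta>\<rbrakk>
        \<Longrightarrow> ennreal (rho_e \<Omega> z - rho_i \<Omega> z) \<le> ennreal C * ennreal_powr (hessian_L2_norm \<Omega> (comparison_fun u z a)) \<tau>"
      using stability_positive_exponent[OF r pos \<tau>, where d = d] by metis
    show ?thesis by (intro exI[of _ C] conjI allI impI C)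
  next
    \<comment> \<open>Only dimension 4 with \<theta> at least 1 leads here.\<close>
    case False
    then have np: "\<tau> \<le> 0" by simp
    obtain C where C: "0 < C"
      "\<And>(\<Omega> :: (real ^ 'n) set) u z a. \<lbrakk>torsion_domain r d \<Omega> u; z \<in> \<Omega>\<rbrakk>
        \<Longrightarrow> ennreal (rho_e \<Omega> z - rho_i \<Omega> z) \<le> ennreal C * ennreal_powr (hessian_L2_norm \<Omega> (comparison_fun u z a)) \<tau>"
      using stability_nonpositive_exponent[OF r(1) np, where 'n = 'n and d = d] by metis
    show ?thesis by (intro exI[of _ C] conjI allI impI C)
  qed
  then show ?thesis
    using torsion_domain_of_sphere_conditions unfolding r_def by blast
qed

end
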